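(* Let $v\in\mathbb{C}[x,y,z,u]$ be a polynomial such that the morphism $\Phi=(x,v):\mathbb{A}^4_{\mathbb{C}}\to\mathbb{A}^2_{\mathbb{C}}$ is a flat family of affine planes. Let $F_{\bar 0}=\Phi^{-1}(\bar 0)$ be the fiber over the origin $\bar 0\in\mathbb{A}^2_{\mathbb{C}}$. Then the following conditions are equivalent: (i) $v$ is an $x$-variable of the ring $\mathbb{C}[x,y,z,u]$; (ii) $\Phi:\mathbb{A}^4_{\mathbb{C}}\to\mathbb{A}^2_{\mathbb{C}}$ is an algebraic fiber bundle (with fiber $\mathbb{A}^2_{\mathbb{C}}$); (iii) $\Phi:\mathbb{A}^4_{\mathbb{C}}\to\mathbb{A}^2_{\mathbb{C}}$ is a trivial fiber bundle (with fiber $\mathbb{A}^2_{\mathbb{C}}$); (iv) the restriction $\lambda:=\Phi|_{\mathbb{A}^4_{\mathbb{C}}\setminus F_{\bar 0}}:\mathbb{A}^4_{\mathbb{C}}\setminus F_{\bar 0}\to\mathbb{A}^2_{\mathbb{C}}\setminus\{\bar 0\}$ is a trivial fiber bundle (with fiber $\mathbb{A}^2_{\mathbb{C}}$) over $\mathbb{A}^2_{\mathbb{C}}\setminus\{\bar 0\}$.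
   Context: Here $\mathbb{A}^4_{\mathbb{C}}=\operatorname{Spec}\mathbb{C}[x,y,z,u]$. A flat family of affine planes is a flat morphism $f:X\to S$ such that every scheme-theoretic fiber $f^*(s)$, $s\in S$ (closed point), is reduced and isomorphic to $\mathbb{A}^2_{\mathbb{C}}$. An algebraic fiber bundle with fiber $\mathbb{A}^2_{\mathbb{C}}$ over $S$ is a morphism $f:X\to S$ that is Zariski-locally on $S$ isomorphic, over $S$, to the projection of a product with $\mathbb{A}^2_{\mathbb{C}}$; it is trivial if $X\cong S\times\mathbb{A}^2_{\mathbb{C}}$ over $S$. A polynomial $v\in\mathbb{C}[x,y,z,u]$ is an $x$-variable if it is a variable of the $\mathbb{C}[x]$-algebra $\mathbb{C}[x][y,z,u]$, i.e. there exist polynomials $g,h$ with $\mathbb{C}[x][y,z,u]=\mathbb{C}[x][v,g,h]$ (equivalently, $v$ is a coordinate of a $\mathbb{C}[x]$-automorphism of $\mathbb{C}[x][y,z,u]$). *)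

theory Defs
  imports
    "HOL-Analysis.Analysis"
    "HOL-Algebra.Algebra"
    "HOL-Algebra.Algebraic_Closure_Type"
    "HOL-Library.Poly_Mapping"
    "HOL-Library.Numeral_Type"
begin

text \<open>The notation would prevent the use of \<open>X\<close> as a variable.\<close>

no_notation var (\<open>X\<index>\<close>)

section \<open>Polynomial rings\<close>

text \<open>\<open>('n, 'a) mpoly\<close> is the polynomial ring over \<open>'a\<close> in variables indexed by \<open>'n\<close>:
  finitely supported functions from exponent vectors to coefficients.\<close>

type_synonym ('n, 'a) mpoly = "('n \<Rightarrow>\<^sub>0 nat) \<Rightarrow>\<^sub>0 'a"

definition Const :: "'a::comm_ring_1 \<Rightarrow> ('n, 'a) mpoly" where
  "Const a = Poly_Mapping.single 0 a"

definition Var :: "'n \<Rightarrow> ('n, 'a::comm_ring_1) mpoly" where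
  "Var i = Poly_Mapping.single (Poly_Mapping.single i 1) 1"

text \<open>The value of \<open>p\<close> when the coefficients are mapped by \<open>c\<close> and the variable \<open>i\<close> is
  replaced by \<open>g i\<close>.\<close>

definition poly_subst ::
    "('a::comm_ring_1 \<Rightarrow> 'b::comm_ring_1) \<Rightarrow> ('n::finite \<Rightarrow> 'b) \<Rightarrow> ('n, 'a) mpoly \<Rightarrow> 'b" where
  "poly_subst c g p =
    (\<Sum>m\<in>Poly_Mapping.keys p.
       c (Poly_Mapping.lookup p m) * (\<Prod>i\<in>UNIV. g i ^ Poly_Mapping.lookup m i))"

section \<open>Localization at a prime ideal\<close>

text \<open>\<open>fraction R P a s\<close> is the fraction \<open>a/s\<close> as an equivalence class of pairs.\<close>

definition fraction :: "('a, 'm) ring_scheme \<Rightarrow> 'a set \<Rightarrow> 'a \<Rightarrow> 'a \<Rightarrow> ('a \<times> 'a) set" where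
  "fraction R P a s =
    {(b, t). b \<in> carrier R \<and> t \<in> carrier R - P \<and>
       (\<exists>u \<in> carrier R - P. u \<otimes>\<^bsub>R\<^esub> (a \<otimes>\<^bsub>R\<^esub> t) = u \<otimes>\<^bsub>R\<^esub> (b \<otimes>\<^bsub>R\<^esub> s))}"

text \<open>As for \<open>FactRing\<close>, the operations are unions over all representatives; all members of
  such a union coincide.\<close>

definition local_ring_at :: "('a, 'm) ring_scheme \<Rightarrow> 'a set \<Rightarrow> ('a \<times> 'a) set ring" where
  "local_ring_at R P =
    \<lparr>carrier = {fraction R P a s | a s. a \<in> carrier R \<and> s \<in> carrier R - P},
     monoid.mult = (\<lambda>X Y. \<Union>(a, s)\<in>X. \<Union>(b, t)\<in>Y. fraction R P (a \<otimes>\<^bsub>R\<^esub> b) (s \<otimes>\<^bsub>R\<^esub> t)),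
     one = fraction R P \<one>\<^bsub>R\<^esub> \<one>\<^bsub>R\<^esub>,
     ring.zero = fraction R P \<zero>\<^bsub>R\<^esub> \<one>\<^bsub>R\<^esub>,
     add = (\<lambda>X Y. \<Union>(a, s)\<in>X. \<Union>(b, t)\<in>Y.
              fraction R P ((a \<otimes>\<^bsub>R\<^esub> t) \<oplus>\<^bsub>R\<^esub> (b \<otimes>\<^bsub>R\<^esub> s)) (s \<otimes>\<^bsub>R\<^esub> t))\<rparr>"

section \<open>Flat modules\<close>

definition linear_map ::
    "('r, 'k) ring_scheme \<Rightarrow> ('r, 'm) module \<Rightarrow> ('r, 'n) module \<Rightarrow> ('m \<Rightarrow> 'n) \<Rightarrow> bool" where
  "linear_map R M N f \<longleftrightarrow>
    f \<in> carrier M \<rightarrow> carrier N \<and>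
    (\<forall>x\<in>carrier M. \<forall>y\<in>carrier M. f (x \<oplus>\<^bsub>M\<^esub> y) = f x \<oplus>\<^bsub>N\<^esub> f y) \<and>
    (\<forall>r\<in>carrier R. \<forall>x\<in>carrier M. f (r \<odot>\<^bsub>M\<^esub> x) = r \<odot>\<^bsub>N\<^esub> f x)"

text \<open>The tensor product over \<open>R\<close> is the free abelian group on pairs modulo the subgroup
  generated by the bilinearity relations.\<close>

definition tensor_relations ::
    "('r, 'k) ring_scheme \<Rightarrow> ('r, 'n) module \<Rightarrow> ('r, 'm) module \<Rightarrow> ('n \<times> 'm \<Rightarrow>\<^sub>0 int) set" where
  "tensor_relations R N M =
    generate (free_Abelian_group (carrier N \<times> carrier M))
     ({frag_of (x \<oplus>\<^bsub>N\<^esub> x', y) - frag_of (x, y) - frag_of (x', y) | x x' y.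
         x \<in> carrier N \<and> x' \<in> carrier N \<and> y \<in> carrier M} \<union>
      {frag_of (x, y \<oplus>\<^bsub>M\<^esub> y') - frag_of (x, y) - frag_of (x, y') | x y y'.
         x \<in> carrier N \<and> y \<in> carrier M \<and> y' \<in> carrier M} \<union>
      {frag_of (r \<odot>\<^bsub>N\<^esub> x, y) - frag_of (x, r \<odot>\<^bsub>M\<^esub> y) | r x y.
         r \<in> carrier R \<and> x \<in> carrier N \<and> y \<in> carrier M})"

definition tensor_product ::
    "('r, 'k) ring_scheme \<Rightarrow> ('r, 'n) module \<Rightarrow> ('r, 'm) module \<Rightarrow>
     ('n \<times> 'm \<Rightarrow>\<^sub>0 int) set monoid" where
  "tensor_product R N M =
    free_Abelian_group (carrier N \<times> carrier M) Mod tensor_relations R N M"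

text \<open>The map \<open>f \<otimes> id\<close> from \<open>N \<otimes> M\<close> to \<open>N' \<otimes> M\<close> induced by \<open>f\<close>, on cosets.\<close>

definition tensor_map ::
    "('r, 'k) ring_scheme \<Rightarrow> ('r, 'n') module \<Rightarrow> ('r, 'm) module \<Rightarrow> ('n \<Rightarrow> 'n') \<Rightarrow>
     ('n \<times> 'm \<Rightarrow>\<^sub>0 int) set \<Rightarrow> ('n' \<times> 'm \<Rightarrow>\<^sub>0 int) set" where
  "tensor_map R N' M f C =
    (\<Union>c\<in>C. tensor_relations R N' M
       #>\<^bsub>free_Abelian_group (carrier N' \<times> carrier M)\<^esub>
       frag_extend (\<lambda>(x, y). frag_of (f x, y)) c)"

text \<open>Tensoring with \<open>M\<close> preserves injectivity. HOL cannot quantify over modules of all types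
  here. The type \<open>(nat \<Rightarrow> 'r) set\<close> contains a copy of every countably generated \<open>R\<close>-module
  (cosets in a free module of countable rank), in particular of every finitely generated one;
  testing on those is the same as testing on all modules, because a relation in a tensor product
  involves only finitely many elements.\<close>

definition flat_module :: "('r, 'k) ring_scheme \<Rightarrow> ('r, 'm) module \<Rightarrow> bool" where
  "flat_module R M \<longleftrightarrow>
    module R M \<and>
    (\<forall>(N :: ('r, (nat \<Rightarrow> 'r) set) module) (N' :: ('r, (nat \<Rightarrow> 'r) set) module) f.
       module R N \<longrightarrow> module R N' \<longrightarrow> linear_map R N N' f \<longrightarrow> inj_on f (carrier N) \<longrightarrow>
       inj_on (tensor_map R N' M f) (carrier (tensor_product R N M)))"

text \<open>The ring \<open>B\<close> as an \<open>R\<close>-module via \<open>h : R \<rightarrow> B\<close>.\<close>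

definition module_via :: "('r \<Rightarrow> 'b) \<Rightarrow> ('b, 'k) ring_scheme \<Rightarrow> ('r, 'b) module" where
  "module_via h B =
    \<lparr>carrier = carrier B, monoid.mult = (\<otimes>\<^bsub>B\<^esub>), one = \<one>\<^bsub>B\<^esub>, ring.zero = \<zero>\<^bsub>B\<^esub>,
     add = (\<oplus>\<^bsub>B\<^esub>), smult = (\<lambda>r b. h r \<otimes>\<^bsub>B\<^esub> b)\<rparr>"

section \<open>Locally ringed spaces\<close>

text \<open>The structure sheaf is given by its stalks together with, for each open set, the family of
  germs of each section. A section over \<open>U\<close> is thus an element of the product of the stalks over
  \<open>U\<close>; restriction is restriction of functions and the ring operations are pointwise.
  A map of sheaves is determined by the stalk maps, which have to carry sections to sections.\<close>

record ('p, 's) lrspace =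
  space_top :: "'p topology"
  stalk :: "'p \<Rightarrow> 's ring"
  sections :: "'p set \<Rightarrow> ('p \<Rightarrow> 's) set"

text \<open>\<open>costalk f p\<close> maps the stalk at \<open>point f p\<close> to the stalk at \<open>p\<close>.\<close>

record ('p, 's, 'q, 't) lrmap =
  point :: "'p \<Rightarrow> 'q"
  costalk :: "'p \<Rightarrow> 't \<Rightarrow> 's"

abbreviation points :: "('p, 's) lrspace \<Rightarrow> 'p set" where
  "points X \<equiv> topspace (space_top X)"

definition vimage_in :: "('p, 's) lrspace \<Rightarrow> ('p, 's, 'q, 't) lrmap \<Rightarrow> 'q set \<Rightarrow> 'p set" where
  "vimage_in X f V = {p \<in> points X. point f p \<in> V}"

definition morphism ::
    "('p, 's) lrspace \<Rightarrow> ('q, 't) lrspace \<Rightarrow> ('p, 's, 'q, 't) lrmap \<Rightarrow> bool" where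
  "morphism X Y f \<longleftrightarrow>
    continuous_map (space_top X) (space_top Y) (point f) \<and>
    (\<forall>p\<in>points X.
       costalk f p \<in> ring_hom (stalk Y (point f p)) (stalk X p) \<and>
       (\<forall>a\<in>carrier (stalk Y (point f p)).
          costalk f p a \<in> Units (stalk X p) \<longrightarrow> a \<in> Units (stalk Y (point f p)))) \<and>
    (\<forall>V t. openin (space_top Y) V \<longrightarrow> t \<in> sections Y V \<longrightarrow>
       (\<lambda>p\<in>vimage_in X f V. costalk f p (t (point f p))) \<in> sections X (vimage_in X f V))"

definition id_map :: "('p, 's, 'p, 's) lrmap" where
  "id_map = \<lparr>point = (\<lambda>p. p), costalk = (\<lambda>p a. a)\<rparr>"

definition comp_map ::
    "('q, 't, 'r, 'u) lrmap \<Rightarrow> ('p, 's, 'q, 't) lrmap \<Rightarrow> ('p, 's, 'r, 'u) lrmap" where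
  "comp_map g f =
    \<lparr>point = (\<lambda>p. point g (point f p)),
     costalk = (\<lambda>p a. costalk f p (costalk g (point f p) a))\<rparr>"

text \<open>Equality of morphisms \<open>X \<rightarrow> Y\<close>; values outside \<open>X\<close> and outside the stalks are ignored.\<close>

definition eq_map ::
    "('p, 's) lrspace \<Rightarrow> ('q, 't) lrspace \<Rightarrow>
     ('p, 's, 'q, 't) lrmap \<Rightarrow> ('p, 's, 'q, 't) lrmap \<Rightarrow> bool" where
  "eq_map X Y f g \<longleftrightarrow>
    (\<forall>p\<in>points X. point f p = point g p \<and>
       (\<forall>a\<in>carrier (stalk Y (point f p)). costalk f p a = costalk g p a))"

text \<open>\<open>X\<close> and \<open>Y\<close> are isomorphic as spaces over \<open>S\<close>, with structure morphisms \<open>f\<close> and \<open>g\<close>.\<close>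

definition isomorphic_over ::
    "('r, 'u) lrspace \<Rightarrow> ('p, 's) lrspace \<Rightarrow> ('p, 's, 'r, 'u) lrmap \<Rightarrow>
     ('q, 't) lrspace \<Rightarrow> ('q, 't, 'r, 'u) lrmap \<Rightarrow> bool" where
  "isomorphic_over S X f Y g \<longleftrightarrow>
    morphism X S f \<and> morphism Y S g \<and>
    (\<exists>\<alpha> \<beta>. morphism X Y \<alpha> \<and> morphism Y X \<beta> \<and>
       eq_map X X (comp_map \<beta> \<alpha>) id_map \<and> eq_map Y Y (comp_map \<alpha> \<beta>) id_map \<and>
       eq_map X S (comp_map g \<alpha>) f)"

definition open_subspace :: "('p, 's) lrspace \<Rightarrow> 'p set \<Rightarrow> ('p, 's) lrspace" where
  "open_subspace X U = X\<lparr>space_top := subtopology (space_top X) U\<rparr>"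

definition reduced :: "('p, 's) lrspace \<Rightarrow> bool" where
  "reduced X \<longleftrightarrow>
    (\<forall>p\<in>points X. \<forall>a\<in>carrier (stalk X p). \<forall>n::nat.
       a [^]\<^bsub>stalk X p\<^esub> n = \<zero>\<^bsub>stalk X p\<^esub> \<longrightarrow> a = \<zero>\<^bsub>stalk X p\<^esub>)"

definition flat_morphism ::
    "('p, 's) lrspace \<Rightarrow> ('q, 't) lrspace \<Rightarrow> ('p, 's, 'q, 't) lrmap \<Rightarrow> bool" where
  "flat_morphism X Y f \<longleftrightarrow>
    morphism X Y f \<and>
    (\<forall>p\<in>points X. flat_module (stalk Y (point f p)) (module_via (costalk f p) (stalk X p)))"

section \<open>Affine schemes\<close>

definition zariski :: "('a, 'm) ring_scheme \<Rightarrow> 'a set topology" where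
  "zariski R = topology_generated_by {{P. primeideal P R \<and> a \<notin> P} | a. a \<in> carrier R}"

text \<open>Sections over \<open>U\<close> are the functions that are locally given by one fraction.\<close>

definition Spec :: "('a, 'm) ring_scheme \<Rightarrow> ('a set, ('a \<times> 'a) set) lrspace" where
  "Spec R =
    \<lparr>space_top = zariski R,
     stalk = local_ring_at R,
     sections = (\<lambda>U. {s \<in> extensional U.
       \<forall>P\<in>U. \<exists>V a b. openin (zariski R) V \<and> P \<in> V \<and> V \<subseteq> U \<and>
         a \<in> carrier R \<and> b \<in> carrier R \<and> (\<forall>Q\<in>V. b \<notin> Q \<and> s Q = fraction R Q a b)})\<rparr>"

text \<open>The morphism \<open>Spec B \<rightarrow> Spec A\<close> induced by \<open>h : A \<rightarrow> B\<close>; on stalks it sends \<open>a/s\<close> to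
  \<open>h a/h s\<close>.\<close>

definition Spec_map ::
    "('a, 'm) ring_scheme \<Rightarrow> ('b, 'n) ring_scheme \<Rightarrow> ('a \<Rightarrow> 'b) \<Rightarrow>
     ('b set, ('b \<times> 'b) set, 'a set, ('a \<times> 'a) set) lrmap" where
  "Spec_map A B h =
    \<lparr>point = (\<lambda>Q. {a \<in> carrier A. h a \<in> Q}),
     costalk = (\<lambda>Q X. \<Union>(a, s)\<in>X. fraction B Q (h a) (h s))\<rparr>"

text \<open>The spectrum of a ring given as a type.\<close>

abbreviation type_ring :: "'a::comm_ring_1 ring" where
  "type_ring \<equiv> ring_of_type_algebra"

abbreviation SpecT :: "('a::comm_ring_1 set, ('a \<times> 'a) set) lrspace" where
  "SpecT \<equiv> Spec type_ring"

abbreviation SpecT_map ::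
    "('a::comm_ring_1 \<Rightarrow> 'b::comm_ring_1) \<Rightarrow>
     ('b set, ('b \<times> 'b) set, 'a set, ('a \<times> 'a) set) lrmap" where
  "SpecT_map \<equiv> Spec_map type_ring type_ring"

section \<open>Families of affine planes\<close>

text \<open>For a ring homomorphism \<open>h : A \<rightarrow> B\<close> and a closed point \<open>\<mm>\<close> of \<open>Spec A\<close>, the residue field
  of \<open>\<mm>\<close> is \<open>A/\<mm>\<close>, so the scheme-theoretic fiber is \<open>Spec (B \<otimes>\<^sub>A A/\<mm>) = Spec (B/\<mm>B)\<close>.\<close>

definition fiber_ring :: "('a \<Rightarrow> 'b::comm_ring_1) \<Rightarrow> 'a set \<Rightarrow> 'b set ring" where
  "fiber_ring h \<mm> = type_ring Quot (Idl\<^bsub>type_ring\<^esub> (h ` \<mm>))"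

text \<open>The structure map of the fiber over the complex numbers.\<close>

definition fiber_const ::
    "('a \<Rightarrow> ('n, complex) mpoly) \<Rightarrow> 'a set \<Rightarrow> complex \<Rightarrow> ('n, complex) mpoly set" where
  "fiber_const h \<mm> c = (Idl\<^bsub>type_ring\<^esub> (h ` \<mm>)) +>\<^bsub>type_ring\<^esub> Const c"

text \<open>\<open>h\<close> is the comorphism of a morphism between affine spaces.\<close>

definition flat_family_of_affine_planes ::
    "(('m, complex) mpoly \<Rightarrow> ('n, complex) mpoly) \<Rightarrow> bool" where
  "flat_family_of_affine_planes h \<longleftrightarrow>
    flat_morphism SpecT SpecT (SpecT_map h) \<and>
    (\<forall>\<mm>. \<mm> \<in> points (SpecT :: (('m, complex) mpoly set, _) lrspace) \<longrightarrow>
       closedin (zariski type_ring) {\<mm>} \<longrightarrow>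
       reduced (Spec (fiber_ring h \<mm>)) \<and>
       isomorphic_over (SpecT :: (complex set, _) lrspace)
         (Spec (fiber_ring h \<mm>)) (Spec_map type_ring (fiber_ring h \<mm>) (fiber_const h \<mm>))
         (SpecT :: ((2, complex) mpoly set, _) lrspace) (SpecT_map Const))"

section \<open>Fiber bundles with fiber the affine plane\<close>

text \<open>The projection of \<open>Spec A[T\<^sub>0, T\<^sub>1]\<close>, the product of \<open>Spec A\<close> and the affine plane, to \<open>Spec A\<close>.\<close>

abbreviation plane_proj ::
    "((2, 'a::comm_ring_1) mpoly set, ((2, 'a) mpoly \<times> (2, 'a) mpoly) set,
      'a set, ('a \<times> 'a) set) lrmap" where
  "plane_proj \<equiv> SpecT_map Const"

text \<open>The product of the affine plane with the open subscheme \<open>S\<close> of \<open>Spec A\<close> is the preimage of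
  \<open>S\<close> in \<open>Spec A[T\<^sub>0, T\<^sub>1]\<close>.\<close>

definition times_plane ::
    "'a::comm_ring_1 set set \<Rightarrow>
     ((2, 'a) mpoly set, ((2, 'a) mpoly \<times> (2, 'a) mpoly) set) lrspace" where
  "times_plane S = open_subspace SpecT (vimage_in SpecT plane_proj S)"

definition trivial_plane_bundle ::
    "'a::comm_ring_1 set set \<Rightarrow> ('p, 's) lrspace \<Rightarrow> ('p, 's, 'a set, ('a \<times> 'a) set) lrmap \<Rightarrow> bool" where
  "trivial_plane_bundle S X f \<longleftrightarrow>
    isomorphic_over (open_subspace SpecT S) X f (times_plane S) plane_proj"

definition plane_bundle ::
    "'a::comm_ring_1 set set \<Rightarrow> ('p, 's) lrspace \<Rightarrow> ('p, 's, 'a set, ('a \<times> 'a) set) lrmap \<Rightarrow> bool" where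
  "plane_bundle S X f \<longleftrightarrow>
    morphism X (open_subspace SpecT S) f \<and>
    (\<forall>s\<in>S. \<exists>U. openin (zariski type_ring) U \<and> s \<in> U \<and> U \<subseteq> S \<and>
       trivial_plane_bundle U (open_subspace X (vimage_in X f U)) f)"

section \<open>The morphism (x, v) and x-variables\<close>

text \<open>The variables \<open>x, y, z, u\<close> have the indices \<open>0, 1, 2, 3\<close>.\<close>

definition x_variable :: "(4, complex) mpoly \<Rightarrow> bool" where
  "x_variable v \<longleftrightarrow>
    (\<exists>g h. generate_ring type_ring
        (generate_ring type_ring (range Const \<union> {Var 0}) \<union> {v, g, h}) = UNIV)"

definition comorphism_xv ::
    "(4, complex) mpoly \<Rightarrow> (2, complex) mpoly \<Rightarrow> (4, complex) mpoly" where
  "comorphism_xv v = poly_subst Const (\<lambda>i. if i = 0 then Var 0 else v)"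

abbreviation A2 :: "((2, complex) mpoly set, ((2, complex) mpoly \<times> (2, complex) mpoly) set) lrspace" where
  "A2 \<equiv> SpecT"

abbreviation A4 :: "((4, complex) mpoly set, ((4, complex) mpoly \<times> (4, complex) mpoly) set) lrspace" where
  "A4 \<equiv> SpecT"

definition origin :: "(2, complex) mpoly set" where
  "origin = Idl\<^bsub>type_ring\<^esub> {Var 0, Var 1}"

end

theory Submission
  imports Defs "HOL-Computational_Algebra.Fraction_Field"
begin

text \<open>
  Every condition amounts to \<open>\<complex>[x, y, z, u]\<close> being a polynomial ring in two variables over
  \<open>R = \<complex>[x, v]\<close>, that is, to a global chart. For (i) this holds because \<open>n\<close> generators of a polynomial
  ring in \<open>n\<close> variables are algebraically independent in characteristic 0. For (iv) a trivialization
  over the punctured plane is a chart over \<open>x \<noteq> 0\<close> and over \<open>v \<noteq> 0\<close>, and its coordinates extend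
  because \<open>x\<close> and \<open>v\<close> have no common factor.

  For (ii) local charts have to be glued. Their existence makes the row \<open>(v\<^sub>y, v\<^sub>z, v\<^sub>u)\<close> unimodular, so
  it is completed to an invertible matrix by Vaserstein's proof of the Quillen-Suslin theorem.
  This yields two derivations \<open>D\<^sub>1, D\<^sub>2\<close> of \<open>\<complex>[x, y, z, u]\<close> over \<open>R\<close> for which the matrix \<open>(D\<^sub>i X\<^sub>j)\<close> of every
  chart \<open>X\<close> is invertible; normalize charts so that it is the identity at the origin of the chart. The
  linear part of the transition automorphism between two charts is then a value of this matrix
  function, hence can be deformed to the identity along a line, and with it the whole automorphism
  \<open>\<phi>\<close>. If \<open>\<Theta>\<^sub>T\<close> is this deformation over \<open>R\<^sub>f\<^sub>g\<close> and \<open>a \<in> R\<close> is divisible by a high power of \<open>f\<close> while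
  \<open>1 - a\<close> is divisible by a high power of \<open>g\<close>, then \<open>\<Theta>\<^sub>a\<close> is defined over \<open>R\<^sub>g\<close> and \<open>\<phi>\<^sup>-\<^sup>1 \<Theta>\<^sub>a\<close> over \<open>R\<^sub>f\<close>,
  which splits \<open>\<phi>\<close> and glues the charts over \<open>f\<close> and \<open>g\<close>.
\<close>

text \<open>Splitting a transition automorphism needs a path of automorphisms from it to the
  identity. Contracting along lines through the origin joins an automorphism only to its linear
  part, and an invertible matrix over R_fg has no reason to be joined to the identity. A global
  frame of vector fields along the fibres supplies this second path. Such a frame lives on the total
  space, which is why the completion of unimodular rows is applied to C[x, y, z, u] and not to R.

  All rings in sight are subrings of one field, the fraction field of C[x, y, z, u]. A localization
  is a subset of it, a chart is a pair of its elements, and gluing amounts to intersecting subsets.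

  Gluing two charts at a time suffices. The r in R such that a chart exists where r is nonzero form,
  together with 0, an ideal: for a sum f + g one passes to R_{f+g}, where f and g become comaximal.
  This ideal lies in no prime, so it contains 1.\<close>

no_notation fps_nth (infixl \<open>$\<close> 75)

section \<open>Polynomial rings\<close>

definition rhom :: "('a::comm_ring_1 \<Rightarrow> 'b::comm_ring_1) \<Rightarrow> bool" where
  "rhom f \<longleftrightarrow> f 1 = 1 \<and> (\<forall>a b. f (a + b) = f a + f b) \<and> (\<forall>a b. f (a * b) = f a * f b)"

lemma rhomI:
  "f 1 = 1 \<Longrightarrow> (\<And>a b. f (a + b) = f a + f b) \<Longrightarrow> (\<And>a b. f (a * b) = f a * f b) \<Longrightarrow> rhom f"
  by (simp add: rhom_def)

lemma rhom_1: "rhom f \<Longrightarrow> f 1 = 1"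
  and rhom_add: "rhom f \<Longrightarrow> f (a + b) = f a + f b"
  and rhom_mult: "rhom f \<Longrightarrow> f (a * b) = f a * f b"
  by (simp_all add: rhom_def)

lemma rhom_0: "rhom f \<Longrightarrow> f 0 = 0"
  using rhom_add[of f 0 0] by simp

lemma rhom_uminus: "rhom f \<Longrightarrow> f (- a) = - f a"
  using rhom_add[of f a "- a"] by (simp add: rhom_0 eq_neg_iff_add_eq_0 add.commute)

lemma rhom_diff: "rhom f \<Longrightarrow> f (a - b) = f a - f b"
  using rhom_add[of f a "- b"] by (simp add: rhom_uminus)

lemma rhom_sum: "rhom f \<Longrightarrow> f (sum g A) = (\<Sum>i\<in>A. f (g i))"
  by (induction A rule: infinite_finite_induct) (simp_all add: rhom_0 rhom_add)

lemma rhom_power: "rhom f \<Longrightarrow> f (a ^ n) = f a ^ n"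
  by (induction n) (simp_all add: rhom_1 rhom_mult)

lemma rhom_comp: "rhom f \<Longrightarrow> rhom g \<Longrightarrow> rhom (\<lambda>x. f (g x))"
  by (simp add: rhom_def)

lemma rhom_id: "rhom (\<lambda>x. x)"
  by (simp add: rhom_def)

lemmas rhom_simps = rhom_0 rhom_1 rhom_add rhom_mult rhom_uminus rhom_diff rhom_power

lemma rhom_const_poly: "rhom (\<lambda>a. [:a:])"
  by (rule rhomI) (simp_all add: one_pCons)

lemma rhom_Const: "rhom (Const :: 'a::comm_ring_1 \<Rightarrow> ('n, 'a) mpoly)"
  by (rule rhomI) (simp_all add: Const_def single_add mult_single)

lemma Const_0 [simp]: "Const 0 = 0"
  by (simp add: Const_def)

lemma Const_1 [simp]: "Const 1 = 1"
  by (simp add: rhom_1 rhom_Const)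

lemma poly_subst_superset:
  assumes "finite F" "Poly_Mapping.keys p \<subseteq> F" "c 0 = 0"
  shows "poly_subst c g p =
    (\<Sum>m\<in>F. c (Poly_Mapping.lookup p m) * (\<Prod>i\<in>UNIV. g i ^ Poly_Mapping.lookup m i))"
  unfolding poly_subst_def
  by (rule sum.mono_neutral_left) (use assms in \<open>auto simp: in_keys_iff\<close>)

lemma poly_subst_add:
  assumes "rhom c"
  shows "poly_subst c g (p + q) = poly_subst c g p + poly_subst c g q"
proof -
  let ?F = "Poly_Mapping.keys p \<union> Poly_Mapping.keys q"
  have "finite ?F" "Poly_Mapping.keys (p + q) \<subseteq> ?F" "c 0 = 0"
    using keys_add[of p q] rhom_0[OF assms] by auto
  then show ?thesis
    by (simp add: poly_subst_superset[where F = ?F] lookup_add rhom_add[OF assms]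
        distrib_right sum.distrib)
qed

lemma poly_subst_single:
  assumes "c 0 = 0"
  shows "poly_subst c g (Poly_Mapping.single m a) =
    c a * (\<Prod>i\<in>UNIV. g i ^ Poly_Mapping.lookup m i)"
  using assms by (subst poly_subst_superset[where F = "{m}"]) (auto simp: keys_single)

lemma poly_subst_0: "poly_subst c g 0 = 0"
  by (simp add: poly_subst_def)

lemma poly_subst_sum:
  assumes "rhom c"
  shows "poly_subst c g (sum f A) = (\<Sum>i\<in>A. poly_subst c g (f i))"
  by (induction A rule: infinite_finite_induct) (simp_all add: poly_subst_0 poly_subst_add[OF assms])

lemma mpoly_sum_single:
  "p = (\<Sum>m\<in>Poly_Mapping.keys p. Poly_Mapping.single m (Poly_Mapping.lookup p m))"
proof (rule poly_mapping_eqI)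
  fix k
  show "Poly_Mapping.lookup p k = Poly_Mapping.lookup
      (\<Sum>m\<in>Poly_Mapping.keys p. Poly_Mapping.single m (Poly_Mapping.lookup p m)) k"
    by (simp add: lookup_sum lookup_single when_def sum.delta in_keys_iff)
qed

lemma poly_subst_mult:
  assumes "rhom c"
  shows "poly_subst c g (p * q) = poly_subst c g p * poly_subst c g q"
proof -
  have c0: "c 0 = 0" by (rule rhom_0[OF assms])
  have mono: "poly_subst c g (Poly_Mapping.single m a * Poly_Mapping.single n b) =
      poly_subst c g (Poly_Mapping.single m a) * poly_subst c g (Poly_Mapping.single n b)" for m n a b
    by (simp add: mult_single poly_subst_single c0 rhom_mult[OF assms] lookup_add power_add
        prod.distrib mult_ac)
  have "p * q = (\<Sum>m\<in>Poly_Mapping.keys p. \<Sum>n\<in>Poly_Mapping.keys q.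
      Poly_Mapping.single m (Poly_Mapping.lookup p m) * Poly_Mapping.single n (Poly_Mapping.lookup q n))"
    by (subst mpoly_sum_single[of p], subst mpoly_sum_single[of q]) (simp add: sum_product)
  also have "poly_subst c g \<dots> =
      (\<Sum>m\<in>Poly_Mapping.keys p. poly_subst c g (Poly_Mapping.single m (Poly_Mapping.lookup p m))) *
      (\<Sum>n\<in>Poly_Mapping.keys q. poly_subst c g (Poly_Mapping.single n (Poly_Mapping.lookup q n)))"
    by (simp add: poly_subst_sum[OF assms] mono sum_product)
  also have "\<dots> = poly_subst c g p * poly_subst c g q"
    by (simp flip: poly_subst_sum[OF assms] mpoly_sum_single)
  finally show ?thesis .
qed

lemma poly_subst_Const [simp]: "rhom c \<Longrightarrow> poly_subst c g (Const a) = c a"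
  by (simp add: Const_def poly_subst_single rhom_0)

lemma poly_subst_Var [simp]:
  assumes "rhom c"
  shows "poly_subst c g (Var i) = g i"
proof -
  have "(\<Prod>j\<in>UNIV. g j ^ Poly_Mapping.lookup (Poly_Mapping.single i (1::nat)) j) =
      (\<Prod>j\<in>UNIV. if j = i then g j else 1)"
    by (rule prod.cong) (auto simp: lookup_single)
  then show ?thesis
    by (simp add: Var_def poly_subst_single rhom_0[OF assms] rhom_1[OF assms])
qed

lemma rhom_poly_subst: "rhom c \<Longrightarrow> rhom (poly_subst c g)"
  by (rule rhomI) (simp_all add: poly_subst_add poly_subst_mult rhom_1 flip: Const_1)

lemma lookup_Var_mult:
  fixes p :: "('n, 'a::comm_ring_1) mpoly"
  shows "Poly_Mapping.lookup (Var i * p) m =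
    (if Poly_Mapping.lookup m i = 0 then 0
     else Poly_Mapping.lookup p (m - Poly_Mapping.single i 1))"
proof -
  have "Poly_Mapping.lookup (Var i * Poly_Mapping.single k a) m =
    (if Poly_Mapping.lookup m i = 0 then 0
     else Poly_Mapping.lookup (Poly_Mapping.single k a) (m - Poly_Mapping.single i 1))" for k and a :: 'a
  proof -
    have "Poly_Mapping.single i 1 + k = m \<longleftrightarrow>
        Poly_Mapping.lookup m i \<noteq> 0 \<and> k = m - Poly_Mapping.single i 1"
    proof (cases "Poly_Mapping.lookup m i = 0")
      case True
      then have "Poly_Mapping.single i 1 + k \<noteq> m"
        by (metis add_is_0 lookup_add lookup_single_eq one_neq_zero)
      then show ?thesis using True by simp
    next
      case False
      then have "m = Poly_Mapping.single i 1 + (m - Poly_Mapping.single i 1)"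
        by (simp add: poly_mapping_eq_iff fun_eq_iff lookup_add lookup_minus lookup_single when_def)
      then show ?thesis using False by (metis add_left_imp_eq)
    qed
    then show ?thesis
      by (auto simp: Var_def mult_single lookup_single when_def)
  qed
  note mono = this
  show ?thesis
    by (subst (1 2) mpoly_sum_single[of p]) (simp add: sum_distrib_left lookup_sum mono)
qed

lemma mpoly_induct [case_names Const Var add]:
  fixes p :: "('n::finite, 'a::comm_ring_1) mpoly"
  assumes C: "\<And>c. P (Const c)"
    and V: "\<And>i p. P p \<Longrightarrow> P (Var i * p)"
    and A: "\<And>p q. P p \<Longrightarrow> P q \<Longrightarrow> P (p + q)"
  shows "P p"
proof -
  have single: "P (Poly_Mapping.single m c)" for m c
  proof (induction "\<Sum>i\<in>UNIV. Poly_Mapping.lookup m i" arbitrary: m rule: less_induct)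
    case less
    show ?case
    proof (cases "m = 0")
      case True
      then show ?thesis using C[of c] by (simp add: Const_def)
    next
      case False
      then obtain i where i: "Poly_Mapping.lookup m i \<noteq> 0"
        by (metis lookup_zero poly_mapping_eqI)
      let ?k = "m - Poly_Mapping.single i 1"
      have le: "Poly_Mapping.lookup ?k j \<le> Poly_Mapping.lookup m j" for j
        by (simp add: lookup_minus)
      have "(\<Sum>i\<in>UNIV. Poly_Mapping.lookup ?k i) < (\<Sum>i\<in>UNIV. Poly_Mapping.lookup m i)"
        by (rule sum_strict_mono_ex1) (use i le in \<open>auto simp: lookup_minus intro!: exI[of _ i]\<close>)
      then have "P (Poly_Mapping.single ?k c)" by (rule less)
      then have "P (Var i * Poly_Mapping.single ?k c)" by (rule V)
      also have "Poly_Mapping.single i 1 + ?k = m"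
        using i by (auto simp: poly_mapping_eq_iff fun_eq_iff lookup_add lookup_minus lookup_single when_def)
      then have "Var i * Poly_Mapping.single ?k c = Poly_Mapping.single m c"
        by (simp add: Var_def mult_single)
      finally show ?thesis .
    qed
  qed
  have "P (\<Sum>m\<in>F. Poly_Mapping.single m (Poly_Mapping.lookup p m))" if "finite F" for F
    using that by (induction) (use C[of 0] A single in auto)
  from this[of "Poly_Mapping.keys p"] show ?thesis
    by (simp flip: mpoly_sum_single)
qed

lemma rhom_mpoly_eqI:
  fixes p :: "('n::finite, 'a::comm_ring_1) mpoly"
  assumes "rhom F" "rhom G" "\<And>c. F (Const c) = G (Const c)" "\<And>i. F (Var i) = G (Var i)"
  shows "F p = G p"
  by (induction p rule: mpoly_induct) (simp_all add: assms rhom_add rhom_mult)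

lemma rhom_poly_subst_comp:
  assumes "rhom F" "rhom c"
  shows "F (poly_subst c g p) = poly_subst (\<lambda>a. F (c a)) (\<lambda>i. F (g i)) p"
  by (rule rhom_mpoly_eqI[where F = "\<lambda>p. F (poly_subst c g p)"])
    (simp_all add: assms rhom_comp rhom_poly_subst)

lemma poly_subst_Const_Var: "poly_subst Const Var p = p"
  by (rule rhom_mpoly_eqI) (simp_all add: rhom_poly_subst rhom_Const rhom_id)

section \<open>Subrings of a fixed ring, and polynomials with coefficients in them\<close>

definition subringset :: "'a::comm_ring_1 set \<Rightarrow> bool" where
  "subringset S \<longleftrightarrow> 1 \<in> S \<and> (\<forall>a\<in>S. \<forall>b\<in>S. a - b \<in> S \<and> a * b \<in> S)"

lemma subringsetD:
  assumes "subringset S"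
  shows "0 \<in> S" "1 \<in> S" "a \<in> S \<Longrightarrow> - a \<in> S" "a \<in> S \<Longrightarrow> b \<in> S \<Longrightarrow> a - b \<in> S"
    "a \<in> S \<Longrightarrow> b \<in> S \<Longrightarrow> a + b \<in> S" "a \<in> S \<Longrightarrow> b \<in> S \<Longrightarrow> a * b \<in> S"
    "a \<in> S \<Longrightarrow> a ^ n \<in> S"
proof -
  show 0: "0 \<in> S" and 1: "1 \<in> S" using assms by (auto simp: subringset_def) (metis diff_self)
  show d: "a \<in> S \<Longrightarrow> b \<in> S \<Longrightarrow> a - b \<in> S" and m: "a \<in> S \<Longrightarrow> b \<in> S \<Longrightarrow> a * b \<in> S" for a b
    using assms by (auto simp: subringset_def)
  show u: "a \<in> S \<Longrightarrow> - a \<in> S" for a using d[OF 0, of a] by simp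
  show "a \<in> S \<Longrightarrow> b \<in> S \<Longrightarrow> a + b \<in> S" using d[OF _ u, of a b] by simp
  show "a \<in> S \<Longrightarrow> a ^ n \<in> S" by (induction n) (auto simp: 1 m)
qed

lemma subringset_sum: "subringset S \<Longrightarrow> (\<And>i. i \<in> I \<Longrightarrow> f i \<in> S) \<Longrightarrow> sum f I \<in> S"
  by (induction I rule: infinite_finite_induct) (auto simp: subringsetD)

lemma subringset_prod: "subringset S \<Longrightarrow> (\<And>i. i \<in> I \<Longrightarrow> f i \<in> S) \<Longrightarrow> prod f I \<in> S"
  by (induction I rule: infinite_finite_induct) (auto simp: subringsetD)

lemma subringset_vimage: "rhom f \<Longrightarrow> subringset S \<Longrightarrow> subringset {a. f a \<in> S}"
  by (auto simp: subringset_def rhom_simps)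

lemma subringset_image: "rhom f \<Longrightarrow> subringset S \<Longrightarrow> subringset (f ` S)"
  unfolding subringset_def by (auto simp flip: rhom_diff rhom_mult) (metis imageI rhom_1)

lemma subringset_range: "rhom f \<Longrightarrow> subringset (range f)"
  by (rule subringset_image) (auto simp: subringset_def)

text \<open>The coefficient rings R, R_f, R_g, R_fg will be subsets of one field and not types.
  Polynomials over them are therefore subsets of one polynomial ring, where intersecting or
  enlarging the coefficient ring needs no transport.\<close>

definition polys :: "'a::comm_ring_1 set \<Rightarrow> ('n, 'a) mpoly set" where
  "polys S = {p. \<forall>m. Poly_Mapping.lookup p m \<in> S}"

lemma poly_subst_closed:
  assumes "subringset T" "p \<in> polys S" "\<And>a. a \<in> S \<Longrightarrow> c a \<in> T" "\<And>i. g i \<in> T"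
  shows "poly_subst c g p \<in> T"
  unfolding poly_subst_def
  by (intro subringset_sum subringsetD(6) subringset_prod subringsetD(7) assms(1))
    (use assms in \<open>auto simp: polys_def\<close>)

lemma Const_polys: "subringset S \<Longrightarrow> a \<in> S \<Longrightarrow> Const a \<in> polys S"
  by (simp add: polys_def Const_def lookup_single when_def subringsetD)

lemma Var_polys: "subringset S \<Longrightarrow> Var i \<in> polys S"
  by (simp add: polys_def Var_def lookup_single when_def subringsetD)

lemma subringset_polys:
  assumes "subringset S"
  shows "subringset (polys S :: ('n, 'a::comm_ring_1) mpoly set)"
proof -
  have "p * q \<in> polys S" if "p \<in> polys S" "q \<in> polys S" for p q :: "('n, 'a) mpoly"
  proof -
    have "p * q = (\<Sum>m\<in>Poly_Mapping.keys p. \<Sum>n\<in>Poly_Mapping.keys q.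
        Poly_Mapping.single (m + n) (Poly_Mapping.lookup p m * Poly_Mapping.lookup q n))"
      by (subst mpoly_sum_single[of p], subst mpoly_sum_single[of q]) (simp add: sum_product mult_single)
    then show ?thesis
      using that assms by (auto simp: polys_def lookup_sum lookup_single when_def subringsetD
          intro!: subringset_sum)
  qed
  then show ?thesis
    using assms Const_polys[OF assms, of 1]
    by (auto simp: subringset_def polys_def lookup_minus)
qed

text \<open>Serves as an induction principle: a property of polynomials over \<open>S\<close> that
  is preserved by ring operations need only be checked on constants and variables.\<close>

lemma polys_subset_subringset:
  fixes T :: "('n::finite, 'a::comm_ring_1) mpoly set"
  assumes "subringset T" "\<And>a. a \<in> S \<Longrightarrow> Const a \<in> T" "\<And>i. Var i \<in> T"
  shows "polys S \<subseteq> T"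
  using poly_subst_closed[OF assms(1), of _ S Const Var] assms by (auto simp: poly_subst_Const_Var)

lemma polys_UNIV [simp]: "polys UNIV = UNIV"
  by (simp add: polys_def)

lemma polys_mono: "S \<subseteq> T \<Longrightarrow> polys S \<subseteq> polys T"
  by (auto simp: polys_def)

lemma polys_Int: "polys (S \<inter> T) = polys S \<inter> polys T"
  by (auto simp: polys_def)

text \<open>The substitution \<open>i \<mapsto> i + \<epsilon> \<delta>\<^sub>i\<^sub>j\<close> yields the partial derivative as the coefficient of \<open>\<epsilon>\<close>;
  the Leibniz rule is then multiplicativity of the substitution.\<close>

definition pd_hom :: "'n::finite \<Rightarrow> ('n, 'a::comm_ring_1) mpoly \<Rightarrow> ('n, 'a) mpoly poly" where
  "pd_hom j = poly_subst (\<lambda>a. [:Const a:]) (\<lambda>i. [:Var i, of_bool (i = j):])"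

definition pd :: "'n::finite \<Rightarrow> ('n, 'a::comm_ring_1) mpoly \<Rightarrow> ('n, 'a) mpoly" where
  "pd j p = Polynomial.coeff (pd_hom j p) 1"

lemma rhom_coeff_0: "rhom (\<lambda>p. Polynomial.coeff p 0)"
  by (rule rhomI) (simp_all add: coeff_mult)

lemma coeff_mult_1:
  "Polynomial.coeff (p * q) (Suc 0) =
    Polynomial.coeff p 0 * Polynomial.coeff q 1 + Polynomial.coeff q 0 * Polynomial.coeff p 1"
  by (simp add: coeff_mult mult.commute)

lemma rhom_pd_hom: "rhom (pd_hom j)"
  unfolding pd_hom_def by (intro rhom_poly_subst rhom_comp[OF rhom_const_poly rhom_Const])

lemma pd_hom_simps [simp]:
  "pd_hom j (Const a) = [:Const a:]" "pd_hom j (Var i) = [:Var i, of_bool (i = j):]"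
  unfolding pd_hom_def by (simp_all add: rhom_comp[OF rhom_const_poly rhom_Const])

lemma coeff_pd_hom_0: "Polynomial.coeff (pd_hom j p) 0 = p"
  by (rule rhom_mpoly_eqI[where G = "\<lambda>p. p"])
    (simp_all add: rhom_comp[OF rhom_coeff_0 rhom_pd_hom] rhom_id)

lemma pd_Const [simp]: "pd j (Const a) = 0"
  by (simp add: pd_def)

lemma pd_Var [simp]: "pd j (Var i) = of_bool (i = j)"
  by (simp add: pd_def)

lemma pd_0 [simp]: "pd j 0 = 0"
  using pd_Const[of j 0] by simp

lemma pd_add: "pd j (p + q) = pd j p + pd j q"
  by (simp add: pd_def rhom_add[OF rhom_pd_hom])

lemma pd_mult: "pd j (p * q) = p * pd j q + q * pd j p"
  by (simp add: pd_def rhom_mult[OF rhom_pd_hom] coeff_mult_1 coeff_pd_hom_0)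

text \<open>Links the coefficient of \<epsilon> with the usual derivative of monomials. The explicit
  coefficients show that coefficient rings are preserved and that the degree drops.\<close>

lemma lookup_pd:
  "Poly_Mapping.lookup (pd j p) m =
    of_nat (Poly_Mapping.lookup m j + 1) * Poly_Mapping.lookup p (m + Poly_Mapping.single j 1)"
proof (induction p arbitrary: m rule: mpoly_induct)
  case (Const c)
  have "m + Poly_Mapping.single j 1 \<noteq> 0"
    by (metis add_is_0 lookup_add lookup_single_eq lookup_zero one_neq_zero)
  then have "Poly_Mapping.lookup (Const c) (m + Poly_Mapping.single j 1) = 0"
    by (metis Const_def lookup_single_not_eq)
  then show ?case by simp
next
  case (add p q)
  then show ?case by (simp add: pd_add lookup_add distrib_left)
next
  case (Var i p)
  show ?case
  proof (cases "i = j")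
    case True
    have 1: "m + Poly_Mapping.single j 1 - Poly_Mapping.single j 1 = m" by simp
    have 2: "m - Poly_Mapping.single j 1 + Poly_Mapping.single j 1 = m" if "Poly_Mapping.lookup m j > 0"
      using that by (auto simp: poly_mapping_eq_iff fun_eq_iff lookup_add lookup_minus lookup_single when_def)
    have 3: "Poly_Mapping.lookup (Var j * p) (m + Poly_Mapping.single j 1) = Poly_Mapping.lookup p m"
      by (simp add: lookup_Var_mult lookup_add 1 del: One_nat_def)
    have "Poly_Mapping.lookup (Var j * pd j p) m = of_nat (Poly_Mapping.lookup m j) * Poly_Mapping.lookup p m"
      by (simp add: lookup_Var_mult Var 2 lookup_minus del: One_nat_def)
    then show ?thesis
      unfolding True pd_mult lookup_add 3 by (simp add: algebra_simps)
  next
    case False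
    have "m - Poly_Mapping.single i 1 + Poly_Mapping.single j 1 =
        m + Poly_Mapping.single j 1 - Poly_Mapping.single i 1"
      using False
      by (auto simp: poly_mapping_eq_iff fun_eq_iff lookup_add lookup_minus lookup_single when_def)
    then show ?thesis
      using False by (auto simp: pd_mult lookup_add lookup_Var_mult Var lookup_minus lookup_single)
  qed
qed

lemma subringset_of_nat: "subringset S \<Longrightarrow> of_nat n \<in> S"
  by (induction n) (simp_all add: subringsetD)

lemma pd_polys: "subringset S \<Longrightarrow> p \<in> polys S \<Longrightarrow> pd j p \<in> polys S"
  unfolding polys_def mem_Collect_eq lookup_pd by (blast intro: subringsetD(6) subringset_of_nat)

text \<open>A derivation along \<open>F\<close> that kills constants is determined by its values on
  the variables. With \<open>\<delta>\<close> a partial derivative of a substitution this is the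
  usual chain rule; with \<open>\<delta>\<close> the linear coefficient along a line it is the first
  order Taylor formula.\<close>

lemma chain_rule:
  fixes \<delta> :: "('n::finite, 'a::comm_ring_1) mpoly \<Rightarrow> 'b::comm_ring_1"
  assumes "rhom F" "\<And>p q. \<delta> (p + q) = \<delta> p + \<delta> q" "\<And>p q. \<delta> (p * q) = F p * \<delta> q + F q * \<delta> p"
    "\<And>c. \<delta> (Const c) = 0"
  shows "\<delta> p = (\<Sum>k\<in>UNIV. F (pd k p) * \<delta> (Var k))"
proof (induction p rule: mpoly_induct)
  case (Const c)
  then show ?case by (simp add: assms rhom_0)
next
  case (Var i p)
  have "(\<Sum>k\<in>UNIV. F (pd k (Var i * p)) * \<delta> (Var k)) =
      (\<Sum>k\<in>UNIV. F (Var i) * (F (pd k p) * \<delta> (Var k))) +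
      (\<Sum>k\<in>UNIV. if k = i then F p * \<delta> (Var i) else 0)"
    unfolding sum.distrib[symmetric]
    by (rule sum.cong) (auto simp: pd_mult rhom_simps[OF assms(1)] algebra_simps)
  also have "\<dots> = F (Var i) * \<delta> p + F p * \<delta> (Var i)"
    by (simp add: Var sum_distrib_left)
  finally show ?case by (simp add: assms)
next
  case (add p q)
  then show ?case by (simp add: assms pd_add rhom_simps algebra_simps sum.distrib)
qed

section \<open>Algebraic independence\<close>

definition indep :: "'a::comm_ring_1 set \<Rightarrow> ('n::finite \<Rightarrow> 'a) \<Rightarrow> bool" where
  "indep S z \<longleftrightarrow> (\<forall>p\<in>polys S. poly_subst (\<lambda>a. a) z p = 0 \<longrightarrow> p = 0)"

definition adjoin :: "'a::comm_ring_1 set \<Rightarrow> ('n::finite \<Rightarrow> 'a) \<Rightarrow> 'a set" where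
  "adjoin S z = poly_subst (\<lambda>a. a) z ` polys S"

lemma rhom_eval: "rhom (poly_subst (\<lambda>a. a) z)"
  by (intro rhom_poly_subst rhom_id)

lemma eval_Var [simp]: "poly_subst (\<lambda>a. a) z (Var i) = z i"
  by (simp add: rhom_id)

lemma eval_Const [simp]: "poly_subst (\<lambda>a. a) z (Const a) = a"
  by (simp add: rhom_id)

lemma subringset_adjoin: "subringset S \<Longrightarrow> subringset (adjoin S z)"
  unfolding adjoin_def by (intro subringset_image rhom_eval subringset_polys)

lemma adjoin_base: "subringset S \<Longrightarrow> a \<in> S \<Longrightarrow> a \<in> adjoin S z"
  unfolding adjoin_def by (rule image_eqI[where x = "Const a"]) (simp_all add: Const_polys)

lemma adjoin_gen: "subringset S \<Longrightarrow> z i \<in> adjoin S z"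
  unfolding adjoin_def by (rule image_eqI[where x = "Var i"]) (simp_all add: Var_polys)

lemma adjoin_least: "subringset T \<Longrightarrow> S \<subseteq> T \<Longrightarrow> (\<And>i. z i \<in> T) \<Longrightarrow> adjoin S z \<subseteq> T"
  unfolding adjoin_def by (auto intro!: poly_subst_closed[of T])

lemma adjoin_mono: "S \<subseteq> T \<Longrightarrow> adjoin S z \<subseteq> adjoin T z"
  unfolding adjoin_def using polys_mono by blast

lemma indepD:
  assumes "subringset S" "indep S z" "p \<in> polys S" "q \<in> polys S"
    "poly_subst (\<lambda>a. a) z p = poly_subst (\<lambda>a. a) z q"
  shows "p = q"
proof -
  have "p - q \<in> polys S" using subringset_polys[OF assms(1)] assms(3,4) by (rule subringsetD(4))
  moreover have "poly_subst (\<lambda>a. a) z (p - q) = 0"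
    using assms(5) by (simp add: rhom_diff[OF rhom_eval])
  ultimately show ?thesis using assms(2) by (auto simp: indep_def)
qed

lemma indep_mono: "S \<subseteq> T \<Longrightarrow> indep T z \<Longrightarrow> indep S z"
  unfolding indep_def using polys_mono by blast

text \<open>Some partial derivative of a nonconstant element is nonzero and of smaller degree.\<close>

lemma pd_closed_ideal_Const:
  fixes I :: "('n::finite, 'a::field_char_0) mpoly set"
  assumes "p \<in> I" "p \<noteq> 0" and pd: "\<And>p j. p \<in> I \<Longrightarrow> pd j p \<in> I"
  shows "\<exists>c. c \<noteq> 0 \<and> Const c \<in> I"
  using assms(1,2)
\<comment> \<open>Induction on the total degree of \<open>p\<close>.\<close>
proof (induction "Max ((\<lambda>m. \<Sum>i\<in>UNIV. Poly_Mapping.lookup m i) ` Poly_Mapping.keys p)"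
    arbitrary: p rule: less_induct)
  case less
  let ?d = "\<lambda>m. \<Sum>i\<in>UNIV. Poly_Mapping.lookup m i"
  have Suc: "?d (m + Poly_Mapping.single j 1) = Suc (?d m)" for m :: "'n \<Rightarrow>\<^sub>0 nat" and j
    by (simp add: lookup_add sum.distrib lookup_single when_def)
  show ?case
  proof (cases "\<exists>j. pd j p \<noteq> 0")
    case True
    then obtain j where j: "pd j p \<noteq> 0" ..
    have "?d m < Max (?d ` Poly_Mapping.keys p)" if "m \<in> Poly_Mapping.keys (pd j p)" for m
    proof -
      have "m + Poly_Mapping.single j 1 \<in> Poly_Mapping.keys p"
        using that by (auto simp: in_keys_iff lookup_pd)
      then have "?d (m + Poly_Mapping.single j 1) \<le> Max (?d ` Poly_Mapping.keys p)"
        by (intro Max_ge) auto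
      then show ?thesis unfolding Suc by simp
    qed
    moreover have "Poly_Mapping.keys (pd j p) \<noteq> {}"
      using j by (metis in_keys_iff emptyE lookup_zero poly_mapping_eqI)
    ultimately have "Max (?d ` Poly_Mapping.keys (pd j p)) < Max (?d ` Poly_Mapping.keys p)"
      by (subst Max_less_iff) auto
    then show ?thesis using less j pd by blast
  next
    case False
    \<comment> \<open>All partial derivatives vanish, so in characteristic zero the coefficient of
      every nonconstant monomial is zero.\<close>
    have "Poly_Mapping.lookup p m = Poly_Mapping.lookup (Const (Poly_Mapping.lookup p 0)) m" for m
    proof (cases "m = 0")
      case True
      then show ?thesis by (simp add: Const_def)
    next
      case mn: False
      then obtain j where j: "Poly_Mapping.lookup m j \<noteq> 0"
        by (metis lookup_zero poly_mapping_eqI)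
      let ?k = "m - Poly_Mapping.single j 1"
      have "m = ?k + Poly_Mapping.single j 1"
        using j by (auto simp: poly_mapping_eq_iff fun_eq_iff lookup_add lookup_minus lookup_single when_def)
      moreover have "Poly_Mapping.lookup (pd j p) ?k = 0" using False by simp
      ultimately have "Poly_Mapping.lookup p m = 0"
        unfolding lookup_pd by (metis mult_eq_0_iff of_nat_eq_0_iff add_is_0 one_neq_zero)
      then show ?thesis using mn by (simp add: Const_def lookup_single when_def)
    qed
    then have "p = Const (Poly_Mapping.lookup p 0)" by (rule poly_mapping_eqI)
    then show ?thesis using less.prems by (metis Const_0)
  qed
qed

text \<open>By the chain rule the Jacobian matrix of \<open>z\<close> with respect to \<open>y\<close> is invertible, so the relations
  between the \<open>z i\<close> are closed under partial derivatives.\<close>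

lemma indep_generators:
  fixes y z :: "'n::finite \<Rightarrow> 'a::field_char_0"
  assumes S: "subringset S" and y: "indep S y"
    and zy: "\<And>i. z i \<in> adjoin S y" and yz: "\<And>i. y i \<in> adjoin S z"
  shows "indep S z"
proof -
  let ?ev = "poly_subst (\<lambda>a. a)"
  obtain w where w: "\<And>i. w i \<in> polys S" "\<And>i. z i = ?ev y (w i)"
    using zy unfolding adjoin_def image_iff Bex_def by metis
  obtain u where u: "\<And>i. u i \<in> polys S" "\<And>i. y i = ?ev z (u i)"
    using yz unfolding adjoin_def image_iff Bex_def by metis
  define F where "F = poly_subst Const w"
  have F: "rhom F" unfolding F_def by (intro rhom_poly_subst rhom_Const)
  have F_simps: "F (Const c) = Const c" "F (Var i) = w i" for c i
    unfolding F_def by (simp_all add: rhom_Const)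
  have F_polys: "F p \<in> polys S" if "p \<in> polys S" for p
    unfolding F_def using that w S
    by (intro poly_subst_closed[of _ _ S]) (auto intro: subringset_polys Const_polys)
  have ev_F: "?ev y (F p) = ?ev z p" for p
    by (rule rhom_mpoly_eqI[where F = "\<lambda>p. ?ev y (F p)"])
      (simp_all add: rhom_comp[OF rhom_eval F] rhom_eval F_simps w(2))
  have chain: "pd k (F p) = (\<Sum>j\<in>UNIV. F (pd j p) * pd k (w j))" for k p
    using chain_rule[of F "\<lambda>p. pd k (F p)" p]
    by (simp add: F rhom_simps[OF F] pd_add pd_mult F_simps)
  \<comment> \<open>Both sides have the value \<open>y i\<close> at \<open>y\<close>. Independence
    of \<open>y\<close> makes this an identity of polynomials, which can be differentiated.\<close>
  have Fu: "F (u i) = Var i" for i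
    using S y by (rule indepD) (simp_all add: F_polys u(1) Var_polys S ev_F flip: u(2))
  define P Q where "P = (\<chi> i j. ?ev z (pd j (u i)))" and "Q = (\<chi> j k. ?ev y (pd k (w j)))"
  have "P ** Q = mat 1"
  proof -
    have "?ev y (pd k (F (u i))) = (\<Sum>j\<in>UNIV. ?ev z (pd j (u i)) * ?ev y (pd k (w j)))"
      for i k
      unfolding chain by (simp add: rhom_sum[OF rhom_eval] rhom_mult[OF rhom_eval] ev_F)
    from this[symmetric] have "(\<Sum>j\<in>UNIV. ?ev z (pd j (u i)) * ?ev y (pd k (w j))) = (if i = k then 1 else 0)" for i k
      by (simp add: Fu rhom_simps[OF rhom_eval] of_bool_def)
    then show ?thesis
      by (simp add: vec_eq_iff matrix_matrix_mult_def mat_def P_def Q_def)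
  qed
  \<comment> \<open>Over a field a one-sided inverse of a square matrix is two-sided; the product is
    needed in this order.\<close>
  then have QP: "Q ** P = mat 1" by (rule matrix_left_right_inverse[THEN iffD1])
  \<comment> \<open>A relation \<open>q\<close> between the \<open>z i\<close> becomes the zero
    polynomial after substituting \<open>w\<close>. By the chain rule the gradient of
    \<open>q\<close> at \<open>z\<close>, multiplied by \<open>Q\<close>, vanishes, and
    \<open>Q\<close> is invertible.\<close>
  have closed: "?ev z (pd j q) = 0" if "q \<in> polys S" "?ev z q = 0" for q j
  proof -
    have "F q = 0"
      using S y by (rule indepD) (simp_all add: F_polys that ev_F rhom_0[OF rhom_eval] subringsetD subringset_polys S)
    then have "0 = (\<Sum>j\<in>UNIV. F (pd j q) * pd k (w j))" for k
      using chain[of k q] by simp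
    then have "?ev y 0 = ?ev y (\<Sum>j\<in>UNIV. F (pd j q) * pd k (w j))" for k by simp
    then have "(\<Sum>j\<in>UNIV. ?ev z (pd j q) * ?ev y (pd k (w j))) = 0" for k
      by (simp add: rhom_sum[OF rhom_eval] rhom_mult[OF rhom_eval] ev_F rhom_0[OF rhom_eval])
    then have "(\<chi> j. ?ev z (pd j q)) v* Q = 0"
      by (simp add: vec_eq_iff vector_matrix_mult_def Q_def mult.commute)
    then have "(\<chi> j. ?ev z (pd j q)) v* (Q ** P) = 0"
      by (metis vector_matrix_mul_assoc vector_matrix_mult_0)
    then show ?thesis unfolding QP by (simp add: vec_eq_iff)
  qed
  show ?thesis
  proof (unfold indep_def, intro ballI impI, rule ccontr)
    fix p assume "p \<in> polys S" "?ev z p = 0" "p \<noteq> 0"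
    then obtain c where "c \<noteq> 0" "Const c \<in> {q \<in> polys S. ?ev z q = 0}"
      using pd_closed_ideal_Const[of p "{q \<in> polys S. ?ev z q = 0}"]
      by (auto simp: pd_polys S closed)
    then show False by simp
  qed
qed

section \<open>Prime ideals\<close>

definition idealset :: "'a::comm_ring_1 set \<Rightarrow> bool" where
  "idealset I \<longleftrightarrow> 0 \<in> I \<and> (\<forall>a\<in>I. \<forall>b\<in>I. a + b \<in> I) \<and> (\<forall>a\<in>I. \<forall>r. r * a \<in> I)"

definition primeset :: "'a::comm_ring_1 set \<Rightarrow> bool" where
  "primeset P \<longleftrightarrow> idealset P \<and> 1 \<notin> P \<and> (\<forall>a b. a * b \<in> P \<longrightarrow> a \<in> P \<or> b \<in> P)"

lemma idealsetD:
  assumes "idealset I"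
  shows "0 \<in> I" "a \<in> I \<Longrightarrow> b \<in> I \<Longrightarrow> a + b \<in> I" "a \<in> I \<Longrightarrow> r * a \<in> I" "a \<in> I \<Longrightarrow> a * r \<in> I"
    "a \<in> I \<Longrightarrow> - a \<in> I" "a \<in> I \<Longrightarrow> b \<in> I \<Longrightarrow> a - b \<in> I"
proof -
  show 1: "0 \<in> I" "a \<in> I \<Longrightarrow> b \<in> I \<Longrightarrow> a + b \<in> I" "a \<in> I \<Longrightarrow> r * a \<in> I" for a b r
    using assms by (auto simp: idealset_def)
  show "a \<in> I \<Longrightarrow> a * r \<in> I" using 1(3)[of a r] by (simp add: mult.commute)
  show 2: "a \<in> I \<Longrightarrow> - a \<in> I" for a using 1(3)[of a "-1"] by simp
  show "a \<in> I \<Longrightarrow> b \<in> I \<Longrightarrow> a - b \<in> I" using 1(2)[of a "-b"] 2[of b] by simp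
qed

lemma idealset_sum: "idealset I \<Longrightarrow> (\<And>i. i \<in> A \<Longrightarrow> f i \<in> I) \<Longrightarrow> sum f A \<in> I"
  by (induction A rule: infinite_finite_induct) (auto simp: idealsetD)

lemma primesetD:
  assumes "primeset P"
  shows "idealset P" "1 \<notin> P" "a * b \<in> P \<Longrightarrow> a \<in> P \<or> b \<in> P"
    "a \<notin> P \<Longrightarrow> b \<notin> P \<Longrightarrow> a * b \<notin> P" "a \<notin> P \<Longrightarrow> a ^ n \<notin> P"
proof -
  show "idealset P" and 1: "1 \<notin> P" and *: "a * b \<in> P \<Longrightarrow> a \<in> P \<or> b \<in> P" for a b
    using assms by (auto simp: primeset_def)
  show "a \<notin> P \<Longrightarrow> b \<notin> P \<Longrightarrow> a * b \<notin> P" using * by blast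
  show "a \<notin> P \<Longrightarrow> a ^ n \<notin> P" by (induction n) (use 1 * in auto)
qed

lemma primeset_vimage:
  assumes "rhom f" "primeset P"
  shows "primeset {a. f a \<in> P}"
  using primesetD[OF assms(2)] idealsetD[OF primesetD(1)[OF assms(2)]]
  by (auto simp: primeset_def idealset_def rhom_simps[OF assms(1)])

lemma primeset_0: "primeset {0 :: 'a::idom}"
  by (auto simp: primeset_def idealset_def)

text \<open>Zorn's lemma gives an ideal maximal among those that contain \<open>I\<close> and avoid
  the powers of \<open>f\<close>. Adjoining an element outside it captures a power of
  \<open>f\<close>. If a product of two such elements were inside, the product of the two captured
  powers would be inside too, so the ideal is prime.\<close>

lemma prime_avoiding_powers:
  fixes I :: "'a::comm_ring_1 set"
  assumes I: "idealset I" and f: "\<And>n. f ^ n \<notin> I"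
  obtains P where "primeset P" "I \<subseteq> P" "f \<notin> P"
proof -
  let ?A = "{J. idealset J \<and> I \<subseteq> J \<and> (\<forall>n. f ^ n \<notin> J)}"
  have "\<exists>M\<in>?A. \<forall>X\<in>?A. M \<subseteq> X \<longrightarrow> X = M"
  proof (rule subset_Zorn_nonempty)
    show "?A \<noteq> {}" using assms by blast
    fix C assume C: "C \<noteq> {}" "subset.chain ?A C"
    have "idealset (\<Union> C)"
      unfolding idealset_def
    proof (intro conjI ballI allI)
      show "0 \<in> \<Union> C" using C by (auto simp: subset_chain_def idealset_def)
      fix a assume a: "a \<in> \<Union> C"
      then show "r * a \<in> \<Union> C" for r using C by (fastforce simp: subset_chain_def idealset_def)
      fix b assume "b \<in> \<Union> C"
      with a obtain X Y where XY: "X \<in> C" "Y \<in> C" "a \<in> X" "b \<in> Y" by blast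
      then have "X \<subseteq> Y \<or> Y \<subseteq> X" using C(2) by (auto simp: subset_chain_def)
      then obtain Z where "Z \<in> C" "a \<in> Z" "b \<in> Z" using XY by blast
      moreover from this have "idealset Z" using C(2) by (auto simp: subset_chain_def)
      ultimately show "a + b \<in> \<Union> C" by (auto simp: idealset_def)
    qed
    then show "\<Union> C \<in> ?A" using C by (auto simp: subset_chain_def)
  qed
  then obtain M where M: "idealset M" "I \<subseteq> M" "\<And>n. f ^ n \<notin> M"
    and max: "\<And>X. idealset X \<Longrightarrow> M \<subseteq> X \<Longrightarrow> (\<And>n. f ^ n \<notin> X) \<Longrightarrow> X = M"
    by (smt (verit) mem_Collect_eq subset_trans)
  note Mi = idealsetD[OF M(1)]
  have ext: "\<exists>n m r. m \<in> M \<and> f ^ n = m + r * a" if "a \<notin> M" for a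
  proof (rule ccontr)
    assume neg: "\<not> ?thesis"
    let ?X = "{m + r * a | m r. m \<in> M}"
    have "idealset ?X" unfolding idealset_def
    proof (intro conjI ballI allI)
      show "0 \<in> ?X" using Mi(1) by (auto intro!: exI[of _ 0])
      fix x assume "x \<in> ?X"
      then obtain m r where x: "x = m + r * a" "m \<in> M" by blast
      show "s * x \<in> ?X" for s
      proof -
        have "s * x = s * m + (s * r) * a" using x by (simp add: algebra_simps)
        then show ?thesis using x Mi(3)[of m s] by blast
      qed
      fix y assume "y \<in> ?X"
      then obtain m' r' where y: "y = m' + r' * a" "m' \<in> M" by blast
      have "x + y = (m + m') + (r + r') * a" using x y by (simp add: algebra_simps)
      then show "x + y \<in> ?X" using x y Mi(2)[of m m'] by blast
    qed
    moreover have "M \<subseteq> ?X"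
    proof
      fix x assume "x \<in> M"
      moreover have "x = x + 0 * a" by simp
      ultimately show "x \<in> ?X" by blast
    qed
    moreover have "f ^ n \<notin> ?X" for n using neg by blast
    ultimately have "?X = M" by (rule max)
    moreover have "0 + 1 * a \<in> ?X" using Mi(1) by blast
    ultimately show False using that by simp
  qed
  have "primeset M" unfolding primeset_def
  proof (intro conjI allI impI M(1))
    show "1 \<notin> M" using M(3)[of 0] by simp
    fix a b assume ab: "a * b \<in> M"
    show "a \<in> M \<or> b \<in> M"
    proof (rule ccontr)
      assume "\<not> ?thesis"
      then obtain n m r n' m' r' where
        "m \<in> M" "f ^ n = m + r * a" "m' \<in> M" "f ^ n' = m' + r' * b" using ext by metis
      moreover from this have "f ^ (n + n') = (m' + r' * b) * m + (r * a) * m' + (r * r') * (a * b)"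
        by (simp add: power_add algebra_simps)
      ultimately have "f ^ (n + n') \<in> M" using ab by (simp add: Mi)
      then show False using M(3) by blast
    qed
  qed
  then show thesis using that M(2) M(3)[of 1] by simp
qed

text \<open>The passage from local to global: if the elements for which a statement holds form an
  ideal and every prime misses one of them, the statement holds for 1. It is used for argument
  shifts of rows, for the gradient, and for the elements over which a chart exists.\<close>

lemma idealset_unit:
  assumes "idealset I" "\<And>P. primeset P \<Longrightarrow> \<not> I \<subseteq> P"
  shows "1 \<in> I"
  using prime_avoiding_powers[of I 1] assms by auto

section \<open>Unimodular rows over polynomial rings\<close>

definition row_equiv :: "'a::comm_ring_1^'n \<Rightarrow> 'a^'n \<Rightarrow> bool" where
  "row_equiv f g \<longleftrightarrow> (\<exists>M N. M ** N = mat 1 \<and> N ** M = mat 1 \<and> f v* M = g)"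

definition map_row :: "('a \<Rightarrow> 'b) \<Rightarrow> 'a^'n \<Rightarrow> 'b^'n" where
  "map_row F f = (\<chi> i. F (f $ i))"

definition map_mat :: "('a \<Rightarrow> 'b) \<Rightarrow> 'a^'n^'m \<Rightarrow> 'b^'n^'m" where
  "map_mat F M = (\<chi> i j. F (M $ i $ j))"

lemma map_mat_mult: "rhom F \<Longrightarrow> map_mat F (M ** N) = map_mat F M ** map_mat F N"
  by (simp add: map_mat_def matrix_matrix_mult_def vec_eq_iff rhom_sum rhom_mult)

lemma map_row_mult: "rhom F \<Longrightarrow> map_row F (f v* M) = map_row F f v* map_mat F M"
  by (simp add: map_mat_def map_row_def vector_matrix_mult_def vec_eq_iff rhom_sum rhom_mult)

lemma map_mat_mat: "rhom F \<Longrightarrow> map_mat F (mat k) = mat (F k)"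
  by (simp add: map_mat_def mat_def vec_eq_iff rhom_0)

lemma row_equiv_refl: "row_equiv f f"
  unfolding row_equiv_def by (rule exI[of _ "mat 1"], rule exI[of _ "mat 1"]) simp

lemma row_equiv_sym: "row_equiv f g \<Longrightarrow> row_equiv g f"
  unfolding row_equiv_def
  by (metis vector_matrix_mul_assoc vector_matrix_mul_rid)

lemma row_equiv_trans:
  assumes "row_equiv f g" "row_equiv g h"
  shows "row_equiv f h"
proof -
  obtain M N M' N' where *: "M ** N = mat 1" "N ** M = mat 1" "f v* M = g"
    "M' ** N' = mat 1" "N' ** M' = mat 1" "g v* M' = h"
    using assms unfolding row_equiv_def by blast
  have "(M ** M') ** (N' ** N) = mat 1" "(N' ** N) ** (M ** M') = mat 1"
    using * by (metis matrix_mul_assoc matrix_mul_rid)+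
  then show ?thesis
    unfolding row_equiv_def using * by (metis vector_matrix_mul_assoc)
qed

lemma row_equiv_map: "rhom F \<Longrightarrow> row_equiv f g \<Longrightarrow> row_equiv (map_row F f) (map_row F g)"
  unfolding row_equiv_def by (metis map_mat_mat map_mat_mult map_row_mult rhom_1)

definition unimodular :: "'a::comm_ring_1^'n \<Rightarrow> bool" where
  "unimodular f \<longleftrightarrow> (\<exists>u. (\<Sum>i\<in>UNIV. f $ i * u $ i) = 1)"

lemma unimodular_map: "rhom F \<Longrightarrow> unimodular f \<Longrightarrow> unimodular (map_row F f)"
  unfolding unimodular_def map_row_def
proof (elim exE)
  fix u assume F: "rhom F" and u: "(\<Sum>i\<in>UNIV. f $ i * u $ i) = 1"
  have "F (\<Sum>i\<in>UNIV. f $ i * u $ i) = 1" using u by (simp add: rhom_1 F)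
  then show "\<exists>u. (\<Sum>i\<in>UNIV. (\<chi> i. F (f $ i)) $ i * u $ i) = 1"
    by (intro exI[of _ "\<chi> i. F (u $ i)"]) (simp add: rhom_sum[OF F] rhom_mult[OF F])
qed

lemma sum_row_mult:
  fixes f :: "'a::comm_ring_1^'n"
  shows "(\<Sum>i\<in>UNIV. (f v* M) $ i * u $ i) = (\<Sum>i\<in>UNIV. f $ i * (M *v u) $ i)"
  by (simp add: vector_matrix_mult_def matrix_vector_mult_def sum_distrib_left sum_distrib_right mult_ac,
      rule sum.swap)

lemma unimodular_row_equiv: "row_equiv f g \<Longrightarrow> unimodular f \<Longrightarrow> unimodular g"
  unfolding unimodular_def
  by (drule row_equiv_sym) (auto simp: row_equiv_def sum_row_mult)

text \<open>Equivalence of rows over \<open>D\<^sub>m[t]\<close>, stated with cleared denominators.\<close>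

definition local_row_equiv :: "'d set \<Rightarrow> 'd::comm_ring_1 poly^'n \<Rightarrow> 'd poly^'n \<Rightarrow> bool" where
  "local_row_equiv m f g \<longleftrightarrow>
    (\<exists>P Q e. e \<notin> m \<and> P ** Q = mat [:e:] \<and> Q ** P = mat [:e:] \<and> f v* P = g)"

lemma mat_mult_left: "(mat k :: 'a::comm_ring_1^'n^'n) ** A = (\<chi> i j. k * A $ i $ j)"
  by (simp add: matrix_matrix_mult_def mat_def vec_eq_iff if_distrib if_distribR cong: if_cong)

lemma mat_mult_right: "A ** (mat k :: 'a::comm_ring_1^'n^'n) = (\<chi> i j. k * A $ i $ j)"
  by (simp add: matrix_matrix_mult_def mat_def vec_eq_iff if_distrib if_distribR mult.commute cong: if_cong)

lemma mat_mat: "(mat a :: 'a::comm_ring_1^'n^'n) ** mat b = mat (a * b)"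
  by (simp add: mat_mult_left) (simp add: mat_def vec_eq_iff)

lemma row_mat: "(f :: 'a::comm_ring_1^'n) v* mat k = (\<chi> i. k * f $ i)"
  by (simp add: vector_matrix_mult_def mat_def vec_eq_iff if_distrib if_distribR cong: if_cong)

lemma local_row_equiv_trans:
  assumes m: "primeset m" and "local_row_equiv m f g" "local_row_equiv m g h"
  shows "local_row_equiv m f h"
proof -
  obtain P Q e P' Q' e' where *: "e \<notin> m" "P ** Q = mat [:e:]" "Q ** P = mat [:e:]" "f v* P = g"
    "e' \<notin> m" "P' ** Q' = mat [:e':]" "Q' ** P' = mat [:e':]" "g v* P' = h"
    using assms unfolding local_row_equiv_def by blast
  have comm: "A ** mat k = mat k ** A" for A :: "'a poly^'b^'b" and k
    by (simp add: mat_mult_left mat_mult_right)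
  have "(P ** P') ** (Q' ** Q) = (P ** mat [:e':]) ** Q" by (metis matrix_mul_assoc *(6))
  also have "\<dots> = mat [:e':] ** (P ** Q)" by (simp only: comm[of P] matrix_mul_assoc)
  finally have 1: "(P ** P') ** (Q' ** Q) = mat [:e' * e:]" by (simp add: * mat_mat mult.commute)
  have "(Q' ** Q) ** (P ** P') = (Q' ** mat [:e:]) ** P'" by (metis matrix_mul_assoc *(3))
  also have "\<dots> = mat [:e:] ** (Q' ** P')" by (simp only: comm[of Q'] matrix_mul_assoc)
  finally have 2: "(Q' ** Q) ** (P ** P') = mat [:e' * e:]" by (simp add: * mat_mat mult.commute)
  have "f v* (P ** P') = h" using * by (metis vector_matrix_mul_assoc)
  then show ?thesis
    unfolding local_row_equiv_def using 1 2 primesetD(4)[OF m *(5) *(1)] by blast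
qed

text \<open>The witness is \<open>Q *v u\<close>: since \<open>P\<close> times \<open>Q\<close> is
  multiplication by an element outside \<open>m\<close>, the pairing only changes by that
  factor.\<close>

lemma local_unimodular:
  assumes m: "primeset m" and "local_row_equiv m f g" and "e \<notin> m" "(\<Sum>i\<in>UNIV. f $ i * u $ i) = [:e:]"
  shows "\<exists>e u. e \<notin> m \<and> (\<Sum>i\<in>UNIV. g $ i * u $ i) = [:e:]"
proof -
  obtain P Q e' where *: "e' \<notin> m" "P ** Q = mat [:e':]" "f v* P = g"
    using assms unfolding local_row_equiv_def by blast
  have "(\<Sum>i\<in>UNIV. g $ i * (Q *v u) $ i) = (\<Sum>i\<in>UNIV. (f v* (P ** Q)) $ i * u $ i)"
    unfolding *(3)[symmetric] sum_row_mult[symmetric] by (simp only: vector_matrix_mul_assoc)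
  also have "\<dots> = [:e':] * (\<Sum>i\<in>UNIV. f $ i * u $ i)"
    unfolding * row_mat by (simp add: sum_distrib_left mult.assoc)
  also have "\<dots> = [:e' * e:]" using assms(4) by simp
  finally show ?thesis using primesetD(4)[OF m *(1) assms(3)] by blast
qed

text \<open>A column operation over the localization: the entries besides the pivot are scaled by
  elements outside \<open>m\<close> and reduced by multiples of the pivot. The scaling is the reason
  why \<open>?P\<close> and \<open>?Q\<close> multiply to \<open>a * b\<close> and not to 1.\<close>

lemma local_row_step:
  fixes f :: "'d::comm_ring_1 poly^3"
  assumes m: "primeset m" and "a \<notin> m" "b \<notin> m"
  shows "local_row_equiv m f (vector [f $ 1, [:a:] * f $ 2 - q * f $ 1, [:b:] * f $ 3 - r * f $ 1])"
proof -
  let ?P = "vector [vector [1, - q, - r], vector [0, [:a:], 0], vector [0, 0, [:b:]]] :: 'd poly^3^3"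
  let ?Q = "vector [vector [[:a * b:], q * [:b:], r * [:a:]], vector [0, [:b:], 0], vector [0, 0, [:a:]]] :: 'd poly^3^3"
  have "?P ** ?Q = mat [:a * b:]" "?Q ** ?P = mat [:a * b:]"
    "f v* ?P = vector [f $ 1, [:a:] * f $ 2 - q * f $ 1, [:b:] * f $ 3 - r * f $ 1]"
    by (simp_all add: vec_eq_iff forall_3 matrix_matrix_mult_def vector_matrix_mult_def sum_3 mat_def mult.commute)
  then show ?thesis unfolding local_row_equiv_def using primesetD(4)[OF m assms(2,3)] by blast
qed

lemma row_equiv_local: "primeset m \<Longrightarrow> row_equiv f g \<Longrightarrow> local_row_equiv m f g"
  unfolding row_equiv_def local_row_equiv_def one_pCons by (metis primesetD(2))

text \<open>Brings a modified third entry into the pivot position; the matrix is invertible for all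
  multipliers.\<close>

lemma row_equiv_rotate:
  fixes f :: "'a::comm_ring_1^3"
  shows "row_equiv f (vector [f $ 3 + v * f $ 1 + w * f $ 2, f $ 2, f $ 1])"
proof -
  let ?P = "vector [vector [v, 0, 1], vector [w, 1, 0], vector [1, 0, 0]] :: 'a^3^3"
  let ?Q = "vector [vector [0, 0, 1], vector [0, 1, - w], vector [1, 0, - v]] :: 'a^3^3"
  have "?P ** ?Q = mat 1" "?Q ** ?P = mat 1"
    "f v* ?P = vector [f $ 3 + v * f $ 1 + w * f $ 2, f $ 2, f $ 1]"
    by (simp_all add: vec_eq_iff forall_3 matrix_matrix_mult_def vector_matrix_mult_def sum_3 mat_def algebra_simps)
  then show ?thesis unfolding row_equiv_def by blast
qed

lemma row_equiv_swap23:
  fixes f :: "'a::comm_ring_1^3"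
  shows "row_equiv f (vector [f $ 1, f $ 3, f $ 2])"
proof -
  let ?P = "vector [vector [1, 0, 0], vector [0, 0, 1], vector [0, 1, 0]] :: 'a^3^3"
  have "?P ** ?P = mat 1" "f v* ?P = vector [f $ 1, f $ 3, f $ 2]"
    by (simp_all add: vec_eq_iff forall_3 matrix_matrix_mult_def vector_matrix_mult_def sum_3 mat_def)
  then show ?thesis unfolding row_equiv_def by blast
qed

text \<open>Multiplying by \<open>t\<close> and reducing modulo \<open>p\<close> shifts the coefficients of \<open>h\<close> upwards.\<close>

lemma lower_degree_combination:
  fixes p q :: "'d::comm_ring_1 poly"
  assumes m: "primeset m" and lc: "Polynomial.lead_coeff p \<notin> m" and d: "Polynomial.degree p = Suc d"
  shows "h = v * p + w * q \<Longrightarrow> Polynomial.degree h \<le> d \<Longrightarrow> j \<le> d \<Longrightarrow> Polynomial.coeff h (d - j) \<notin> m \<Longrightarrow>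
    \<exists>v w. Polynomial.degree (v * p + w * q) \<le> d \<and> Polynomial.coeff (v * p + w * q) d \<notin> m"
proof (induction j arbitrary: h v w)
  case 0
  then show ?case by auto
next
  case (Suc j)
  note mi = idealsetD[OF primesetD(1)[OF m]]
  show ?case
  proof (cases "Polynomial.coeff h d \<in> m")
    case False
    then show ?thesis using Suc by blast
  next
    case True
    let ?a = "Polynomial.lead_coeff p"
    let ?h = "Polynomial.smult ?a (pCons 0 h) - Polynomial.smult (Polynomial.coeff h d) p"
    have "?h = [:0, ?a:] * h - [:Polynomial.coeff h d:] * p" by simp
    also have "\<dots> = [:0, ?a:] * (v * p + w * q) - [:Polynomial.coeff h d:] * p" using Suc.prems(1) by simp
    also have "\<dots> = ([:0, ?a:] * v - [:Polynomial.coeff h d:]) * p + ([:0, ?a:] * w) * q"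
      by (simp only: ring_distribs mult_ac) (simp only: algebra_simps)
    finally have 1: "?h = ([:0, ?a:] * v - [:Polynomial.coeff h d:]) * p + ([:0, ?a:] * w) * q" .
    have 2: "Polynomial.degree ?h \<le> d"
    proof (rule degree_le, intro allI impI)
      fix i assume "d < i"
      then obtain k where i: "i = Suc k" "d \<le> k" by (cases i) auto
      show "Polynomial.coeff ?h i = 0"
      proof (cases "k = d")
        case True
        then show ?thesis using i d by simp
      next
        case False
        then have "Polynomial.coeff h k = 0" "Polynomial.coeff p i = 0"
          using i d Suc.prems(2) by (auto intro: coeff_eq_0)
        then show ?thesis using i by simp
      qed
    qed
    have "d - j = Suc (d - Suc j)" using Suc.prems(3) by simp
    then have "Polynomial.coeff ?h (d - j) =
        ?a * Polynomial.coeff h (d - Suc j) - Polynomial.coeff h d * Polynomial.coeff p (d - j)" by simp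
    moreover have "?a * Polynomial.coeff h (d - Suc j) \<notin> m"
      by (rule primesetD(4)[OF m lc Suc.prems(4)])
    moreover have "Polynomial.coeff h d * Polynomial.coeff p (d - j) \<in> m" using True by (rule mi(4))
    ultimately have 3: "Polynomial.coeff ?h (d - j) \<notin> m"
      by (metis diff_add_cancel mi(2))
    show ?thesis using Suc.prems(3) by (intro Suc.IH[OF 1 2 _ 3]) simp
  qed
qed

text \<open>The factor \<open>a\<close> is a power of the leading coefficient of \<open>p\<close>,
  hence outside the prime \<open>m\<close>.\<close>

lemma pseudo_division:
  fixes f p :: "'d::idom poly"
  assumes m: "primeset m" and lc: "Polynomial.lead_coeff p \<notin> m" and d: "Polynomial.degree p > 0"
  obtains a q where "a \<notin> m" "Polynomial.degree ([:a:] * f - q * p) < Polynomial.degree p"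
proof -
  obtain q r where qr: "pseudo_divmod f p = (q, r)" by fastforce
  have "p \<noteq> 0" using d by auto
  note * = pseudo_divmod[OF this qr]
  let ?a = "Polynomial.coeff p (Polynomial.degree p) ^ (Suc (Polynomial.degree f) - Polynomial.degree p)"
  have "[:?a:] * f - q * p = r" using *(1) by (simp add: algebra_simps)
  moreover have "?a \<notin> m" using lc by (rule primesetD(5)[OF m])
  ultimately show thesis using that[of ?a q] *(2) d by auto
qed

text \<open>Induction on the degree of the pivot \<open>f $ 1\<close>, whose leading coefficient is
  a unit of the localization at \<open>m\<close>. The other entries are reduced below the degree of
  the pivot. They cannot both vanish modulo \<open>m\<close>, because a pivot of positive degree is
  not a unit there. From one of them and the pivot arises a combination of degree one less than the
  pivot with leading coefficient outside \<open>m\<close>, and this produces the next pivot.\<close>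

lemma local_completion:
  fixes f :: "'d::idom poly^3"
  assumes m: "primeset m" and "Polynomial.lead_coeff (f $ 1) \<notin> m"
    "e \<notin> m" "(\<Sum>i\<in>UNIV. f $ i * u $ i) = [:e:]"
  shows "\<exists>e. e \<notin> m \<and> local_row_equiv m f (vector [[:e:], 0, 0])"
  using assms(2-)
proof (induction "Polynomial.degree (f $ 1)" arbitrary: f e u)
  case 0
  \<comment> \<open>A constant pivot is a unit of the localization and clears the other two
    entries.\<close>
  then obtain a where a: "f $ 1 = [:a:]" by (metis degree_eq_zeroE)
  then have am: "a \<notin> m" using 0 by simp
  have "local_row_equiv m f (vector [f $ 1, [:a:] * f $ 2 - f $ 2 * f $ 1, [:a:] * f $ 3 - f $ 3 * f $ 1])"
    by (rule local_row_step[OF m am am])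
  then show ?case using am a by (auto simp: mult.commute)
next
  case (Suc d)
  note mi = idealsetD[OF primesetD(1)[OF m]]
  have dp: "Polynomial.degree (f $ 1) > 0" using Suc by simp
  obtain a q where a: "a \<notin> m" "Polynomial.degree ([:a:] * f $ 2 - q * f $ 1) < Polynomial.degree (f $ 1)"
    using pseudo_division[OF m Suc.prems(1) dp] by blast
  obtain b r where b: "b \<notin> m" "Polynomial.degree ([:b:] * f $ 3 - r * f $ 1) < Polynomial.degree (f $ 1)"
    using pseudo_division[OF m Suc.prems(1) dp] by blast
  define g :: "'d poly^3" where "g = vector [f $ 1, [:a:] * f $ 2 - q * f $ 1, [:b:] * f $ 3 - r * f $ 1]"
  have fg: "local_row_equiv m f g" unfolding g_def by (rule local_row_step[OF m a(1) b(1)])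
  have deg: "g $ 1 = f $ 1" "Polynomial.degree (g $ 2) \<le> d" "Polynomial.degree (g $ 3) \<le> d"
    using a b Suc(2) by (auto simp: g_def)
  obtain e' u' where u': "e' \<notin> m" "(\<Sum>i\<in>UNIV. g $ i * u' $ i) = [:e':]"
    using local_unimodular[OF m fg Suc.prems(2,3)] by blast
  \<comment> \<open>Otherwise the row is the pivot followed by zeros modulo \<open>m\<close>, and
    unimodularity would make the pivot a unit modulo \<open>m\<close>, although it keeps its
    positive degree there.\<close>
  have "\<exists>j\<le>d. Polynomial.coeff (g $ 2) j \<notin> m \<or> Polynomial.coeff (g $ 3) j \<notin> m"
  proof (rule ccontr)
    assume neg: "\<not> ?thesis"
    then have in_m: "Polynomial.coeff (g $ 2) j \<in> m" "Polynomial.coeff (g $ 3) j \<in> m" for j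
      using deg mi(1) by (metis coeff_eq_0 le_trans not_le)+
    have cm: "Polynomial.coeff (g $ 2 * u' $ 2 + g $ 3 * u' $ 3) j \<in> m" for j
      by (simp add: coeff_mult) (intro mi(2) idealset_sum[OF primesetD(1)[OF m]] mi(4) in_m)
    have eq: "f $ 1 * u' $ 1 = [:e':] - (g $ 2 * u' $ 2 + g $ 3 * u' $ 3)"
      using u'(2) by (simp add: sum_3 deg algebra_simps)
    \<comment> \<open>The last coefficient of \<open>u' $ 1\<close> outside \<open>m\<close>, times
      the leading coefficient of the pivot, would be modulo \<open>m\<close> a coefficient of
      positive degree in a product that is constant modulo \<open>m\<close>.\<close>
    have "Polynomial.coeff (u' $ 1) j \<in> m" for j
    proof (rule ccontr)
      assume j: "Polynomial.coeff (u' $ 1) j \<notin> m"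
      let ?K = "{j. Polynomial.coeff (u' $ 1) j \<notin> m}"
      have "?K \<subseteq> {..Polynomial.degree (u' $ 1)}" using mi(1) by (auto intro: le_degree)
      then have fin: "finite ?K" by (rule finite_subset) simp
      define k where "k = Max ?K"
      have k: "Polynomial.coeff (u' $ 1) k \<notin> m" using Max_in[OF fin] j by (auto simp: k_def)
      have k': "Polynomial.coeff (u' $ 1) i \<in> m" if "i > k" for i
        using Max_ge[OF fin, of i] that by (auto simp: k_def)
      let ?n = "Polynomial.degree (f $ 1) + k"
      have "Polynomial.coeff (f $ 1 * u' $ 1) ?n =
          (\<Sum>i\<le>?n. Polynomial.coeff (f $ 1) i * Polynomial.coeff (u' $ 1) (?n - i))"
        by (rule coeff_mult)
      also have "\<dots> = Polynomial.lead_coeff (f $ 1) * Polynomial.coeff (u' $ 1) k +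
          (\<Sum>i\<in>{..?n} - {Polynomial.degree (f $ 1)}. Polynomial.coeff (f $ 1) i * Polynomial.coeff (u' $ 1) (?n - i))"
        by (subst sum.remove[of _ "Polynomial.degree (f $ 1)"]) auto
      finally have E: "Polynomial.lead_coeff (f $ 1) * Polynomial.coeff (u' $ 1) k =
        Polynomial.coeff ([:e':] - (g $ 2 * u' $ 2 + g $ 3 * u' $ 3)) ?n -
        (\<Sum>i\<in>{..?n} - {Polynomial.degree (f $ 1)}. Polynomial.coeff (f $ 1) i * Polynomial.coeff (u' $ 1) (?n - i))"
        by (simp add: eq algebra_simps)
      have X: "Polynomial.coeff ([:e':] - (g $ 2 * u' $ 2 + g $ 3 * u' $ 3)) ?n \<in> m"
        using cm[of ?n] dp by (simp add: coeff_pCons mi split: nat.splits)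
      have Y: "(\<Sum>i\<in>{..?n} - {Polynomial.degree (f $ 1)}. Polynomial.coeff (f $ 1) i * Polynomial.coeff (u' $ 1) (?n - i)) \<in> m"
      proof (rule idealset_sum[OF primesetD(1)[OF m]])
        fix i assume i: "i \<in> {..?n} - {Polynomial.degree (f $ 1)}"
        show "Polynomial.coeff (f $ 1) i * Polynomial.coeff (u' $ 1) (?n - i) \<in> m"
        proof (cases "i < Polynomial.degree (f $ 1)")
          case True
          then have "?n - i > k" by simp
          then show ?thesis using k' mi(3) by blast
        next
          case False
          then have "Polynomial.coeff (f $ 1) i = 0" using i by (intro coeff_eq_0) auto
          then show ?thesis using mi(1) by simp
        qed
      qed
      have "Polynomial.lead_coeff (f $ 1) * Polynomial.coeff (u' $ 1) k \<in> m"
        unfolding E by (rule mi(6)[OF X Y])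
      then show False using primesetD(4)[OF m Suc.prems(1) k] by blast
    qed
    then have "Polynomial.coeff (f $ 1 * u' $ 1) 0 \<in> m" by (simp add: coeff_mult mi(3))
    then have "Polynomial.coeff (f $ 1 * u' $ 1) 0 + Polynomial.coeff (g $ 2 * u' $ 2 + g $ 3 * u' $ 3) 0 \<in> m"
      using cm by (rule mi(2))
    then show False using u'(1) by (simp add: eq)
  qed
  then obtain h :: "'d poly^3" where h: "local_row_equiv m g h" "h $ 1 = f $ 1" "Polynomial.degree (h $ 2) \<le> d"
    "Polynomial.degree (h $ 3) \<le> d" "\<exists>j\<le>d. Polynomial.coeff (h $ 2) j \<notin> m"
  proof (elim exE conjE disjE)
    fix j assume "j \<le> d" "Polynomial.coeff (g $ 2) j \<notin> m"
    then show thesis using that[of g] deg row_equiv_local[OF m row_equiv_refl] by blast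
  next
    fix j assume "j \<le> d" "Polynomial.coeff (g $ 3) j \<notin> m"
    then show thesis using that[of "vector [g $ 1, g $ 3, g $ 2]"] deg
        row_equiv_local[OF m row_equiv_swap23[of g]] by auto
  qed
  then obtain j where j: "j \<le> d" "Polynomial.coeff (h $ 2) j \<notin> m" by blast
  have "\<exists>v w. Polynomial.degree (v * f $ 1 + w * h $ 2) \<le> d \<and> Polynomial.coeff (v * f $ 1 + w * h $ 2) d \<notin> m"
    by (rule lower_degree_combination[OF m Suc.prems(1) Suc(2)[symmetric], of "h $ 2" 0 1 _ "d - j"])
      (use j h in auto)
  then obtain v w where vw: "Polynomial.degree (v * f $ 1 + w * h $ 2) \<le> d"
    "Polynomial.coeff (v * f $ 1 + w * h $ 2) d \<notin> m" by blast
  \<comment> \<open>The third entry is the new pivot if its coefficient of degree \<open>d\<close>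
    lies outside \<open>m\<close>. If not, adding the combination just found moves this coefficient
    outside \<open>m\<close>.\<close>
  obtain v' w' where vw': "Polynomial.degree (h $ 3 + v' * h $ 1 + w' * h $ 2) \<le> d"
    "Polynomial.coeff (h $ 3 + v' * h $ 1 + w' * h $ 2) d \<notin> m"
  proof (cases "Polynomial.coeff (h $ 3) d \<in> m")
    case True
    have "Polynomial.coeff (h $ 3) d + Polynomial.coeff (v * f $ 1 + w * h $ 2) d \<notin> m"
      using True vw(2) mi(6) by (metis add_diff_cancel_left')
    then show thesis using that[of v w] vw(1) h(2,4) by (simp add: add.assoc degree_add_le)
  next
    case False
    then show thesis using that[of 0 0] h by simp
  qed
  define k :: "'d poly^3" where "k = vector [h $ 3 + v' * h $ 1 + w' * h $ 2, h $ 2, h $ 1]"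
  have fk: "local_row_equiv m f k"
    unfolding k_def
    by (intro local_row_equiv_trans[OF m fg] local_row_equiv_trans[OF m h(1)] row_equiv_local[OF m] row_equiv_rotate)
  have "Polynomial.coeff (k $ 1) d \<noteq> 0" using vw' mi(1) by (auto simp: k_def)
  then have dk: "d = Polynomial.degree (k $ 1)" using vw' by (metis k_def le_antisym le_degree vector_3(1))
  obtain e'' u'' where "e'' \<notin> m" "(\<Sum>i\<in>UNIV. k $ i * u'' $ i) = [:e'':]"
    using local_unimodular[OF m fk Suc.prems(2,3)] by blast
  moreover have "Polynomial.lead_coeff (k $ 1) \<notin> m" using vw' dk by (simp add: k_def)
  ultimately obtain e3 where "e3 \<notin> m" "local_row_equiv m k (vector [[:e3:], 0, 0])"
    using Suc.hyps(1)[OF dk] by blast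
  then show ?case using local_row_equiv_trans[OF m fk] by blast
qed

section \<open>From local to global: shifting the argument of a row\<close>

lemma rhom_pcompose: "rhom (\<lambda>p. pcompose p b)"
  by (rule rhomI) (simp_all add: pcompose_1 pcompose_add pcompose_mult)

text \<open>Arguments congruent modulo \<open>e\<close> give values congruent modulo
  \<open>e\<close>; this makes the later divisions by \<open>e\<close> exact.\<close>

lemma pcompose_diff_dvd: "(b - b' :: 'a::comm_ring_1 poly) dvd pcompose p b - pcompose p b'"
proof (induction p)
  case 0
  then show ?case by simp
next
  case (pCons a p)
  then obtain k where k: "pcompose p b - pcompose p b' = (b - b') * k" by (elim dvdE)
  have "pcompose (pCons a p) b - pcompose (pCons a p) b' =
      b * (pcompose p b - pcompose p b') + (b - b') * pcompose p b'"
    by (simp add: pcompose_pCons algebra_simps)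
  also have "\<dots> = (b - b') * (b * k + pcompose p b')" by (simp add: k algebra_simps)
  finally show ?case by simp
qed

text \<open>Vaserstein's argument. The row \<open>f v* P\<close> does not involve the variable, so
  f(b) P(b) = f(b') P(b'), and P(b) P(b')^-1 carries f(b) to f(b'). With denominators cleared this
  matrix is P(b) Q(b') divided by \<open>e\<close>. The division is exact when b and b' are
  congruent modulo \<open>e\<close>, because then P(b) Q(b') is congruent to P(b') Q(b'), which is
  \<open>e\<close> times the identity.\<close>

lemma local_shift_equiv:
  fixes f :: "'d::idom poly^3"
  assumes m: "primeset m" and "Polynomial.lead_coeff (f $ 1) \<notin> m" "unimodular f"
  shows "\<exists>e. e \<notin> m \<and> (\<forall>b d. row_equiv (map_row (\<lambda>p. pcompose p b) f) (map_row (\<lambda>p. pcompose p (b + [:e:] * d)) f))"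
proof -
  obtain u where "(\<Sum>i\<in>UNIV. f $ i * u $ i) = [:1:]"
    using assms(3) unfolding unimodular_def one_pCons by blast
  then obtain e' where "local_row_equiv m f (vector [[:e':], 0, 0])"
    using local_completion[OF m assms(2) primesetD(2)[OF m]] by blast
  then obtain P Q :: "'d poly^3^3" and e where e: "e \<notin> m" "P ** Q = mat [:e:]" "Q ** P = mat [:e:]"
    "f v* P = vector [[:e':], 0, 0]" unfolding local_row_equiv_def by blast
  have e0: "[:e:] \<noteq> 0" using e(1) idealsetD(1)[OF primesetD(1)[OF m]] by auto
  have "row_equiv (map_row (\<lambda>p. pcompose p b) f) (map_row (\<lambda>p. pcompose p (b + [:e:] * d)) f)" for b d
  proof -
    define S :: "'d poly \<Rightarrow> 'd poly^3^3 \<Rightarrow> 'd poly^3^3" where "S x = map_mat (\<lambda>p. pcompose p x)" for x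
    define s where "s x = map_row (\<lambda>p. pcompose p x) f" for x
    let ?b = "b + [:e:] * d"
    have PQ: "S x P ** S x Q = mat [:e:]" "S x Q ** S x P = mat [:e:]" for x
      unfolding S_def map_mat_mult[OF rhom_pcompose, symmetric] e map_mat_mat[OF rhom_pcompose] by simp_all
    have sP: "s x v* S x P = vector [[:e':], 0, 0]" for x
      unfolding S_def s_def map_row_mult[OF rhom_pcompose, symmetric] e
      by (simp add: vec_eq_iff forall_3 map_row_def)
    have div: "\<exists>N. S x P ** S y Q = mat [:e:] ** N" if "[:e:] dvd x - y" for x y
    proof -
      have "\<exists>W. S x P $ i $ j - S y P $ i $ j = [:e:] * W" for i j
        using dvd_trans[OF that pcompose_diff_dvd[of x y "P $ i $ j"]] by (simp add: S_def map_mat_def dvd_def)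
      then obtain W where W: "\<And>i j. S x P $ i $ j - S y P $ i $ j = [:e:] * W i j" by metis
      define W' where "W' = (\<chi> i j. W i j)"
      have "S x P = S y P + mat [:e:] ** W'"
        using W by (simp add: vec_eq_iff mat_mult_left W'_def algebra_simps del: mult_pCons_left)
      then have "S x P ** S y Q = S y P ** S y Q + mat [:e:] ** W' ** S y Q"
        by (simp add: matrix_matrix_mult_def vec_eq_iff distrib_right sum.distrib del: mult_pCons_left)
      also have "\<dots> = mat [:e:] ** (mat 1 + W' ** S y Q)"
        by (simp add: PQ matrix_add_ldistrib matrix_mul_assoc)
      finally show ?thesis by blast
    qed
    have "[:e:] dvd b - ?b" by (rule dvdI[of _ _ "- d"]) simp
    then obtain N where N: "S b P ** S ?b Q = mat [:e:] ** N" using div by blast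
    have "[:e:] dvd ?b - b" by (rule dvdI[of _ _ d]) simp
    then obtain N' where N': "S ?b P ** S b Q = mat [:e:] ** N'" using div by blast
    have cancel: "A = B" if "mat [:e:] ** A = mat [:e:] ** B" for A B :: "'d poly^3^3"
      using that e0 by (simp add: mat_mult_left vec_eq_iff del: mult_pCons_left pCons_eq_0_iff)
    have comm: "A ** mat [:e:] = mat [:e:] ** A" for A :: "'d poly^3^3"
      by (simp add: mat_mult_left mat_mult_right)
    \<comment> \<open>The quotients for the two directions are mutually inverse: after
      multiplication by the square of \<open>e\<close>, their product is a product of four matrices
      that collapses from the inside.\<close>
    have prod: "A ** B = mat 1"
      if "S x P ** S y Q = mat [:e:] ** A" "S y P ** S x Q = mat [:e:] ** B" for x y A B
    proof -
      have "mat [:e:] ** (mat [:e:] ** (A ** B)) = (mat [:e:] ** (mat [:e:] ** A)) ** B"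
        by (simp only: matrix_mul_assoc)
      also have "\<dots> = (mat [:e:] ** (A ** mat [:e:])) ** B" by (simp only: comm[of A])
      also have "\<dots> = (mat [:e:] ** A) ** (mat [:e:] ** B)" by (simp only: matrix_mul_assoc)
      also have "\<dots> = (S x P ** (S y Q ** S y P)) ** S x Q"
        unfolding that[symmetric] by (simp only: matrix_mul_assoc)
      also have "\<dots> = mat [:e:] ** (S x P ** S x Q)"
        unfolding PQ comm[of "S x P"] by (simp only: matrix_mul_assoc[symmetric] PQ)
      finally have "mat [:e:] ** (mat [:e:] ** (A ** B)) = mat [:e:] ** (mat [:e:] ** mat 1)"
        by (simp add: PQ)
      then show ?thesis by (rule cancel[OF cancel])
    qed
    have row: "s b v* N = s ?b"
    proof -
      have "(s b v* N) v* mat [:e:] = s b v* (mat [:e:] ** N)"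
        by (simp only: vector_matrix_mul_assoc comm[of N])
      also have "\<dots> = (s b v* S b P) v* S ?b Q" by (simp only: N[symmetric] vector_matrix_mul_assoc)
      also have "\<dots> = (s ?b v* S ?b P) v* S ?b Q" by (simp only: sP)
      also have "\<dots> = s ?b v* mat [:e:]" by (simp only: vector_matrix_mul_assoc PQ)
      finally show ?thesis using e0 by (simp add: row_mat vec_eq_iff del: mult_pCons_left pCons_eq_0_iff)
    qed
    show ?thesis
      unfolding row_equiv_def using prod[OF N N'] prod[OF N' N] row unfolding s_def by blast
  qed
  then show ?thesis using e(1) by blast
qed

text \<open>Quillen's ideal: \<open>V\<close> consists of those \<open>c\<close> for which shifting
  the argument by multiples of \<open>c\<close> never changes the class of the row. The local shift
  lemma shows that it lies in no prime, so arbitrary shifts are allowed, in particular the one that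
  moves the variable to 0.\<close>

lemma row_equiv_at_0:
  fixes f :: "'d::idom poly^3"
  assumes "Polynomial.lead_coeff (f $ 1) dvd 1" "unimodular f"
  shows "row_equiv f (map_row (\<lambda>p. [:Polynomial.coeff p 0:]) f)"
proof -
  define s where "s x = map_row (\<lambda>p. pcompose p x) f" for x
  define V where "V = {c. \<forall>b d. row_equiv (s b) (s (b + [:c:] * d))}"
  have "idealset V"
    unfolding idealset_def
  proof (intro conjI ballI allI)
    show "0 \<in> V" by (simp add: V_def row_equiv_refl)
    fix c assume c: "c \<in> V"
    have "row_equiv (s b) (s (b + [:r * c:] * d))" for r b d
    proof -
      have "[:r * c:] * d = [:c:] * ([:r:] * d)" by (simp add: mult.commute)
      moreover have "row_equiv (s b) (s (b + [:c:] * ([:r:] * d)))" using c unfolding V_def by blast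
      ultimately show ?thesis by (simp only:)
    qed
    then show "r * c \<in> V" for r unfolding V_def by blast
    fix c' assume c': "c' \<in> V"
    have "row_equiv (s b) (s (b + [:c + c':] * d))" for b d
    proof -
      have "row_equiv (s b) (s ((b + [:c:] * d) + [:c':] * d))"
        using c c' unfolding V_def by (blast intro: row_equiv_trans)
      also have "(b + [:c:] * d) + [:c':] * d = b + [:c + c':] * d"
        by (simp add: smult_add_left)
      finally show ?thesis .
    qed
    then show "c + c' \<in> V" by (simp add: V_def)
  qed
  moreover have "\<not> V \<subseteq> m" if m: "primeset m" for m
  proof -
    have "Polynomial.lead_coeff (f $ 1) \<notin> m"
      using assms(1) primesetD(2)[OF m] idealsetD(4)[OF primesetD(1)[OF m]] by (metis dvdE)
    from local_shift_equiv[OF m this assms(2)] show ?thesis by (auto simp: V_def s_def)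
  qed
  ultimately have "1 \<in> V" by (rule idealset_unit)
  \<comment> \<open>The argument is the variable and the shift is its negative.\<close>
  then have "row_equiv (s [:0, 1:]) (s ([:0, 1:] + [:1:] * (- [:0, 1:])))" unfolding V_def by blast
  also have "[:0, 1:] + [:1:] * (- [:0, 1:]) = (0 :: 'd poly)" by simp
  finally show ?thesis by (simp add: s_def map_row_def pcompose_0')
qed

section \<open>Completion of unimodular rows over polynomial rings in several variables\<close>

text \<open>Length 3 is the length of the gradient in the variables other than x. The property is
  attached to a type so that one can induct over iterated polynomial rings.\<close>

definition rows_completable :: "'d::comm_ring_1 itself \<Rightarrow> bool" where
  "rows_completable (t::'d itself) \<longleftrightarrow> (\<forall>f::'d^3. unimodular f \<longrightarrow> row_equiv f (vector [1, 0, 0]))"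

text \<open>Supplies the unit leading coefficient from which the local argument starts. A left
  inverse of \<open>\<theta>\<close> is enough to carry an equivalence back.\<close>

definition normalizable :: "'d::comm_ring_1 itself \<Rightarrow> bool" where
  "normalizable (t::'d itself) \<longleftrightarrow> (\<forall>p::'d poly. p \<noteq> 0 \<longrightarrow>
    (\<exists>\<theta> \<theta>' :: 'd poly \<Rightarrow> 'd poly. rhom \<theta> \<and> rhom \<theta>' \<and> (\<forall>q. \<theta>' (\<theta> q) = q) \<and>
      Polynomial.lead_coeff (\<theta> p) dvd 1))"

lemma normalizableD:
  fixes p :: "'d::comm_ring_1 poly"
  assumes "normalizable TYPE('d)" "p \<noteq> 0"
  shows "\<exists>\<theta> \<theta>' :: 'd poly \<Rightarrow> 'd poly. rhom \<theta> \<and> rhom \<theta>' \<and> (\<forall>q. \<theta>' (\<theta> q) = q) \<and>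
      Polynomial.lead_coeff (\<theta> p) dvd 1"
  using assms by (simp add: normalizable_def)

lemma row_equiv_first_nonzero:
  fixes f :: "'a::idom^3"
  assumes "unimodular f"
  obtains g where "row_equiv f g" "g $ 1 \<noteq> 0"
proof (cases "f $ 1 = 0")
  case False
  then show ?thesis using that row_equiv_refl by blast
next
  case True
  have "f $ 2 \<noteq> 0 \<or> f $ 3 \<noteq> 0"
    using assms True by (auto simp: unimodular_def sum_3)
  then have "f $ 3 + (if f $ 3 = 0 then 1 else 0) * f $ 2 \<noteq> 0" by auto
  then obtain w where "f $ 3 + w * f $ 2 \<noteq> 0" by blast
  then show ?thesis using that[OF row_equiv_rotate[of f 0 w]] by simp
qed

lemma row_equiv_left_inverse:
  assumes "rhom \<theta>" "rhom \<theta>'" "\<And>q. \<theta>' (\<theta> q) = q" "row_equiv (map_row \<theta> f) (vector [1, 0, 0] :: 'b::comm_ring_1^3)"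
  shows "row_equiv f (vector [1, 0, 0])"
proof -
  have "row_equiv (map_row \<theta>' (map_row \<theta> f)) (map_row \<theta>' (vector [1, 0, 0] :: 'b^3))"
    by (rule row_equiv_map[OF assms(2,4)])
  also have "map_row \<theta>' (map_row \<theta> f) = f" by (simp add: map_row_def assms(3))
  also have "map_row \<theta>' (vector [1, 0, 0] :: 'b^3) = vector [1, 0, 0]"
    by (simp add: vec_eq_iff forall_3 map_row_def rhom_0 rhom_1 assms(2))
  finally show ?thesis .
qed

text \<open>Once the pivot is normalized, the row is equivalent to the row of its constant terms,
  which is unimodular over the coefficient ring.\<close>

lemma rows_completable_poly:
  assumes "rows_completable TYPE('d::idom)" "normalizable TYPE('d)"
  shows "rows_completable TYPE('d poly)"
  unfolding rows_completable_def
proof (intro allI impI)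
  fix f :: "'d poly^3"
  assume f: "unimodular f"
  then obtain g where g: "row_equiv f g" "g $ 1 \<noteq> 0" by (rule row_equiv_first_nonzero)
  obtain \<theta> \<theta>' :: "'d poly \<Rightarrow> 'd poly" where \<theta>: "rhom \<theta>" "rhom \<theta>'" "\<forall>q. \<theta>' (\<theta> q) = q" "Polynomial.lead_coeff (\<theta> (g $ 1)) dvd 1"
    using normalizableD[OF assms(2) g(2)] by blast
  let ?g = "map_row \<theta> g"
  have ug: "unimodular ?g" using \<theta>(1) unimodular_row_equiv[OF g(1) f] by (rule unimodular_map)
  have "row_equiv ?g (map_row (\<lambda>p. [:Polynomial.coeff p 0:]) ?g)"
    using \<theta>(4) ug by (intro row_equiv_at_0) (simp_all add: map_row_def)
  also have "map_row (\<lambda>p. [:Polynomial.coeff p 0:]) ?g = map_row (\<lambda>a. [:a:]) (map_row (\<lambda>p. Polynomial.coeff p 0) ?g)"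
    by (simp add: map_row_def)
  finally have 1: "row_equiv ?g \<dots>" .
  have "row_equiv (map_row (\<lambda>p. Polynomial.coeff p 0) ?g) (vector [1, 0, 0])"
    using assms(1) unimodular_map[OF rhom_coeff_0 ug] unfolding rows_completable_def by blast
  from row_equiv_map[OF rhom_const_poly this]
  have "row_equiv (map_row (\<lambda>a. [:a:]) (map_row (\<lambda>p. Polynomial.coeff p 0) ?g)) (map_row (\<lambda>a. [:a:]) (vector [1, 0, 0]))" .
  also have "map_row (\<lambda>a. [:a:]) (vector [1, 0, 0] :: 'd^3) = vector [1, 0, 0]"
    by (simp add: vec_eq_iff forall_3 map_row_def one_pCons)
  finally have "row_equiv ?g (vector [1, 0, 0])" by (rule row_equiv_trans[OF 1])
  from row_equiv_left_inverse[OF \<theta>(1,2) \<theta>(3)[rule_format] this] show "row_equiv f (vector [1, 0, 0])"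
    by (rule row_equiv_trans[OF g(1)])
qed

lemma rows_completable_field: "rows_completable TYPE('k::field)"
  unfolding rows_completable_def
proof (intro allI impI)
  fix f :: "'k^3"
  assume f: "unimodular f"
  then obtain g where g: "row_equiv f g" "g $ 1 \<noteq> 0" by (rule row_equiv_first_nonzero)
  let ?a = "g $ 1" let ?b = "g $ 2" let ?c = "g $ 3"
  let ?P = "vector [vector [1 / ?a, - ?b / ?a, - ?c / ?a], vector [0, 1, 0], vector [0, 0, 1]] :: 'k^3^3"
  let ?Q = "vector [vector [?a, ?b, ?c], vector [0, 1, 0], vector [0, 0, 1]] :: 'k^3^3"
  have "?P ** ?Q = mat 1" "?Q ** ?P = mat 1" "g v* ?P = vector [1, 0, 0]"
    using g(2)
    by (simp_all add: vec_eq_iff forall_3 matrix_matrix_mult_def vector_matrix_mult_def sum_3 mat_def)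
  then have "row_equiv g (vector [1, 0, 0])" unfolding row_equiv_def by blast
  with g(1) show "row_equiv f (vector [1, 0, 0])" by (rule row_equiv_trans)
qed

section \<open>Nagata's change of variables, and iterated polynomial rings\<close>

definition evalp :: "('a::comm_ring_1 \<Rightarrow> 'b::comm_ring_1) \<Rightarrow> 'b \<Rightarrow> 'a poly \<Rightarrow> 'b" where
  "evalp c x p = poly (map_poly c p) x"

lemma evalp_0 [simp]: "evalp c x 0 = 0"
  by (simp add: evalp_def)

lemma evalp_pCons [simp]: "rhom c \<Longrightarrow> evalp c x (pCons a p) = c a + x * evalp c x p"
  by (simp add: evalp_def map_poly_pCons rhom_0)

lemma evalp_add: "rhom c \<Longrightarrow> evalp c x (p + q) = evalp c x p + evalp c x q"
  by (induction p q rule: poly_induct2) (simp_all add: rhom_add algebra_simps)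

lemma evalp_smult: "rhom c \<Longrightarrow> evalp c x (Polynomial.smult a p) = c a * evalp c x p"
  by (induction p) (simp_all add: rhom_mult algebra_simps)

lemma evalp_mult: "rhom c \<Longrightarrow> evalp c x (p * q) = evalp c x p * evalp c x q"
  by (induction p) (simp_all add: evalp_add evalp_smult rhom_0 algebra_simps)

lemma rhom_evalp: "rhom c \<Longrightarrow> rhom (evalp c x)"
  by (rule rhomI) (simp_all add: evalp_add evalp_mult one_pCons rhom_1)

lemma rhom_poly_eqI:
  assumes "rhom F" "rhom G" "\<And>a. F [:a:] = G [:a:]" "F [:0, 1:] = G [:0, 1:]"
  shows "F p = G p"
proof (induction p)
  case 0
  then show ?case by (simp add: assms rhom_0)
next
  case (pCons a p)
  have "pCons a p = [:a:] + [:0, 1:] * p" by simp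
  then show ?case by (simp add: assms rhom_add rhom_mult pCons del: mult_pCons_left)
qed

lemma rhom_poly_poly_eqI:
  fixes p :: "'a::comm_ring_1 poly poly"
  assumes "rhom F" "rhom G" "\<And>a. F [:[:a:]:] = G [:[:a:]:]" "F [:[:0, 1:]:] = G [:[:0, 1:]:]"
    "F [:0, 1:] = G [:0, 1:]"
  shows "F p = G p"
proof (rule rhom_poly_eqI[OF assms(1,2) _ assms(5)])
  fix a :: "'a poly"
  show "F [:a:] = G [:a:]"
    by (rule rhom_poly_eqI[where F = "\<lambda>a. F [:a:]"])
      (simp_all add: assms rhom_comp[OF _ rhom_const_poly])
qed

text \<open>\<open>twist w\<close> maps \<open>E[t][s]\<close> to \<open>E[s][t]\<close> by \<open>s \<mapsto> s + w(t)\<close>; its inverse is \<open>untwist w\<close>.\<close>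

definition lift_poly :: "'e::comm_ring_1 poly \<Rightarrow> 'e poly poly" where
  "lift_poly = map_poly (\<lambda>a. [:a:])"

definition twist :: "'e::comm_ring_1 poly \<Rightarrow> 'e poly poly \<Rightarrow> 'e poly poly" where
  "twist w = evalp lift_poly ([:[:0, 1:]:] + lift_poly w)"

definition untwist :: "'e::comm_ring_1 poly \<Rightarrow> 'e poly poly \<Rightarrow> 'e poly poly" where
  "untwist w = evalp (evalp (\<lambda>a. [:[:a:]:]) ([:0, 1:] - [:w:])) [:[:0, 1:]:]"

lemma lift_poly_evalp: "lift_poly p = evalp (\<lambda>a. [:[:a:]:]) [:0, 1:] p"
  by (induction p) (simp_all add: lift_poly_def map_poly_pCons rhom_comp[OF rhom_const_poly rhom_const_poly])

lemma rhom_lift_poly: "rhom lift_poly"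
  unfolding lift_poly_evalp[abs_def] by (intro rhom_evalp rhom_comp[OF rhom_const_poly rhom_const_poly])

lemma lift_poly_simps [simp]: "lift_poly [:a:] = [:[:a:]:]" "lift_poly [:0, 1:] = [:0, 1:]"
  by (simp_all add: lift_poly_def map_poly_pCons one_pCons)

lemma rhom_twist: "rhom (twist w)"
  unfolding twist_def by (intro rhom_evalp rhom_lift_poly)

lemma rhom_const2: "rhom (\<lambda>a. [:[:a:]:])"
  by (intro rhom_comp[OF rhom_const_poly rhom_const_poly])

lemma rhom_untwist: "rhom (untwist w)"
  unfolding untwist_def by (intro rhom_evalp rhom_const2)

lemma twist_simps: "twist w [:a:] = lift_poly a" "twist w [:0, 1:] = [:[:0, 1:]:] + lift_poly w"
  by (simp_all add: twist_def rhom_lift_poly rhom_1 rhom_0)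

lemma untwist_simps: "untwist w [:[:a:]:] = [:[:a:]:]" "untwist w [:[:0, 1:]:] = [:0, 1:] - [:w:]"
  "untwist w [:0, 1:] = [:[:0, 1:]:]"
  by (simp_all add: untwist_def rhom_const2 rhom_evalp rhom_1 rhom_0 flip: one_pCons)

lemma untwist_lift_poly: "untwist w (lift_poly p) = [:p:]"
  by (rule rhom_poly_eqI[where F = "\<lambda>p. untwist w (lift_poly p)"])
    (simp_all add: rhom_comp[OF rhom_untwist rhom_lift_poly] rhom_const_poly untwist_simps)

lemma untwist_twist: "untwist w (twist w p) = p"
  by (rule rhom_poly_eqI[where F = "\<lambda>p. untwist w (twist w p)"])
    (simp_all add: rhom_comp[OF rhom_untwist rhom_twist] rhom_id twist_simps untwist_lift_poly
      rhom_add[OF rhom_untwist] untwist_simps)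

text \<open>For \<open>w = 0\<close> both maps only exchange the two variables.\<close>

lemma twist_untwist_0: "twist 0 (untwist 0 p) = p"
  by (rule rhom_poly_poly_eqI[where F = "\<lambda>p. twist 0 (untwist 0 p)"])
    (simp_all add: rhom_comp[OF rhom_twist rhom_untwist] rhom_id untwist_simps twist_simps rhom_0[OF rhom_lift_poly])

lemma degree_lift_poly: "Polynomial.degree (lift_poly p) = Polynomial.degree p"
  unfolding lift_poly_def by (rule degree_map_poly) simp

lemma coeff_lift_poly: "Polynomial.coeff (lift_poly p) i = [:Polynomial.coeff p i:]"
  unfolding lift_poly_def by (simp add: coeff_map_poly)

text \<open>Nagata's trick: \<open>w\<close> is t^N with \<open>N\<close> larger than all degrees in
  t of the coefficients. Terms of different degree in s then have t-degrees in disjoint ranges, so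
  the top term dominates, and its leading coefficient is the given unit.\<close>

lemma twist_monic:
  fixes p :: "'e::idom poly poly"
  assumes "Polynomial.lead_coeff (Polynomial.lead_coeff p) dvd 1"
  obtains w where "Polynomial.lead_coeff (twist w p) dvd 1"
proof -
  define J where "J = Polynomial.degree p"
  define M where "M = Max ((\<lambda>j. Polynomial.degree (Polynomial.coeff p j)) ` {..J})"
  have M: "Polynomial.degree (Polynomial.coeff p j) \<le> M" if "j \<le> J" for j
    unfolding M_def using that by (intro Max_ge) auto
  define N where "N = Suc M"
  define w where "w = Polynomial.monom (1::'e) N"
  define x where "x = [:[:0, 1:]:] + lift_poly w"
  have lw: "lift_poly w = Polynomial.monom 1 N"
    by (rule poly_eqI) (simp add: coeff_lift_poly w_def one_pCons)
  have dx: "Polynomial.degree x = N" "Polynomial.lead_coeff x = 1"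
  proof -
    have *: "Polynomial.degree [:[:0, 1::'e:]:] < Polynomial.degree (lift_poly w)"
      by (simp add: lw degree_monom_eq N_def)
    show "Polynomial.degree x = N" unfolding x_def using degree_add_eq_right[OF *] by (simp add: lw degree_monom_eq)
    show "Polynomial.lead_coeff x = 1" unfolding x_def lead_coeff_add_le[OF *] by (simp add: lw degree_monom_eq)
  qed
  have p0: "p \<noteq> 0" using assms by auto
  have coeff_ne: "x ^ j \<noteq> 0" for j using dx by (intro power_not_zero) auto
  define T where "T j = lift_poly (Polynomial.coeff p j) * x ^ j" for j
  have deg_T: "Polynomial.degree (T j) = Polynomial.degree (Polynomial.coeff p j) + N * j"
    if "Polynomial.coeff p j \<noteq> 0" for j
  proof -
    have "lift_poly (Polynomial.coeff p j) \<noteq> 0"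
      using that by (metis coeff_lift_poly coeff_0 pCons_eq_0_iff leading_coeff_0_iff)
    then show ?thesis
      using degree_mult_eq[OF _ coeff_ne[of j]] degree_power_eq[of x j] coeff_ne[of 1]
      by (simp add: T_def degree_lift_poly dx(1) mult.commute[of j N])
  qed
  have dJ: "Polynomial.degree (T J) \<ge> N * J" using deg_T[of J] p0 by (simp add: J_def)
  have dm: "Polynomial.degree (map_poly lift_poly p) = J"
    unfolding J_def
    by (rule degree_map_poly) (metis coeff_lift_poly leading_coeff_0_iff pCons_eq_0_iff coeff_0)
  have "twist w p = (\<Sum>j\<le>J. T j)"
    unfolding twist_def evalp_def poly_altdef dm x_def[symmetric] T_def
    by (simp add: coeff_map_poly rhom_0[OF rhom_lift_poly])
  then have tw: "twist w p = (\<Sum>j<J. T j) + T J"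
    by (simp flip: lessThan_Suc_atMost)
  have lcJ: "Polynomial.lead_coeff (T J) = [:Polynomial.lead_coeff (Polynomial.lead_coeff p):]"
    unfolding T_def lead_coeff_mult lead_coeff_power dx(2) by (simp add: coeff_lift_poly degree_lift_poly J_def)
  have "Polynomial.lead_coeff ((\<Sum>j<J. T j) + T J) = Polynomial.lead_coeff (T J)"
  proof (cases "J = 0")
    case False
    have "Polynomial.degree (\<Sum>j<J. T j) < N * J"
    proof (rule degree_sum_less)
      fix j assume "j \<in> {..<J}"
      then have j: "j < J" by simp
      show "Polynomial.degree (T j) < N * J"
      proof (cases "Polynomial.coeff p j = 0")
        case True
        then show ?thesis using False by (simp add: T_def rhom_0[OF rhom_lift_poly] N_def)
      next
        case nz: False
        have "Polynomial.degree (T j) \<le> M + N * j" using deg_T[OF nz] M[of j] j by simp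
        also have "\<dots> < N * Suc j" by (simp add: N_def)
        also have "\<dots> \<le> N * J" using j by (intro mult_le_mono) auto
        finally show ?thesis .
      qed
    qed (use False in \<open>simp add: N_def\<close>)
    then show ?thesis using dJ by (intro lead_coeff_add_le) simp
  qed simp
  then have lc: "Polynomial.lead_coeff (twist w p) = [:Polynomial.lead_coeff (Polynomial.lead_coeff p):]"
    unfolding tw lcJ .
  obtain k where "1 = Polynomial.lead_coeff (Polynomial.lead_coeff p) * k" using assms by (elim dvdE)
  then have "1 = [:Polynomial.lead_coeff (Polynomial.lead_coeff p):] * [:k:]" by (simp add: one_pCons mult.commute)
  then have "Polynomial.lead_coeff (twist w p) dvd 1" unfolding lc by (rule dvdI)
  then show thesis by (rule that)
qed

lemma rhom_map_poly: "rhom c \<Longrightarrow> rhom (map_poly c)"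
proof -
  assume c: "rhom c"
  have "map_poly c = evalp (\<lambda>a. [:c a:]) [:0, 1:]"
  proof
    show "map_poly c p = evalp (\<lambda>a. [:c a:]) [:0, 1:] p" for p
      by (induction p) (simp_all add: map_poly_pCons c rhom_comp[OF rhom_const_poly] rhom_0)
  qed
  then show ?thesis by (simp add: rhom_evalp rhom_comp[OF rhom_const_poly c])
qed

text \<open>The twist wants a leading coefficient that itself has a unit leading coefficient. This
  is arranged by the hypothesis for the leading coefficient of \<open>untwist 0 p\<close>, applied
  to all coefficients alike.\<close>

lemma normalizable_poly:
  assumes "normalizable TYPE('e::idom)"
  shows "normalizable TYPE('e poly)"
  unfolding normalizable_def
proof (intro allI impI)
  fix p :: "'e poly poly"
  assume "p \<noteq> 0"
  then have "untwist 0 p \<noteq> 0" using twist_untwist_0[of p] rhom_0[OF rhom_twist] by metis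
  then have "Polynomial.lead_coeff (untwist 0 p) \<noteq> 0" by simp
  then obtain \<theta> \<theta>' :: "'e poly \<Rightarrow> 'e poly" where \<theta>: "rhom \<theta>" "rhom \<theta>'" "\<forall>q. \<theta>' (\<theta> q) = q"
    "Polynomial.lead_coeff (\<theta> (Polynomial.lead_coeff (untwist 0 p))) dvd 1"
    using normalizableD[OF assms] by blast
  have inj: "\<theta> q = 0 \<Longrightarrow> q = 0" for q using \<theta> rhom_0 by metis
  let ?p = "map_poly \<theta> (untwist 0 p)"
  have "Polynomial.degree ?p = Polynomial.degree (untwist 0 p)"
    by (rule degree_map_poly) (use inj in blast)
  then have "Polynomial.lead_coeff ?p = \<theta> (Polynomial.lead_coeff (untwist 0 p))"
    by (simp add: coeff_map_poly rhom_0[OF \<theta>(1)])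
  then obtain w where w: "Polynomial.lead_coeff (twist w ?p) dvd 1" using \<theta>(4) twist_monic[of ?p] by metis
  have "map_poly \<theta>' (map_poly \<theta> q) = q" for q
    by (rule poly_eqI) (simp add: coeff_map_poly rhom_0 \<theta>)
  then have "twist 0 (map_poly \<theta>' (untwist w (twist w (map_poly \<theta> (untwist 0 q))))) = q" for q
    by (simp add: untwist_twist twist_untwist_0)
  then show "\<exists>\<theta> \<theta>' :: 'e poly poly \<Rightarrow> 'e poly poly. rhom \<theta> \<and> rhom \<theta>' \<and> (\<forall>q. \<theta>' (\<theta> q) = q) \<and> Polynomial.lead_coeff (\<theta> p) dvd 1"
    using w by (intro exI[of _ "\<lambda>q. twist w (map_poly \<theta> (untwist 0 q))"]
        exI[of _ "\<lambda>q. twist 0 (map_poly \<theta>' (untwist w q))"])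
      (auto intro!: rhom_comp[OF rhom_twist] rhom_comp[OF rhom_map_poly] rhom_untwist \<theta>)
qed

lemma normalizable_field: "normalizable TYPE('k::field)"
  unfolding normalizable_def
proof (intro allI impI)
  fix p :: "'k poly"
  assume "p \<noteq> 0"
  then have "Polynomial.lead_coeff p dvd 1" by (simp add: dvd_field_iff)
  then show "\<exists>\<theta> \<theta>' :: 'k poly \<Rightarrow> 'k poly. rhom \<theta> \<and> rhom \<theta>' \<and> (\<forall>q. \<theta>' (\<theta> q) = q) \<and> Polynomial.lead_coeff (\<theta> p) dvd 1"
    using rhom_id by (intro exI[of _ "\<lambda>q :: 'k poly. q"]) auto
qed

lemma forall_4': "(\<forall>i::4. P i) \<longleftrightarrow> P 0 \<and> P 1 \<and> P 2 \<and> P 3"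
proof -
  have "(4::4) = 0" by simp
  then show ?thesis using forall_4[of P] by metis
qed

text \<open>Four steps up from the field, variable 3 becoming the outermost one; the identity
  \<open>G (F p) = p\<close> brings the equivalence back to the multivariate ring.\<close>

lemma rows_completable_mpoly4: "rows_completable TYPE((4, 'k::field) mpoly)"
proof -
  have *: "rows_completable TYPE('k poly poly poly poly)"
    by (intro rows_completable_poly normalizable_poly rows_completable_field normalizable_field)
  define F :: "(4, 'k) mpoly \<Rightarrow> 'k poly poly poly poly" where
    "F = poly_subst (\<lambda>c. [:[:[:[:c:]:]:]:])
      (\<lambda>i. if i = 0 then [:[:[:[:0, 1:]:]:]:] else if i = 1 then [:[:[:0, 1:]:]:]
        else if i = 2 then [:[:0, 1:]:] else [:0, 1:])"
  define G :: "'k poly poly poly poly \<Rightarrow> (4, 'k) mpoly" where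
    "G = evalp (evalp (evalp (evalp Const (Var 0)) (Var 1)) (Var 2)) (Var 3)"
  have c: "rhom (\<lambda>c::'k. [:[:[:[:c:]:]:]:])"
    by (intro rhom_comp[OF rhom_const_poly] rhom_const_poly)
  have F: "rhom F" unfolding F_def by (intro rhom_poly_subst c)
  have G: "rhom G" unfolding G_def by (intro rhom_evalp rhom_Const)
  have G_simps: "G [:a:] = evalp (evalp (evalp Const (Var 0)) (Var 1)) (Var 2) a"
    "G [:0, 1:] = Var 3" for a
    unfolding G_def by (simp_all add: rhom_evalp rhom_Const rhom_0 rhom_1)
  have F_simps: "F (Const a) = [:[:[:[:a:]:]:]:]" "F (Var 0) = [:[:[:[:0, 1:]:]:]:]"
    "F (Var 1) = [:[:[:0, 1:]:]:]" "F (Var 2) = [:[:0, 1:]:]" "F (Var 3) = [:0, 1:]" for a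
    unfolding F_def by (simp_all add: c)
  have GF: "G (F p) = p" for p
  proof (rule rhom_mpoly_eqI[where F = "\<lambda>p. G (F p)"])
    show "G (F (Var i)) = Var i" for i
    proof -
      have "\<forall>i::4. G (F (Var i)) = Var i"
        unfolding forall_4' F_simps
        by (simp add: G_simps rhom_evalp rhom_Const rhom_1 rhom_0)
      then show ?thesis by blast
    qed
  qed (simp_all add: rhom_comp[OF G F] rhom_id F_simps G_simps rhom_evalp rhom_Const)
  show ?thesis
    unfolding rows_completable_def
  proof (intro allI impI)
    fix f :: "(4, 'k) mpoly^3"
    assume "unimodular f"
    then have "row_equiv (map_row F f) (vector [1, 0, 0])"
      using * unimodular_map[OF F] unfolding rows_completable_def by blast
    then show "row_equiv f (vector [1, 0, 0])" by (rule row_equiv_left_inverse[OF F G GF])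
  qed
qed

section \<open>Localization of subrings\<close>

text \<open>In a field and for \<open>f\<close> nonzero in the subring \<open>S\<close> this is
  S[1/f]. As localizations are subsets of one ambient ring, they can be compared and
  intersected.\<close>

definition loc :: "'a::comm_ring_1 set \<Rightarrow> 'a \<Rightarrow> 'a set" where
  "loc S f = {a. \<exists>n. f ^ n * a \<in> S}"

lemma locI: "f ^ n * a \<in> S \<Longrightarrow> a \<in> loc S f"
  by (auto simp: loc_def)

lemma loc_base: "S \<subseteq> loc S f"
  using locI[where n = 0] by auto

lemma loc_mono: "S \<subseteq> S' \<Longrightarrow> loc S f \<subseteq> loc S' f"
  by (auto simp: loc_def)

lemma power_mult_mono:
  assumes "subringset S" "f \<in> S" "f ^ n * a \<in> S" "n \<le> m"
  shows "f ^ m * a \<in> S"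
proof -
  have "f ^ m * a = f ^ (m - n) * (f ^ n * a)"
    using assms(4) by (simp flip: power_add mult.assoc)
  then show ?thesis using assms subringsetD(6,7)[OF assms(1)] by simp
qed

lemma subringset_loc:
  assumes "subringset S" "f \<in> S"
  shows "subringset (loc S f)"
  unfolding subringset_def
proof (intro conjI ballI)
  show "1 \<in> loc S f" using loc_base subringsetD(2)[OF assms(1)] by blast
  fix a b assume "a \<in> loc S f" "b \<in> loc S f"
  then obtain n m where nm: "f ^ n * a \<in> S" "f ^ m * b \<in> S" by (auto simp: loc_def)
  have "f ^ (n + m) * a \<in> S" "f ^ (n + m) * b \<in> S"
    using power_mult_mono[OF assms] nm by simp_all
  then have "f ^ (n + m) * (a - b) \<in> S"
    using subringsetD(4)[OF assms(1)] by (simp add: right_diff_distrib)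
  then show "a - b \<in> loc S f" by (rule locI)
  have "f ^ (n + m) * (a * b) = (f ^ n * a) * (f ^ m * b)" by (simp add: power_add mult_ac)
  then show "a * b \<in> loc S f" using subringsetD(6)[OF assms(1) nm] by (intro locI[where n = "n + m"]) simp
qed

lemma loc_loc:
  assumes "subringset S" "f \<in> S" "g \<in> S"
  shows "loc (loc S g) f = loc S (f * g)"
proof (intro equalityI subsetI)
  fix a assume "a \<in> loc (loc S g) f"
  then obtain n m where nm: "g ^ m * (f ^ n * a) \<in> S" by (auto simp: loc_def)
  have "(f * g) ^ (n + m) * a = (f ^ m * g ^ n) * (g ^ m * (f ^ n * a))"
    by (simp add: power_add power_mult_distrib mult_ac)
  then show "a \<in> loc S (f * g)"
    using subringsetD(6,7)[OF assms(1)] nm assms(2,3) by (intro locI[where n = "n + m"]) simp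
next
  fix a assume "a \<in> loc S (f * g)"
  then obtain n where "(f * g) ^ n * a \<in> S" by (auto simp: loc_def)
  then have "g ^ n * (f ^ n * a) \<in> S" by (simp add: power_mult_distrib mult_ac)
  then show "a \<in> loc (loc S g) f" by (intro locI)
qed

lemma comaximal_power:
  assumes S: "subringset S" "f \<in> S" "g \<in> S" and "u \<in> S" "v \<in> S" "u * f + v * g = 1"
  obtains u' v' where "u' \<in> S" "v' \<in> S" "u' * f ^ n + v' * g = 1"
proof -
  have "\<exists>u'\<in>S. \<exists>v'\<in>S. u' * f ^ n + v' * g = 1"
  proof (induction n)
    case 0
    show ?case using subringsetD(1,2)[OF S(1)] by (intro bexI[of _ 1] bexI[of _ 0]) auto
  next
    case (Suc n)
    then obtain u' v' where *: "u' \<in> S" "v' \<in> S" "u' * f ^ n + v' * g = 1" by blast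
    have "(u * u') * f ^ Suc n + (u * f * v' + v * (u' * f ^ n + v' * g)) * g =
        (u * f + v * g) * (u' * f ^ n + v' * g)"
      by (simp add: algebra_simps)
    also have "\<dots> = 1" by (simp add: * assms)
    finally have "(u * u') * f ^ Suc n + (u * f * v' + v * (u' * f ^ n + v' * g)) * g = 1" .
    moreover have "u * u' \<in> S" "u * f * v' + v * (u' * f ^ n + v' * g) \<in> S"
      using * assms subringsetD(5-7)[OF S(1)] by simp_all
    ultimately show ?case by blast
  qed
  then show thesis using that by blast
qed

lemma comaximal_powers:
  assumes S: "subringset S" "f \<in> S" "g \<in> S" and "u \<in> S" "v \<in> S" "u * f + v * g = 1"
  obtains u' v' where "u' \<in> S" "v' \<in> S" "u' * f ^ n + v' * g ^ m = 1"
proof -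
  obtain u' v' where 1: "u' \<in> S" "v' \<in> S" "u' * f ^ n + v' * g = 1"
    using comaximal_power[OF assms] by blast
  then have "v' * g + u' * f ^ n = 1" by (simp add: add.commute)
  then obtain v'' u'' where "v'' \<in> S" "u'' \<in> S" "v'' * g ^ m + u'' * f ^ n = 1"
    using comaximal_power[OF S(1,3) subringsetD(7)[OF S(1,2)] 1(2,1)] by blast
  then show thesis using that[of u'' v''] by (simp add: add.commute)
qed

text \<open>Partition of unity: multiplying \<open>a\<close> by u' f^n + v' g^m = 1 writes it as a
  sum of two elements of \<open>S\<close>.\<close>

lemma loc_Int_comaximal:
  assumes S: "subringset S" "f \<in> S" "g \<in> S" and "u \<in> S" "v \<in> S" "u * f + v * g = 1"
  shows "loc S f \<inter> loc S g = S"
proof (intro equalityI subsetI)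
  fix a assume "a \<in> loc S f \<inter> loc S g"
  then obtain n m where nm: "f ^ n * a \<in> S" "g ^ m * a \<in> S" by (auto simp: loc_def)
  obtain u' v' where uv: "u' \<in> S" "v' \<in> S" "u' * f ^ n + v' * g ^ m = 1"
    using comaximal_powers[OF assms] by blast
  have "a = (u' * f ^ n + v' * g ^ m) * a" by (simp add: uv)
  also have "\<dots> = u' * (f ^ n * a) + v' * (g ^ m * a)" by (simp add: algebra_simps)
  also have "\<dots> \<in> S" using uv nm subringsetD(5,6)[OF S(1)] by simp
  finally show "a \<in> S" .
qed (use loc_base in blast)

text \<open>The sum of the individual bounds works for all; this is how common denominators are
  found.\<close>

lemma finite_max_bound:
  fixes P :: "'i \<Rightarrow> nat \<Rightarrow> bool"
  assumes "finite I" "\<And>i. i \<in> I \<Longrightarrow> \<exists>n. P i n" "\<And>i n m. P i n \<Longrightarrow> n \<le> m \<Longrightarrow> P i m"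
  shows "\<exists>n. \<forall>i\<in>I. P i n"
proof -
  obtain k where "\<And>i. i \<in> I \<Longrightarrow> P i (k i)" using assms(2) by metis
  then have "\<forall>i\<in>I. P i (sum k I)"
    using assms(1,3) by (meson member_le_sum zero_le)
  then show ?thesis by blast
qed

text \<open>Finitely many coefficients have a common denominator.\<close>

lemma polys_loc:
  assumes "subringset S" "f \<in> S"
  shows "polys (loc S f) = loc (polys S) (Const f :: ('n::finite, 'a::comm_ring_1) mpoly)"
proof -
  have Cm: "Poly_Mapping.lookup (Const c * p) m = c * Poly_Mapping.lookup p m" for c :: 'a and p :: "('n, 'a) mpoly" and m
  proof -
    have "Const c * p = Poly_Mapping.map ((*) c) p" by (simp add: Const_def mult_map_scale_conv_mult)
    then show ?thesis by (simp add: Poly_Mapping.map.rep_eq when_def)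
  qed
  have C: "Const f ^ n * p \<in> polys S \<longleftrightarrow> (\<forall>m. f ^ n * Poly_Mapping.lookup p m \<in> S)" for n and p :: "('n, 'a) mpoly"
    by (simp add: polys_def Cm flip: rhom_power[OF rhom_Const])
  show ?thesis
  proof (intro equalityI subsetI)
    fix p :: "('n, 'a) mpoly" assume p: "p \<in> polys (loc S f)"
    have "\<exists>n. \<forall>m\<in>Poly_Mapping.keys p. f ^ n * Poly_Mapping.lookup p m \<in> S"
      using p power_mult_mono[OF assms] by (intro finite_max_bound) (auto simp: polys_def loc_def)
    then obtain n where "\<forall>m\<in>Poly_Mapping.keys p. f ^ n * Poly_Mapping.lookup p m \<in> S" ..
    then have "f ^ n * Poly_Mapping.lookup p m \<in> S" for m
      using subringsetD(1)[OF assms(1)] by (cases "m \<in> Poly_Mapping.keys p") (auto simp: in_keys_iff)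
    then show "p \<in> loc (polys S) (Const f)" using C by (intro locI) blast
  next
    fix p :: "('n, 'a) mpoly" assume "p \<in> loc (polys S) (Const f)"
    then obtain n where "Const f ^ n * p \<in> polys S" by (auto simp: loc_def)
    then have "\<forall>m. f ^ n * Poly_Mapping.lookup p m \<in> S" by (rule C[THEN iffD1])
    then show "p \<in> polys (loc S f)" unfolding polys_def loc_def by blast
  qed
qed

lemma inverse_power_loc: "subringset S \<Longrightarrow> (f :: 'a::field) \<noteq> 0 \<Longrightarrow> inverse (f ^ n) \<in> loc S f"
  by (rule locI[where n = n]) (simp add: subringsetD)

lemma adjoin_loc:
  fixes f :: "'a::field"
  assumes "subringset S" "f \<in> S" "f \<noteq> 0"
  shows "adjoin (loc S f) z = loc (adjoin S z) f"
proof (intro equalityI adjoin_least subringset_loc subringset_adjoin loc_mono)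
  show "loc (adjoin S z) f \<subseteq> adjoin (loc S f) z"
  proof
    fix a assume "a \<in> loc (adjoin S z) f"
    then obtain n where n: "f ^ n * a \<in> adjoin S z" by (auto simp: loc_def)
    note R = subringset_loc[OF assms(1,2)]
    have "f ^ n * a \<in> adjoin (loc S f) z" using n adjoin_mono[OF loc_base, of S z f] by blast
    with adjoin_base[OF R inverse_power_loc[OF assms(1,3)]]
    have "inverse (f ^ n) * (f ^ n * a) \<in> adjoin (loc S f) z"
      by (rule subringsetD(6)[OF subringset_adjoin[OF R]])
    moreover have "inverse (f ^ n) * (f ^ n * a) = a" using assms(3) by (simp flip: mult.assoc)
    ultimately show "a \<in> adjoin (loc S f) z" by simp
  qed
  show "S \<subseteq> adjoin S z" using adjoin_base[OF assms(1)] by blast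
  show "z i \<in> loc (adjoin S z) f" for i using adjoin_gen[OF assms(1)] loc_base by blast
qed (use assms adjoin_base in auto)

text \<open>Each positive power of the argument f^n b contains a factor f^n, which absorbs the
  denominator of its coefficient. The constant term receives no such factor and has to lie in
  \<open>S\<close> from the start; in the application it is the identity automorphism.\<close>

lemma clear_denominators:
  fixes q :: "'i::finite \<Rightarrow> 'r::comm_ring_1 poly"
  assumes S: "subringset S" "f \<in> S"
    and q: "\<And>i n. Polynomial.coeff (q i) n \<in> loc S f" "\<And>i. Polynomial.coeff (q i) 0 \<in> S"
  shows "\<exists>N. \<forall>n\<ge>N. \<forall>b\<in>S. \<forall>i. poly (q i) (f ^ n * b) \<in> S"
proof -
  have "\<exists>N. \<forall>(i, j)\<in>(SIGMA i:UNIV. {..Polynomial.degree (q i)}). f ^ N * Polynomial.coeff (q i) j \<in> S"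
    using q(1) power_mult_mono[OF S] by (intro finite_max_bound) (auto simp: loc_def)
  then obtain N where N: "\<And>i j. j \<le> Polynomial.degree (q i) \<Longrightarrow> f ^ N * Polynomial.coeff (q i) j \<in> S"
    by auto
  show ?thesis
  proof (intro exI[of _ N] allI impI ballI)
    fix n b i assume n: "N \<le> n" and b: "b \<in> S"
    show "poly (q i) (f ^ n * b) \<in> S"
      unfolding poly_altdef
    proof (rule subringset_sum[OF S(1)])
      fix j assume "j \<in> {..Polynomial.degree (q i)}"
      then have j: "j \<le> Polynomial.degree (q i)" by simp
      show "Polynomial.coeff (q i) j * (f ^ n * b) ^ j \<in> S"
      proof (cases j)
        case 0
        then show ?thesis using q(2) by simp
      next
        case (Suc k)
        have "Polynomial.coeff (q i) j * (f ^ n * b) ^ j =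
            (f ^ n * Polynomial.coeff (q i) j) * (b * (f ^ n * b) ^ k)"
          by (simp add: Suc mult_ac)
        moreover have "f ^ n * Polynomial.coeff (q i) j \<in> S" using power_mult_mono[OF S N[OF j] n] .
        ultimately show ?thesis using b S subringsetD(6,7)[OF S(1)] by simp
      qed
    qed
  qed
qed

section \<open>Patching coordinate systems\<close>

definition evl :: "('n::finite \<Rightarrow> 'a::comm_ring_1) \<Rightarrow> ('n, 'a) mpoly \<Rightarrow> 'a" where
  "evl z = poly_subst (\<lambda>a. a) z"

definition sbst :: "('n::finite \<Rightarrow> ('m, 'a::comm_ring_1) mpoly) \<Rightarrow> ('n, 'a) mpoly \<Rightarrow> ('m, 'a) mpoly" where
  "sbst w = poly_subst Const w"

lemma rhom_evl: "rhom (evl z)"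
  by (simp add: evl_def rhom_eval)

lemma rhom_sbst: "rhom (sbst w)"
  by (simp add: sbst_def rhom_poly_subst rhom_Const)

lemma evl_simps [simp]: "evl z (Const a) = a" "evl z (Var i) = z i"
  by (simp_all add: evl_def)

lemma sbst_simps [simp]: "sbst w (Const a) = Const a" "sbst w (Var i) = w i"
  by (simp_all add: sbst_def rhom_Const)

lemma evl_sbst: "evl z (sbst w p) = evl (\<lambda>i. evl z (w i)) p"
  by (rule rhom_mpoly_eqI[where F = "\<lambda>p. evl z (sbst w p)"])
    (simp_all add: rhom_comp[OF rhom_evl rhom_sbst] rhom_evl)

lemma sbst_polys:
  assumes "subringset S" "\<And>i. w i \<in> polys S" "p \<in> polys S"
  shows "sbst w p \<in> polys S"
  unfolding sbst_def
  by (rule poly_subst_closed[OF subringset_polys[OF assms(1)] assms(3)]) (simp_all add: assms Const_polys)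

lemma evl_closed: "subringset S \<Longrightarrow> p \<in> polys S \<Longrightarrow> (\<And>i. z i \<in> S) \<Longrightarrow> evl z p \<in> S"
  unfolding evl_def by (rule poly_subst_closed[where S = S]) auto

lemma evl_adjoin: "p \<in> polys S \<Longrightarrow> evl z p \<in> adjoin S z"
  by (auto simp: adjoin_def evl_def)

lemma adjoin_evl: "a \<in> adjoin S z \<longleftrightarrow> (\<exists>p\<in>polys S. a = evl z p)"
  by (auto simp: adjoin_def evl_def)

lemma indep_evl_eqI:
  "subringset S \<Longrightarrow> indep S z \<Longrightarrow> p \<in> polys S \<Longrightarrow> q \<in> polys S \<Longrightarrow> evl z p = evl z q \<Longrightarrow> p = q"
  unfolding evl_def by (rule indepD)

text \<open>Restriction to the lines d + T Y through \<open>d\<close>, where Y are the variables and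
  T is the new polynomial variable. Its coefficients at T^0 and T^1 are the value and the linear
  part at \<open>d\<close>, and dividing by T is a shift of coefficients.\<close>

definition line_subst :: "('n::finite \<Rightarrow> 'a::comm_ring_1) \<Rightarrow> ('n, 'a) mpoly \<Rightarrow> ('n, 'a) mpoly poly" where
  "line_subst d = poly_subst (\<lambda>a. [:Const a:]) (\<lambda>k. [:Const (d k), Var k:])"

lemma rhom_const_Const: "rhom (\<lambda>a. [:Const a :: ('n, 'a::comm_ring_1) mpoly:])"
  by (rule rhom_comp[OF rhom_const_poly rhom_Const])

lemma rhom_line_subst: "rhom (line_subst d)"
  by (simp add: line_subst_def rhom_poly_subst rhom_const_Const)

lemma line_subst_simps [simp]:
  "line_subst d (Const a) = [:Const a:]" "line_subst d (Var k) = [:Const (d k), Var k:]"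
  by (simp_all add: line_subst_def rhom_const_Const)

lemma coeff_line_subst_0: "Polynomial.coeff (line_subst d p) 0 = Const (evl d p)"
  by (rule rhom_mpoly_eqI[where F = "\<lambda>p. Polynomial.coeff (line_subst d p) 0"])
    (simp_all add: rhom_comp[OF rhom_coeff_0 rhom_line_subst] rhom_comp[OF rhom_Const rhom_evl])

lemma coeff_line_subst_1:
  "Polynomial.coeff (line_subst d p) 1 = (\<Sum>k\<in>UNIV. Const (evl d (pd k p)) * Var k)"
  by (subst chain_rule[where F = "\<lambda>p. Const (evl d p)" and \<delta> = "\<lambda>p. Polynomial.coeff (line_subst d p) 1"])
    (simp_all add: rhom_comp[OF rhom_Const rhom_evl] rhom_simps[OF rhom_line_subst] coeff_mult_1 coeff_line_subst_0)

lemma rhom_poly: "rhom (\<lambda>q. poly q x)"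
  by (rule rhomI) simp_all

lemma poly_line_subst: "poly (line_subst d p) (Const a) = sbst (\<lambda>k. Const (d k) + Const a * Var k) p"
  by (rule rhom_mpoly_eqI[where F = "\<lambda>p. poly (line_subst d p) (Const a)"])
    (simp_all add: rhom_comp[OF rhom_poly rhom_line_subst] rhom_sbst)

definition cpolys :: "'a::comm_ring_1 set \<Rightarrow> 'a poly set" where
  "cpolys S = {q. \<forall>n. Polynomial.coeff q n \<in> S}"

lemma subringset_cpolys: "subringset S \<Longrightarrow> subringset (cpolys S)"
  unfolding subringset_def[of "cpolys S"]
  by (auto simp: cpolys_def coeff_mult subringsetD intro!: subringset_sum split: if_splits)

lemma pCons_cpolys: "pCons a q \<in> cpolys S \<longleftrightarrow> a \<in> S \<and> q \<in> cpolys S"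
  unfolding cpolys_def mem_Collect_eq by (metis coeff_pCons_0 coeff_pCons_Suc not0_implies_Suc)

lemma zero_cpolys: "subringset S \<Longrightarrow> 0 \<in> cpolys S"
  by (simp add: subringsetD subringset_cpolys)

lemma line_subst_cpolys:
  assumes S: "subringset S" "p \<in> polys S" "\<And>k. d k \<in> S"
  shows "line_subst d p \<in> cpolys (polys S)"
  unfolding line_subst_def
  by (rule poly_subst_closed[OF _ assms(2)])
    (simp_all add: S subringset_cpolys subringset_polys pCons_cpolys zero_cpolys Const_polys Var_polys)

lemma poly_closed: "subringset S \<Longrightarrow> q \<in> cpolys S \<Longrightarrow> x \<in> S \<Longrightarrow> poly q x \<in> S"
  unfolding poly_altdef by (intro subringset_sum) (auto simp: cpolys_def subringsetD)

text \<open>\<open>poly_shift 1\<close> drops the constant coefficient and divides by the variable,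
  which is the factor T^-1 of the deformation.\<close>

lemma poly_shift_line: "pCons (Polynomial.coeff q 0) (poly_shift 1 q) = q"
  by (rule poly_eqI) (simp add: coeff_poly_shift coeff_pCons split: nat.splits)

lemma sbst_Var: "sbst Var p = p"
  by (simp add: sbst_def poly_subst_Const_Var)

lemma sbst_sbst: "sbst w (sbst w' p) = sbst (\<lambda>i. sbst w (w' i)) p"
  by (rule rhom_mpoly_eqI[where F = "\<lambda>p. sbst w (sbst w' p)"])
    (simp_all add: rhom_comp[OF rhom_sbst rhom_sbst] rhom_sbst)

lemma pd_sbst: "pd m (sbst w p) = (\<Sum>i\<in>UNIV. sbst w (pd i p) * pd m (w i))"
  using chain_rule[of "sbst w" "\<lambda>p. pd m (sbst w p)" p]
  by (simp add: rhom_sbst rhom_simps[OF rhom_sbst] pd_add pd_mult)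

lemma poly_map_Const: "poly (map_poly Const q) (Const a) = (Const (poly q a) :: ('n::finite, 'a::comm_ring_1) mpoly)"
  by (rule rhom_poly_eqI[where F = "\<lambda>q. poly (map_poly Const q) (Const a)"])
    (simp_all add: rhom_comp[OF rhom_poly rhom_map_poly[OF rhom_Const]] rhom_comp[OF rhom_Const rhom_poly]
      map_poly_pCons)

lemma map_Const_cpolys: "subringset S \<Longrightarrow> q \<in> cpolys S \<Longrightarrow> map_poly Const q \<in> cpolys (polys S)"
  by (simp add: cpolys_def coeff_map_poly Const_polys)

lemma smult_cpolys: "subringset S \<Longrightarrow> a \<in> S \<Longrightarrow> q \<in> cpolys S \<Longrightarrow> Polynomial.smult a q \<in> cpolys S"
  by (simp add: cpolys_def subringsetD)

lemma pcompose_cpolys: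
  assumes S: "subringset S"
  shows "q \<in> cpolys S \<Longrightarrow> r \<in> cpolys S \<Longrightarrow> pcompose q r \<in> cpolys S"
proof (induction q)
  case (pCons a q)
  then show ?case
    unfolding pcompose_pCons
    by (intro subringsetD(5,6)[OF subringset_cpolys[OF S]]) (simp_all add: pCons_cpolys zero_cpolys S)
qed (simp add: zero_cpolys S)

lemma poly_shift_cpolys: "q \<in> cpolys S \<Longrightarrow> poly_shift n q \<in> cpolys S"
  by (simp add: cpolys_def coeff_poly_shift)

lemma evalp_closed:
  assumes "subringset R" "q \<in> cpolys S" "\<And>a. a \<in> S \<Longrightarrow> c a \<in> R" "x \<in> R" "c 0 = 0"
  shows "evalp c x q \<in> R"
  unfolding evalp_def using assms
  by (intro poly_closed) (auto simp: cpolys_def coeff_map_poly)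

lemma sum_of_bool [simp]:
  fixes f :: "'i::finite \<Rightarrow> 'a::comm_ring_1"
  shows "(\<Sum>k\<in>UNIV. f k * of_bool (k = i)) = f i" "(\<Sum>k\<in>UNIV. f k * of_bool (i = k)) = f i"
  by (simp_all add: of_bool_def if_distrib cong: if_cong)

text \<open>The automorphism \<open>\<phi>\<close> is deformed through automorphisms to the identity:
  \<open>\<Theta>\<^sub>T(Y) = T c + T\<^sup>-\<^sup>1 (\<phi>(T Y) - c) K\<^sub>T\<close> where \<open>c = \<phi>(0)\<close> and \<open>K\<close> deforms the inverse of the linear part
  of \<open>\<phi>\<close> to the identity.\<close>

lemma automorphism_homotopy:
  fixes \<phi> \<psi> :: "'n::finite \<Rightarrow> ('n, 'a::field) mpoly" and K K' :: "'n \<Rightarrow> 'n \<Rightarrow> 'a poly"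
  defines "c \<equiv> \<lambda>k. evl (\<lambda>_. 0) (\<phi> k)" and "L \<equiv> \<lambda>i j. evl (\<lambda>_. 0) (pd i (\<phi> j))"
  assumes T: "subringset T" and \<phi>: "\<And>j. \<phi> j \<in> polys T" and \<psi>: "\<And>j. \<psi> j \<in> polys T"
    and inv: "\<And>j. sbst \<phi> (\<psi> j) = Var j"
    and K: "\<And>i j. K i j \<in> cpolys T" and K': "\<And>i j. K' i j \<in> cpolys T"
    and KK': "\<And>i k. (\<Sum>j\<in>UNIV. K i j * K' j k) = of_bool (i = k)"
    and K0: "\<And>i j. (\<Sum>k\<in>UNIV. L i k * Polynomial.coeff (K k j) 0) = of_bool (i = j)"
    and K'0: "\<And>i j. Polynomial.coeff (K' i j) 0 = L i j"
    and K1: "\<And>i j. poly (K i j) 1 = of_bool (i = j)" and K'1: "\<And>i j. poly (K' i j) 1 = of_bool (i = j)"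
  obtains \<Theta> \<Psi> :: "'n \<Rightarrow> ('n, 'a) mpoly poly"
  where "\<And>j. \<Theta> j \<in> cpolys (polys T)" "\<And>j. \<Psi> j \<in> cpolys (polys T)"
    "\<And>j. Polynomial.coeff (\<Theta> j) 0 = Var j" "\<And>j. Polynomial.coeff (\<Psi> j) 0 = Var j"
    "\<And>j. poly (\<Theta> j) 1 = \<phi> j" "\<And>j. poly (\<Psi> j) 1 = \<psi> j"
    "\<And>a Y Z j. (\<And>k. Z k = evl Y (poly (\<Theta> k) (Const a))) \<Longrightarrow> evl Z (poly (\<Psi> j) (Const a)) = Y j"
proof -
  let ?z = "\<lambda>_::'n. 0::'a"
  note C = rhom_simps[OF rhom_Const, symmetric]
  \<comment> \<open>\<open>W\<close> is T^-1 (\<phi>(T Y) - c) and \<open>U\<close> is T^-1 \<psi>(c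
    + T Y). Both are polynomial in T, the second because \<psi>(c) = 0.\<close>
  define W where "W k = poly_shift 1 (line_subst ?z (\<phi> k))" for k
  define U where "U k = poly_shift 1 (line_subst c (\<psi> k))" for k
  define \<Theta> where "\<Theta> j = [:0, Const (c j):] + (\<Sum>k\<in>UNIV. W k * map_poly Const (K k j))" for j
  \<comment> \<open>Solving Z = \<Theta>(Y) for \<open>W\<close> gives (Z - T c) K', which is
    \<open>V\<close> in the variables Z. Since c + T W = \<phi>(T Y), the inverse family is
    \<open>U\<close> evaluated at \<open>V\<close>.\<close>
  define V where "V k = (\<Sum>j\<in>UNIV. [:Var j, - Const (c j):] * map_poly Const (K' j k))" for k
  define sub where "sub = evalp (poly_subst (\<lambda>a. [:Const a:]) V) [:0, 1:]"
  define \<Psi> where "\<Psi> j = sub (U j)" for j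
  have rV: "rhom (poly_subst (\<lambda>a. [:Const a:]) V)" by (intro rhom_poly_subst rhom_const_Const)
  have rsub: "rhom sub" unfolding sub_def by (intro rhom_evalp rV)
  have c\<psi>: "evl c (\<psi> j) = 0" for j
  proof -
    have "evl ?z (sbst \<phi> (\<psi> j)) = evl c (\<psi> j)" unfolding evl_sbst c_def ..
    then show ?thesis by (simp add: inv)
  qed
  have cT: "c k \<in> T" for k unfolding c_def by (rule evl_closed[OF T \<phi>]) (simp add: subringsetD T)
  have W0: "Polynomial.coeff (W k) 0 = (\<Sum>i\<in>UNIV. Const (L i k) * Var i)" for k
    unfolding W_def coeff_poly_shift L_def using coeff_line_subst_1[of ?z "\<phi> k"] by simp
  have U0: "Polynomial.coeff (U k) 0 = (\<Sum>i\<in>UNIV. Const (evl c (pd i (\<psi> k))) * Var i)" for k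
    unfolding U_def coeff_poly_shift using coeff_line_subst_1[of c "\<psi> k"] by simp
  have Wa: "Const a * poly (W k) (Const a) = sbst (\<lambda>i. Const a * Var i) (\<phi> k) - Const (c k)" for a k
  proof -
    have "poly (pCons (Const (c k)) (W k)) (Const a) = sbst (\<lambda>i. Const a * Var i) (\<phi> k)"
      using poly_line_subst[of ?z "\<phi> k" a] poly_shift_line[of "line_subst ?z (\<phi> k)"]
      by (simp add: W_def c_def coeff_line_subst_0)
    then show ?thesis by (simp add: algebra_simps)
  qed
  have Ua: "Const a * poly (U k) (Const a) = sbst (\<lambda>i. Const (c i) + Const a * Var i) (\<psi> k)" for a k
  proof -
    have "poly (pCons 0 (U k)) (Const a) = sbst (\<lambda>i. Const (c i) + Const a * Var i) (\<psi> k)"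
      using poly_line_subst[of c "\<psi> k" a] poly_shift_line[of "line_subst c (\<psi> k)"]
      by (simp add: U_def coeff_line_subst_0 c\<psi>)
    then show ?thesis by simp
  qed
  have poly_sub: "poly (sub q) (Const a) = sbst (\<lambda>k. poly (V k) (Const a)) (poly q (Const a))" for q a
  proof (rule rhom_poly_eqI[where F = "\<lambda>q. poly (sub q) (Const a)"])
    show "poly (sub [:p:]) (Const a) = sbst (\<lambda>k. poly (V k) (Const a)) (poly [:p:] (Const a))" for p
    proof -
      have "poly (poly_subst (\<lambda>a. [:Const a:]) V p) (Const a) = sbst (\<lambda>k. poly (V k) (Const a)) p"
        by (rule rhom_mpoly_eqI[where F = "\<lambda>p. poly (poly_subst (\<lambda>a. [:Const a:]) V p) (Const a)"])
          (simp_all add: rhom_comp[OF rhom_poly rV] rhom_sbst rhom_const_Const)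
      then show ?thesis by (simp add: sub_def rV)
    qed
  qed (simp_all add: rhom_comp[OF rhom_poly rsub] rhom_comp[OF rhom_sbst rhom_poly], simp add: sub_def rV rhom_simps[OF rV])
  \<comment> \<open>The chain rule for \<psi> after \<phi> at the point 0, which \<phi> sends to
    \<open>c\<close>.\<close>
  have jac: "(\<Sum>i\<in>UNIV. L m i * evl c (pd i (\<psi> j))) = of_bool (m = j)" for m j
  proof -
    have "evl ?z (pd m (sbst \<phi> (\<psi> j))) = (\<Sum>i\<in>UNIV. evl c (pd i (\<psi> j)) * L m i)"
      unfolding pd_sbst rhom_sum[OF rhom_evl] rhom_mult[OF rhom_evl] evl_sbst L_def c_def ..
    then show ?thesis by (cases "m = j") (simp_all add: inv mult.commute rhom_simps[OF rhom_evl])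
  qed
  have \<Theta>0: "Polynomial.coeff (\<Theta> j) 0 = Var j" for j
  proof -
    have "Polynomial.coeff (\<Theta> j) 0 = (\<Sum>k\<in>UNIV. (\<Sum>i\<in>UNIV. Const (L i k) * Var i) * Const (Polynomial.coeff (K k j) 0))"
      by (simp add: \<Theta>_def coeff_sum coeff_mult W0 coeff_map_poly)
    also have "\<dots> = (\<Sum>i\<in>UNIV. Var i * Const (\<Sum>k\<in>UNIV. L i k * Polynomial.coeff (K k j) 0))"
      unfolding rhom_sum[OF rhom_Const] rhom_mult[OF rhom_Const] sum_distrib_left sum_distrib_right
      by (subst sum.swap) (simp add: mult_ac)
    also have "\<dots> = (\<Sum>i\<in>UNIV. Var i * of_bool (i = j))"
      unfolding K0 by (rule sum.cong) (auto simp: of_bool_def)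
    finally show ?thesis by simp
  qed
    have V0: "poly (V k) (Const 0) = (\<Sum>m\<in>UNIV. Var m * Const (L m k))" for k
      unfolding V_def poly_sum poly_mult poly_map_Const by (simp add: poly_0_coeff_0 K'0)
  have \<Psi>0: "Polynomial.coeff (\<Psi> j) 0 = Var j" for j
  proof -
    have "Polynomial.coeff (\<Psi> j) 0 = poly (\<Psi> j) (Const 0)" by (simp add: poly_0_coeff_0)
    also have "\<dots> = (\<Sum>i\<in>UNIV. Const (evl c (pd i (\<psi> j))) * (\<Sum>m\<in>UNIV. Var m * Const (L m i)))"
      unfolding \<Psi>_def poly_sub V0 by (simp add: poly_0_coeff_0 U0 rhom_sum[OF rhom_sbst] rhom_mult[OF rhom_sbst])
    also have "\<dots> = (\<Sum>m\<in>UNIV. Var m * Const (\<Sum>i\<in>UNIV. L m i * evl c (pd i (\<psi> j))))"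
      unfolding rhom_sum[OF rhom_Const] rhom_mult[OF rhom_Const] sum_distrib_left sum_distrib_right
      by (subst sum.swap) (simp add: mult_ac)
    also have "\<dots> = (\<Sum>m\<in>UNIV. Var m * of_bool (m = j))"
      unfolding jac by (rule sum.cong) (auto simp: of_bool_def)
    finally show ?thesis by simp
  qed
  show thesis
  proof (rule that[of \<Theta> \<Psi>])
    note Tp = subringset_cpolys[OF subringset_polys[OF T]]
    fix j
    have W: "W k \<in> cpolys (polys T)" and U: "U k \<in> cpolys (polys T)" for k
      unfolding W_def U_def using T \<phi> \<psi> cT
      by (auto intro!: poly_shift_cpolys line_subst_cpolys simp: subringsetD)
    show "\<Theta> j \<in> cpolys (polys T)"
      unfolding \<Theta>_def using T
      by (intro subringsetD(5,6)[OF Tp] subringset_sum[OF Tp] W map_Const_cpolys K)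
        (simp_all add: pCons_cpolys Const_polys cT zero_cpolys subringset_polys subringsetD)
    have V: "V k \<in> cpolys (polys T)" for k
      unfolding V_def using T
      by (intro subringsetD(5,6)[OF Tp] subringset_sum[OF Tp] map_Const_cpolys K')
        (simp_all add: pCons_cpolys Const_polys Var_polys cT zero_cpolys subringset_polys subringsetD)
    show "\<Psi> j \<in> cpolys (polys T)"
      unfolding \<Psi>_def sub_def using T
      by (intro evalp_closed[OF Tp U] poly_subst_closed[OF Tp, where S = T] V)
        (simp_all add: pCons_cpolys Const_polys zero_cpolys subringset_polys subringsetD poly_subst_0)
    show "Polynomial.coeff (\<Theta> j) 0 = Var j" "Polynomial.coeff (\<Psi> j) 0 = Var j"
      by (rule \<Theta>0 \<Psi>0)+
    have W1: "poly (W k) 1 = \<phi> k - Const (c k)" for k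
      using Wa[of 1 k] by (simp add: sbst_Var)
    have "poly (\<Theta> j) (Const 1) = Const (c j) + (\<Sum>k\<in>UNIV. poly (W k) 1 * Const (poly (K k j) 1))"
      unfolding \<Theta>_def poly_sum poly_add poly_mult poly_map_Const by simp
    also have "(\<Sum>k\<in>UNIV. poly (W k) 1 * Const (poly (K k j) 1)) = (\<Sum>k\<in>UNIV. poly (W k) 1 * of_bool (k = j))"
      unfolding K1 by (rule sum.cong) (auto simp: of_bool_def)
    finally show "poly (\<Theta> j) 1 = \<phi> j" by (simp add: W1)
    have V1: "poly (V k) (Const 1) = Var k - Const (c k)" for k
    proof -
      have "poly (V k) (Const 1) = (\<Sum>j\<in>UNIV. (Var j - Const (c j)) * Const (poly (K' j k) 1))"
        unfolding V_def poly_sum poly_mult poly_map_Const by simp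
      also have "\<dots> = (\<Sum>j\<in>UNIV. (Var j - Const (c j)) * of_bool (j = k))"
        unfolding K'1 by (rule sum.cong) (auto simp: of_bool_def)
      finally show ?thesis by simp
    qed
    have "poly (U j) (Const 1) = sbst (\<lambda>i. Const (c i) + Var i) (\<psi> j)" using Ua[of 1 j] by simp
    then have "poly (\<Psi> j) (Const 1) = sbst (\<lambda>k. Var k - Const (c k)) (sbst (\<lambda>i. Const (c i) + Var i) (\<psi> j))"
      unfolding \<Psi>_def poly_sub V1 by simp
    also have "\<dots> = \<psi> j" unfolding sbst_sbst by (simp add: rhom_simps[OF rhom_sbst] sbst_Var)
    finally show "poly (\<Psi> j) 1 = \<psi> j" by simp
  next
    fix a Y Z j
    assume Z: "\<And>k. Z k = evl Y (poly (\<Theta> k) (Const a))"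
    show "evl Z (poly (\<Psi> j) (Const a)) = Y j"
    \<comment> \<open>The computation below cancels a factor \<open>a\<close>; at 0 both families
      are the identity.\<close>
    proof (cases "a = 0")
      case True
      then show ?thesis using Z by (simp add: poly_0_coeff_0 \<Theta>0 \<Psi>0)
    next
      case False
      define w where "w k = evl Y (poly (W k) (Const a))" for k
      have Zk: "Z k = a * c k + (\<Sum>i\<in>UNIV. w i * poly (K i k) a)" for k
        unfolding Z \<Theta>_def poly_sum poly_add poly_mult poly_map_Const w_def
        by (simp add: rhom_simps[OF rhom_evl] rhom_sum[OF rhom_evl])
      have KKa: "(\<Sum>j\<in>UNIV. poly (K i j) a * poly (K' j k) a) = of_bool (i = k)" for i k
        using arg_cong[OF KK'[of i k], of "\<lambda>q. poly q a"] by (simp add: poly_sum of_bool_def split: if_splits)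
      have "evl Z (poly (V k) (Const a)) = w k" for k
      proof -
        have "evl Z (poly (V k) (Const a)) = (\<Sum>j\<in>UNIV. (Z j - a * c j) * poly (K' j k) a)"
          unfolding V_def poly_sum poly_mult poly_map_Const
          by (simp add: rhom_simps[OF rhom_evl] rhom_sum[OF rhom_evl])
        also have "\<dots> = (\<Sum>j\<in>UNIV. \<Sum>i\<in>UNIV. w i * (poly (K i j) a * poly (K' j k) a))"
          unfolding Zk by (simp add: sum_distrib_right mult.assoc)
        also have "\<dots> = (\<Sum>i\<in>UNIV. w i * (\<Sum>j\<in>UNIV. poly (K i j) a * poly (K' j k) a))"
          unfolding sum_distrib_left by (rule sum.swap)
        also have "\<dots> = w k" by (simp add: KKa)
        finally show ?thesis .
      qed
      then have \<Psi>w: "evl Z (poly (\<Psi> j) (Const a)) = evl w (poly (U j) (Const a))"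
        unfolding \<Psi>_def poly_sub evl_sbst by simp
      have cw: "c i + a * w i = evl (\<lambda>i. a * Y i) (\<phi> i)" for i
        using arg_cong[OF Wa[of a i], of "evl Y"] by (simp add: w_def rhom_simps[OF rhom_evl] evl_sbst)
      have "a * evl w (poly (U j) (Const a)) = evl w (Const a * poly (U j) (Const a))"
        by (simp add: rhom_simps[OF rhom_evl])
      also have "\<dots> = evl (\<lambda>i. c i + a * w i) (\<psi> j)"
        unfolding Ua evl_sbst by (simp add: rhom_simps[OF rhom_evl])
      also have "\<dots> = a * Y j"
        unfolding cw by (simp add: inv flip: evl_sbst)
      finally show ?thesis using False \<Psi>w by simp
    qed
  qed
qed

text \<open>The path is K(t) = M(c)^-1 M(t c). At t = 0 it is M(c)^-1 because M(0) = 1, and at t = 1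
  it is the identity. Its inverse is N(t c) M(c).\<close>

lemma matrix_homotopy:
  fixes M N :: "('n::finite, 'a::comm_ring_1) mpoly^'n^'n" and c :: "'n \<Rightarrow> 'a"
  assumes T: "subringset T" and c: "\<And>i. c i \<in> T"
    and MN: "M ** N = mat 1" "N ** M = mat 1"
    and MT: "\<And>i j. M $ i $ j \<in> polys T" and NT: "\<And>i j. N $ i $ j \<in> polys T"
    and M0: "\<And>i j. evl (\<lambda>_. 0) (M $ i $ j) = of_bool (i = j)"
  obtains K K' :: "'n \<Rightarrow> 'n \<Rightarrow> 'a poly" where
    "\<And>i j. K i j \<in> cpolys T" "\<And>i j. K' i j \<in> cpolys T"
    "\<And>i k. (\<Sum>j\<in>UNIV. K i j * K' j k) = of_bool (i = k)"
    "\<And>i j. (\<Sum>k\<in>UNIV. evl c (M $ i $ k) * Polynomial.coeff (K k j) 0) = of_bool (i = j)"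
    "\<And>i j. Polynomial.coeff (K' i j) 0 = evl c (M $ i $ j)"
    "\<And>i j. poly (K i j) 1 = of_bool (i = j)" "\<And>i j. poly (K' i j) 1 = of_bool (i = j)"
proof -
  define P where "P = poly_subst (\<lambda>a. [:a:]) (\<lambda>k. [:0, c k:])"
  have P: "rhom P" unfolding P_def by (intro rhom_poly_subst rhom_const_poly)
  have P_simps: "P (Const a) = [:a:]" "P (Var k) = [:0, c k:]" for a k
    unfolding P_def by (simp_all add: rhom_const_poly)
  have P0: "Polynomial.coeff (P p) 0 = evl (\<lambda>_. 0) p" for p
    by (rule rhom_mpoly_eqI[where F = "\<lambda>p. Polynomial.coeff (P p) 0"])
      (simp_all add: rhom_comp[OF rhom_coeff_0 P] rhom_evl P_simps)
  have P1: "poly (P p) 1 = evl c p" for p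
    by (rule rhom_mpoly_eqI[where F = "\<lambda>p. poly (P p) 1"])
      (simp_all add: rhom_comp[OF rhom_poly P] rhom_evl P_simps)
  have PT: "P p \<in> cpolys T" if "p \<in> polys T" for p
    unfolding P_def using T c
    by (intro poly_subst_closed[OF subringset_cpolys[OF T] that])
      (simp_all add: pCons_cpolys zero_cpolys subringsetD)
  let ?C = "map_mat (\<lambda>a::'a. [:a:])"
  let ?L = "map_mat (evl c) M" and ?I = "map_mat (evl c) N"
  have LI: "?L ** ?I = mat 1" "?I ** ?L = mat 1"
    unfolding map_mat_mult[OF rhom_evl, symmetric] MN by (simp_all add: map_mat_mat rhom_evl rhom_1)
  define K where "K = ?C ?I ** map_mat P M"
  define K' where "K' = map_mat P N ** ?C ?L"
  have of_bool_mat: "A = mat 1 \<longleftrightarrow> (\<forall>i j. A $ i $ j = of_bool (i = j))" for A :: "'b::comm_ring_1^'n^'n"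
    by (auto simp: vec_eq_iff mat_def)
  have M0': "map_mat (evl (\<lambda>_. 0)) M = mat 1" by (simp add: of_bool_mat map_mat_def M0)
  have N0': "map_mat (evl (\<lambda>_. 0)) N = mat 1"
  proof -
    have "map_mat (evl (\<lambda>_. 0)) M ** map_mat (evl (\<lambda>_. 0)) N = mat 1"
      unfolding map_mat_mult[OF rhom_evl, symmetric] MN by (simp add: map_mat_mat rhom_evl rhom_1)
    then show ?thesis by (simp add: M0')
  qed
  have KK': "K ** K' = mat 1"
  proof -
    have "map_mat P M ** map_mat P N = mat 1"
      unfolding map_mat_mult[OF P, symmetric] MN by (simp add: map_mat_mat P rhom_1)
    moreover have "?C ?I ** ?C ?L = mat 1"
      unfolding map_mat_mult[OF rhom_const_poly, symmetric] LI
      by (simp add: map_mat_mat rhom_const_poly one_pCons)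
    ultimately show ?thesis unfolding K_def K'_def by (metis matrix_mul_assoc matrix_mul_rid)
  qed
  have map_map: "map_mat F (map_mat G A) = map_mat (\<lambda>x. F (G x)) A"
    for F :: "'c \<Rightarrow> 'd" and G :: "'b \<Rightarrow> 'c" and A :: "'b^'n^'n"
    by (simp add: map_mat_def)
  have map_id: "map_mat (\<lambda>x. x) A = A" for A :: "'b^'n^'n" by (simp add: map_mat_def)
  have K0: "map_mat (\<lambda>q. Polynomial.coeff q 0) K = ?I" "map_mat (\<lambda>q. Polynomial.coeff q 0) K' = ?L"
    unfolding K_def K'_def map_mat_mult[OF rhom_coeff_0] map_map P0 by (simp_all add: M0' N0' map_id)
  have K1: "map_mat (\<lambda>q. poly q 1) K = mat 1" "map_mat (\<lambda>q. poly q 1) K' = mat 1"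
    unfolding K_def K'_def map_mat_mult[OF rhom_poly] map_map P1 by (simp_all add: map_id LI)
  show thesis
  proof (rule that[of "\<lambda>i j. K $ i $ j" "\<lambda>i j. K' $ i $ j"])
    note Tc = subringset_cpolys[OF T]
    have cl: "evl c p \<in> T" if "p \<in> polys T" for p using evl_closed[OF T that c] .
    show "K $ i $ j \<in> cpolys T" for i j
      unfolding K_def matrix_matrix_mult_def map_mat_def using T
      by (simp, intro subringset_sum[OF Tc] smult_cpolys PT MT cl NT)
    show "K' $ i $ j \<in> cpolys T" for i j
      unfolding K'_def matrix_matrix_mult_def map_mat_def using T
      by (simp, intro subringset_sum[OF Tc] smult_cpolys PT MT cl NT)
    show "(\<Sum>j\<in>UNIV. K $ i $ j * K' $ j $ k) = of_bool (i = k)" for i k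
      using KK' unfolding of_bool_mat by (simp add: matrix_matrix_mult_def)
    have "Polynomial.coeff (K $ k $ j) 0 = ?I $ k $ j" for k j
      using K0(1) by (simp add: map_mat_def vec_eq_iff)
    then show "(\<Sum>k\<in>UNIV. evl c (M $ i $ k) * Polynomial.coeff (K $ k $ j) 0) = of_bool (i = j)" for i j
      using LI(1) unfolding of_bool_mat by (simp add: matrix_matrix_mult_def map_mat_def)
    show "Polynomial.coeff (K' $ i $ j) 0 = evl c (M $ i $ j)" for i j
      using K0(2) by (simp add: map_mat_def vec_eq_iff)
    show "poly (K $ i $ j) 1 = of_bool (i = j)" for i j
      using K1(1) unfolding of_bool_mat by (simp add: map_mat_def)
    show "poly (K' $ i $ j) 1 = of_bool (i = j)" for i j
      using K1(2) unfolding of_bool_mat by (simp add: map_mat_def)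
  qed
qed

section \<open>Derivations, and the splitting of a transition automorphism\<close>

definition derivation :: "('a::comm_ring_1 \<Rightarrow> 'a) \<Rightarrow> bool" where
  "derivation D \<longleftrightarrow> (\<forall>a b. D (a + b) = D a + D b) \<and> (\<forall>a b. D (a * b) = a * D b + b * D a)"

lemma derivationD:
  assumes "derivation D"
  shows "D (a + b) = D a + D b" "D (a * b) = a * D b + b * D a" "D 0 = 0" "D 1 = 0" "D (- a) = - D a"
    "D (a - b) = D a - D b"
proof -
  show 1: "D (a + b) = D a + D b" "D (a * b) = a * D b + b * D a" for a b
    using assms by (auto simp: derivation_def)
  show 0: "D 0 = 0" "D 1 = 0" using 1(2)[of 0 0] 1(2)[of 1 1] by simp_all
  show m: "D (- a) = - D a" for a using 1(1)[of a "- a"] 0 by (simp add: eq_neg_iff_add_eq_0 add.commute)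
  show "D (a - b) = D a - D b" using 1(1)[of a "- b"] m by simp
qed

lemma derivation_sum: "derivation D \<Longrightarrow> D (sum f A) = (\<Sum>i\<in>A. D (f i))"
  by (induction A rule: infinite_finite_induct) (simp_all add: derivationD)

lemma derivation_chain:
  assumes "subringset T" "derivation D" "\<And>a. a \<in> T \<Longrightarrow> D a = 0" "p \<in> polys T"
  shows "D (evl y p) = (\<Sum>k\<in>UNIV. evl y (pd k p) * D (y k))"
proof -
  let ?R = "{p. D (evl y p) = (\<Sum>k\<in>UNIV. evl y (pd k p) * D (y k))}"
  note s = rhom_simps[OF rhom_evl] derivationD[OF assms(2)]
  have pd_diff: "pd k (a - b) = pd k a - pd k b" for k and a b :: "('b, 'a) mpoly"
    using pd_add[of k "a - b" b] by (simp add: algebra_simps)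
  have "subringset ?R"
    unfolding subringset_def
    by (auto simp: s pd_mult pd_diff left_diff_distrib sum_subtractf ring_distribs sum.distrib
        sum_distrib_left mult.assoc pd_Const[of _ 1, simplified])
  moreover have "Const a \<in> ?R" if "a \<in> T" for a using assms(3)[OF that] by (simp add: s)
  moreover have "Var i \<in> ?R" for i
  proof -
    have "(\<Sum>k\<in>UNIV. evl y (pd k (Var i)) * D (y k)) = (\<Sum>k\<in>UNIV. D (y k) * of_bool (k = i))"
      by (rule sum.cong) (auto simp: s of_bool_def)
    then show ?thesis by simp
  qed
  ultimately show ?thesis using polys_subset_subringset[of ?R T] assms(4) by blast
qed

text \<open>In both charts the matrix of the frame is the identity at the origin. Writing X =
  \<phi>(Y) and comparing D X = MF(X) with D Y = MG(Y) shows that the linear part of \<phi> at 0 is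
  MF(c) for c = \<phi>(0), so it can be deformed. The common coordinates are Z = \<Theta>_a(Y),
  where \<open>a\<close> is divisible by a high power of \<open>f\<close> and \<open>1 - a\<close>
  by a high power of \<open>g\<close>.\<close>

lemma patch_normalized:
  fixes X Y :: "'n::finite \<Rightarrow> 'a::field_char_0" and MF NF MG :: "('n, 'a) mpoly^'n^'n"
  assumes S: "subringset S" "f \<in> S" "g \<in> S" "u \<in> S" "v \<in> S" "u * f + v * g = 1"
  defines "T \<equiv> loc S (f * g)"
  assumes Y: "indep T Y" and XY: "\<And>i. X i \<in> adjoin T Y" and YX: "\<And>i. Y i \<in> adjoin T X"
    and MN: "MF ** NF = mat 1" "NF ** MF = mat 1"
    and MF: "\<And>i j. MF $ i $ j \<in> polys T" and NF: "\<And>i j. NF $ i $ j \<in> polys T"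
    and MG: "\<And>i j. MG $ i $ j \<in> polys T"
    and MF0: "\<And>i j. evl (\<lambda>_. 0) (MF $ i $ j) = of_bool (i = j)"
    and MG0: "\<And>i j. evl (\<lambda>_. 0) (MG $ i $ j) = of_bool (i = j)"
    and D: "\<And>i. derivation (D i)" "\<And>i a. a \<in> T \<Longrightarrow> D i a = 0"
    and DX: "\<And>i j. D i (X j) = evl X (MF $ i $ j)" and DY: "\<And>i j. D i (Y j) = evl Y (MG $ i $ j)"
  obtains Z :: "'n \<Rightarrow> 'a"
  where "adjoin (loc S f) Z = adjoin (loc S f) X" "adjoin (loc S g) Z = adjoin (loc S g) Y"
proof -
  have T: "subringset T" unfolding T_def using S by (intro subringset_loc) (auto simp: subringsetD)
  have Tf: "T = loc (loc S g) f" and Tg: "T = loc (loc S f) g"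
    unfolding T_def using loc_loc[OF S(1-3)] loc_loc[OF S(1,3,2)] by (simp_all add: mult.commute)
  have Sf: "subringset (loc S f)" and Sg: "subringset (loc S g)" using S by (auto intro: subringset_loc)
  have fg: "f \<in> loc S g" "g \<in> loc S f" "S \<subseteq> loc S f" "S \<subseteq> loc S g" using S loc_base by auto
  have X: "indep T X" by (rule indep_generators[OF T Y XY YX])
  obtain \<phi> where \<phi>: "\<And>j. \<phi> j \<in> polys T" "\<And>j. X j = evl Y (\<phi> j)"
    using XY unfolding adjoin_evl by metis
  obtain \<psi> where \<psi>: "\<And>j. \<psi> j \<in> polys T" "\<And>j. Y j = evl X (\<psi> j)"
    using YX unfolding adjoin_evl by metis
  have \<phi>\<psi>: "sbst \<phi> (\<psi> j) = Var j" for j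
    using T Y by (rule indep_evl_eqI) (simp_all add: sbst_polys T \<phi>(1) \<psi>(1) Var_polys evl_sbst flip: \<phi>(2) \<psi>(2))
  have \<psi>\<phi>: "sbst \<psi> (\<phi> j) = Var j" for j
    using T X by (rule indep_evl_eqI) (simp_all add: sbst_polys T \<phi>(1) \<psi>(1) Var_polys evl_sbst flip: \<phi>(2) \<psi>(2))
  define c where "c k = evl (\<lambda>_. 0) (\<phi> k)" for k
  have cT: "c k \<in> T" for k unfolding c_def by (rule evl_closed[OF T \<phi>(1)]) (simp add: subringsetD T)
  have jac: "evl c (MF $ i $ j) = evl (\<lambda>_. 0) (pd i (\<phi> j))" for i j
  proof -
    have "sbst \<phi> (MF $ i $ j) = (\<Sum>k\<in>UNIV. pd k (\<phi> j) * MG $ i $ k)"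
    proof (rule indep_evl_eqI[OF T Y])
      show "sbst \<phi> (MF $ i $ j) \<in> polys T" by (rule sbst_polys[OF T \<phi>(1) MF])
      show "(\<Sum>k\<in>UNIV. pd k (\<phi> j) * MG $ i $ k) \<in> polys T"
        by (intro subringset_sum[OF subringset_polys[OF T]] subringsetD(6)[OF subringset_polys[OF T]] pd_polys T \<phi> MG)
      show "evl Y (sbst \<phi> (MF $ i $ j)) = evl Y (\<Sum>k\<in>UNIV. pd k (\<phi> j) * MG $ i $ k)"
        using derivation_chain[OF T D \<phi>(1)[of j], of i Y]
        by (simp add: evl_sbst rhom_sum[OF rhom_evl] rhom_mult[OF rhom_evl] DX DY flip: \<phi>(2))
    qed
    then have "evl (\<lambda>_. 0) (sbst \<phi> (MF $ i $ j)) = evl (\<lambda>_. 0) (\<Sum>k\<in>UNIV. pd k (\<phi> j) * MG $ i $ k)" by simp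
    then show ?thesis
      by (simp add: evl_sbst rhom_sum[OF rhom_evl] rhom_mult[OF rhom_evl] MG0 flip: c_def)
  qed
  show thesis
  proof (rule matrix_homotopy[OF T cT MN MF NF MF0])
    fix K K' assume K:
      "\<And>i j. K i j \<in> cpolys T" "\<And>i j. K' i j \<in> cpolys T"
      "\<And>i k. (\<Sum>j\<in>UNIV. K i j * K' j k) = of_bool (i = k)"
      "\<And>i j. (\<Sum>k\<in>UNIV. evl c (MF $ i $ k) * Polynomial.coeff (K k j) 0) = of_bool (i = j)"
      "\<And>i j. Polynomial.coeff (K' i j) 0 = evl c (MF $ i $ j)"
      "\<And>i j. poly (K i j) 1 = of_bool (i = j)" "\<And>i j. poly (K' i j) 1 = of_bool (i = j)"
    show thesis
    proof (rule automorphism_homotopy[OF T \<phi>(1) \<psi>(1) \<phi>\<psi> K(1-3) K(4)[unfolded jac] K(5)[unfolded jac] K(6,7)])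
      fix \<Theta> \<Psi> assume \<Theta>: "\<And>j. \<Theta> j \<in> cpolys (polys T)" and \<Psi>: "\<And>j. \<Psi> j \<in> cpolys (polys T)"
        and \<Theta>0: "\<And>j. Polynomial.coeff (\<Theta> j) 0 = Var j" and \<Psi>0: "\<And>j. Polynomial.coeff (\<Psi> j) 0 = Var j"
        and \<Theta>1: "\<And>j. poly (\<Theta> j) 1 = \<phi> j" and \<Psi>1: "\<And>j. poly (\<Psi> j) 1 = \<psi> j"
        and inv: "\<And>a Y Z j. (\<And>k. Z k = evl Y (poly (\<Theta> k) (Const a))) \<Longrightarrow> evl Z (poly (\<Psi> j) (Const a)) = Y j"
      \<comment> \<open>At the parameter \<open>1 - a\<close>, \<open>H\<close> expresses Z by X as
        \<Theta>_a after \<psi>, and \<open>H'\<close> expresses X by Z as \<phi> after \<Psi>_a.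
        The parameter is reversed so that both are the identity at 0, as clearing denominators
        requires.\<close>
      define H where "H j = map_poly (sbst \<psi>) (pcompose (\<Theta> j) [:1, -1:])" for j
      define H' where "H' j = poly_subst (\<lambda>a. [:Const a:]) (\<lambda>k. pcompose (\<Psi> k) [:1, -1:]) (\<phi> j)" for j
      note Tp = subringset_polys[OF T] subringset_cpolys[OF subringset_polys[OF T]]
      have refl_closed: "pcompose q [:1, -1:] \<in> cpolys (polys T)" if "q \<in> cpolys (polys T)" for q :: "('n, 'a) mpoly poly"
        using that by (rule pcompose_cpolys[OF Tp(1)])
          (simp add: pCons_cpolys zero_cpolys subringsetD Tp)
      have H: "H j \<in> cpolys (polys T)" for j
        using refl_closed[OF \<Theta>] unfolding H_def cpolys_def
        by (simp add: coeff_map_poly rhom_0[OF rhom_sbst] sbst_polys T \<psi>)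
      have H': "H' j \<in> cpolys (polys T)" for j
        unfolding H'_def
        by (rule poly_subst_closed[OF Tp(2) \<phi>(1)]) (auto intro: refl_closed \<Psi> simp: pCons_cpolys Const_polys T zero_cpolys Tp)
      have H_poly: "poly (H j) (Const a) = sbst \<psi> (poly (\<Theta> j) (Const (1 - a)))" for j a
      proof -
        have "poly (map_poly (sbst \<psi>) q) (Const a) = sbst \<psi> (poly q (Const a))" for q
          by (rule rhom_poly_eqI[where F = "\<lambda>q. poly (map_poly (sbst \<psi>) q) (Const a)"])
            (simp_all add: rhom_comp[OF rhom_poly rhom_map_poly[OF rhom_sbst]] rhom_comp[OF rhom_sbst rhom_poly]
              map_poly_pCons rhom_simps[OF rhom_sbst])
        then show ?thesis unfolding H_def by (simp add: poly_pcompose rhom_simps[OF rhom_Const])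
      qed
      have H'_poly: "poly (H' j) (Const a) = sbst (\<lambda>k. poly (\<Psi> k) (Const (1 - a))) (\<phi> j)" for j a
        unfolding H'_def
        by (rule rhom_mpoly_eqI[where F = "\<lambda>p. poly (poly_subst _ _ p) (Const a)"])
          (simp_all add: rhom_comp[OF rhom_poly rhom_poly_subst] rhom_const_Const rhom_sbst poly_pcompose
            rhom_simps[OF rhom_Const])
      have H0: "Polynomial.coeff (H j) 0 = Var j" "Polynomial.coeff (H' j) 0 = Var j" for j
        using H_poly[of j 0] H'_poly[of j 0] by (simp_all add: poly_0_coeff_0 \<Theta>1 \<Psi>1 \<psi>\<phi>)
      have Tfp: "(polys T :: ('n, 'a) mpoly set) = loc (polys (loc S g)) (Const f)"
        unfolding Tf by (rule polys_loc[OF Sg fg(1)])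
      have Tgp: "(polys T :: ('n, 'a) mpoly set) = loc (polys (loc S f)) (Const g)"
        unfolding Tg by (rule polys_loc[OF Sf fg(2)])
      have clear: "\<exists>N. \<forall>n\<ge>N. \<forall>b\<in>S. \<forall>i. poly (q i) (Const (f' ^ n * b)) \<in> polys S'"
        if q: "\<And>i. q i \<in> cpolys (polys T)" "\<And>i. Polynomial.coeff (q i) 0 = Var i"
          and S': "subringset S'" "f' \<in> S'" "S \<subseteq> S'" "(polys T :: ('n, 'a) mpoly set) = loc (polys S') (Const f')"
        for q :: "'n \<Rightarrow> ('n, 'a) mpoly poly" and S' f'
      proof -
        have "\<exists>N. \<forall>n\<ge>N. \<forall>b\<in>polys S'. \<forall>i. poly (q i) (Const f' ^ n * b) \<in> polys S'"
        proof (rule clear_denominators)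
          show "Polynomial.coeff (q i) n \<in> loc (polys S') (Const f')" for i n
            using q(1)[of i] unfolding cpolys_def S'(4)[symmetric] by blast
        qed (use S' q(2) in \<open>auto simp: subringset_polys Const_polys Var_polys\<close>)
        then show ?thesis
          using S' by (auto simp: rhom_simps[OF rhom_Const] intro!: Const_polys) (metis Const_polys subset_eq)
      qed
      obtain N1 where N1: "\<And>n b i. n \<ge> N1 \<Longrightarrow> b \<in> S \<Longrightarrow> poly (\<Theta> i) (Const (f ^ n * b)) \<in> polys (loc S g)"
        using clear[OF \<Theta> \<Theta>0 Sg fg(1,4) Tfp] by blast
      obtain N2 where N2: "\<And>n b i. n \<ge> N2 \<Longrightarrow> b \<in> S \<Longrightarrow> poly (\<Psi> i) (Const (f ^ n * b)) \<in> polys (loc S g)"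
        using clear[OF \<Psi> \<Psi>0 Sg fg(1,4) Tfp] by blast
      obtain N3 where N3: "\<And>n b i. n \<ge> N3 \<Longrightarrow> b \<in> S \<Longrightarrow> poly (H i) (Const (g ^ n * b)) \<in> polys (loc S f)"
        using clear[OF H H0(1) Sf fg(2,3) Tgp] by blast
      obtain N4 where N4: "\<And>n b i. n \<ge> N4 \<Longrightarrow> b \<in> S \<Longrightarrow> poly (H' i) (Const (g ^ n * b)) \<in> polys (loc S f)"
        using clear[OF H' H0(2) Sf fg(2,3) Tgp] by blast
      \<comment> \<open>One exponent that serves all four families.\<close>
      let ?N = "N1 + N2 + N3 + N4"
      obtain b b' where b: "b \<in> S" "b' \<in> S" "b * f ^ ?N + b' * g ^ ?N = 1"
        using comaximal_powers[OF S] by blast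
      define a where "a = f ^ ?N * b"
      have a': "1 - a = g ^ ?N * b'" using b(3) by (simp add: a_def algebra_simps)
      define Z where "Z k = evl Y (poly (\<Theta> k) (Const a))" for k
      have YZ: "Y k = evl Z (poly (\<Psi> k) (Const a))" for k using inv[of Z Y a k] Z_def by simp
      have ZX: "Z k = evl X (poly (H k) (Const (1 - a)))" for k
        unfolding H_poly evl_sbst by (simp add: Z_def flip: \<psi>(2))
      have XZ: "X k = evl Z (poly (H' k) (Const (1 - a)))" for k
        unfolding H'_poly evl_sbst by (simp add: \<phi>(2) flip: YZ)
      show thesis
      proof (rule that[of Z])
        have "Z k \<in> adjoin (loc S f) X" for k
          unfolding ZX a' by (intro evl_adjoin N3 b) simp
        moreover have "X k \<in> adjoin (loc S f) Z" for k
          unfolding XZ a' by (intro evl_adjoin N4 b) simp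
        ultimately show "adjoin (loc S f) Z = adjoin (loc S f) X"
          by (intro equalityI adjoin_least subringset_adjoin Sf) (auto intro: adjoin_base Sf)
        have "Z k \<in> adjoin (loc S g) Y" for k
          unfolding Z_def a_def by (intro evl_adjoin N1 b) simp
        moreover have "Y k \<in> adjoin (loc S g) Z" for k
          using evl_adjoin[OF N2[of ?N b k, OF _ b(1)], of Z] YZ[of k] by (simp add: a_def)
        ultimately show "adjoin (loc S g) Z = adjoin (loc S g) Y"
          by (intro equalityI adjoin_least subringset_adjoin Sg) (auto intro: adjoin_base Sg)
      qed
    qed
  qed
qed

section \<open>Coordinate charts\<close>

text \<open>For subrings \<open>S\<close> of \<open>A\<close> and nonzero \<open>f\<close> in
  \<open>S\<close> this says that A_f is a polynomial ring over S_f in the coordinates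
  \<open>X\<close>. It is recorded by one inclusion in each direction, and these pass directly to
  multiples of \<open>f\<close>; \<open>chart_adjoin\<close> recovers the equality.\<close>

definition chart :: "'a::field set \<Rightarrow> 'a set \<Rightarrow> 'a \<Rightarrow> ('n::finite \<Rightarrow> 'a) \<Rightarrow> bool" where
  "chart S A f X \<longleftrightarrow> indep S X \<and> A \<subseteq> adjoin (loc S f) X \<and> (\<forall>i. X i \<in> loc A f)"

lemma indep_loc:
  fixes f :: "'a::field"
  assumes S: "subringset S" "f \<in> S" "f \<noteq> 0" and "indep S z"
  shows "indep (loc S f) z"
  unfolding indep_def
proof (intro ballI impI)
  fix p assume p: "p \<in> polys (loc S f)" "poly_subst (\<lambda>a. a) z p = 0"
  then obtain n where n: "Const f ^ n * p \<in> polys S" unfolding polys_loc[OF S(1,2)] by (auto simp: loc_def)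
  have "poly_subst (\<lambda>a. a) z (Const f ^ n * p) = 0"
    by (simp add: rhom_simps[OF rhom_eval] p)
  then have "Const f ^ n * p = 0" using n assms(4) by (auto simp: indep_def)
  then have z: "Const (inverse f ^ n) * (Const f ^ n * p) = 0" by simp
  have "Const (inverse f ^ n) * Const f ^ n = (1 :: ('b, 'a) mpoly)"
    using S(3) by (simp flip: rhom_power[OF rhom_Const] rhom_mult[OF rhom_Const] power_mult_distrib)
  then show "p = 0" using z by (simp flip: mult.assoc)
qed

lemma loc_idem: "loc (loc S f) f = loc S f"
proof (intro equalityI loc_base subsetI)
  fix a assume "a \<in> loc (loc S f) f"
  then obtain n m where "f ^ m * (f ^ n * a) \<in> S" by (auto simp: loc_def)
  then show "a \<in> loc S f" by (intro locI[where n = "m + n"]) (simp add: power_add mult.assoc)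
qed

lemma chart_adjoin:
  fixes f :: "'a::field"
  assumes "subringset S" "subringset A" "S \<subseteq> A" "f \<in> S" "f \<noteq> 0" "chart S A f X"
  shows "adjoin (loc S f) X = loc A f"
proof (intro equalityI adjoin_least)
  have fA: "f \<in> A" using assms by blast
  show "subringset (loc A f)" using assms fA by (intro subringset_loc)
  show "loc S f \<subseteq> loc A f" by (rule loc_mono[OF assms(3)])
  show "X i \<in> loc A f" for i using assms(6) by (simp add: chart_def)
  have "loc A f \<subseteq> loc (adjoin (loc S f) X) f" using assms(6) by (intro loc_mono) (simp add: chart_def)
  also have "\<dots> = adjoin (loc (loc S f) f) X"
    using assms loc_base[of S f] by (subst adjoin_loc) (auto intro: subringset_loc)
  also have "loc (loc S f) f = loc S f"
    by (rule loc_idem)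
  finally show "loc A f \<subseteq> adjoin (loc S f) X" .
qed

lemma loc_mult_subset:
  assumes "subringset S" "f \<in> S" "r \<in> S"
  shows "loc S f \<subseteq> loc S (r * f)"
  using loc_loc[OF assms(1) assms(3,2)] loc_base by blast

lemma chart_mult:
  assumes "subringset S" "subringset A" "S \<subseteq> A" "f \<in> S" "r \<in> S" "chart S A f X"
  shows "chart S A (r * f) X"
  using assms loc_mult_subset[of S f r] loc_mult_subset[of A f r] adjoin_mono[of "loc S f" "loc S (r * f)" X]
  unfolding chart_def by blast

lemma derivation_power: "derivation D \<Longrightarrow> D f = 0 \<Longrightarrow> D (f ^ n) = 0"
  by (induction n) (simp_all add: derivationD)

lemma derivation_loc:
  assumes "derivation D" "D f = 0" "\<And>a. a \<in> A \<Longrightarrow> D a \<in> A" "a \<in> loc A f"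
  shows "D a \<in> loc A f"
proof -
  obtain n where n: "f ^ n * a \<in> A" using assms(4) by (auto simp: loc_def)
  have "D (f ^ n * a) = f ^ n * D a"
    by (simp add: derivationD(2)[OF assms(1)] derivation_power[OF assms(1,2)])
  then show ?thesis using assms(3)[OF n] by (intro locI) simp
qed

lemma derivation_zero_loc:
  fixes f :: "'a::field"
  assumes "derivation D" "\<And>a. a \<in> S \<Longrightarrow> D a = 0" "f \<in> S" "f \<noteq> 0" "a \<in> loc S f"
  shows "D a = 0"
proof -
  obtain n where n: "f ^ n * a \<in> S" using assms(5) by (auto simp: loc_def)
  have "D (f ^ n * a) = f ^ n * D a"
    by (simp add: derivationD(2)[OF assms(1)] derivation_power[OF assms(1) assms(2)[OF assms(3)]])
  then show ?thesis using assms(2)[OF n] assms(4) by simp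
qed

text \<open>A frame of vector fields along the fibres. Invertibility is demanded in all charts at
  once because normalizing and patching change the charts while the frame stays fixed.\<close>

definition jacobian_frame :: "'a::field set \<Rightarrow> 'a set \<Rightarrow> ('n::finite \<Rightarrow> 'a \<Rightarrow> 'a) \<Rightarrow> bool" where
  "jacobian_frame S A D \<longleftrightarrow>
    (\<forall>i. derivation (D i) \<and> (\<forall>a\<in>S. D i a = 0) \<and> (\<forall>a\<in>A. D i a \<in> A)) \<and>
    (\<forall>f X. f \<in> S \<longrightarrow> f \<noteq> 0 \<longrightarrow> chart S A f X \<longrightarrow>
      (\<exists>N :: 'a^'n^'n. (\<forall>i j. N $ i $ j \<in> loc A f) \<and> (\<chi> i j. D i (X j)) ** N = mat 1))"

text \<open>Independence of the coordinates turns identities between values into identities between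
  polynomials. Only then can the matrix be evaluated elsewhere, as at the origin of the
  chart.\<close>

lemma chart_jacobian:
  fixes D :: "'n::finite \<Rightarrow> 'a::field \<Rightarrow> 'a" and X :: "'n \<Rightarrow> 'a"
  assumes S: "subringset S" "subringset A" "S \<subseteq> A" and frame: "jacobian_frame S A D"
    and f: "f \<in> S" "f \<noteq> 0" "chart S A f X"
  obtains M N :: "('n, 'a) mpoly^'n^'n" where
    "M ** N = mat 1" "N ** M = mat 1" "\<forall>i j. M $ i $ j \<in> polys (loc S f)" "\<forall>i j. N $ i $ j \<in> polys (loc S f)"
    "\<forall>i j. D i (X j) = evl X (M $ i $ j)"
proof -
  note R = subringset_loc[OF S(1) f(1)]
  note ad = chart_adjoin[OF S f]
  have D: "derivation (D i)" "\<And>a. a \<in> S \<Longrightarrow> D i a = 0" "\<And>a. a \<in> A \<Longrightarrow> D i a \<in> A" for i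
    using frame by (auto simp: jacobian_frame_def)
  obtain N0 :: "'a^'n^'n" where N0: "\<And>i j. N0 $ i $ j \<in> loc A f" "(\<chi> i j. D i (X j)) ** N0 = mat 1"
    using frame f unfolding jacobian_frame_def by metis
  have "D i (X j) \<in> adjoin (loc S f) X" for i j
    unfolding ad using f(3) D f(1) by (intro derivation_loc[where D = "D i"]) (auto simp: chart_def)
  then have "\<exists>p. p \<in> polys (loc S f) \<and> D i (X j) = evl X p" for i j
    unfolding adjoin_evl by blast
  then obtain m where m: "\<And>i j. m i j \<in> polys (loc S f)" "\<And>i j. D i (X j) = evl X (m i j)" by metis
  have "\<exists>p. p \<in> polys (loc S f) \<and> N0 $ i $ j = evl X p" for i j
    using N0(1)[of i j] unfolding ad[symmetric] adjoin_evl by blast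
  then obtain n where n: "\<And>i j. n i j \<in> polys (loc S f)" "\<And>i j. N0 $ i $ j = evl X (n i j)" by metis
  define M N where "M = (\<chi> i j. m i j)" and "N = (\<chi> i j. n i j)"
  have M: "map_mat (evl X) M = (\<chi> i j. D i (X j))" and N: "map_mat (evl X) N = N0"
    by (simp_all add: M_def N_def map_mat_def vec_eq_iff m n)
  have ind: "indep (loc S f) X" using f(3) by (intro indep_loc[OF S(1) f(1,2)]) (simp add: chart_def)
  have Rp: "subringset (polys (loc S f) :: ('n, 'a) mpoly set)" by (rule subringset_polys[OF R])
  have inj: "B = mat 1"
    if "map_mat (evl X) B = mat 1" "\<And>i j. B $ i $ j \<in> polys (loc S f)" for B :: "('n, 'a) mpoly^'n^'n"
  proof -
    have "B $ i $ j = mat 1 $ i $ j" for i j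
    proof (rule indep_evl_eqI[OF R ind that(2)])
      show "(mat 1 :: ('n, 'a) mpoly^'n^'n) $ i $ j \<in> polys (loc S f)"
        using subringsetD(1,2)[OF Rp] by (simp add: mat_def)
      show "evl X (B $ i $ j) = evl X ((mat 1 :: ('n, 'a) mpoly^'n^'n) $ i $ j)"
        using arg_cong[OF that(1), of "\<lambda>C. C $ i $ j"] by (simp add: map_mat_def mat_def rhom_simps[OF rhom_evl])
    qed
    then show ?thesis by (simp add: vec_eq_iff)
  qed
  have closed: "(B ** C) $ i $ j \<in> polys (loc S f)"
    if "\<And>i j. B $ i $ j \<in> polys (loc S f)" "\<And>i j. C $ i $ j \<in> polys (loc S f)"
    for B C :: "('n, 'a) mpoly^'n^'n" and i j
    unfolding matrix_matrix_mult_def using that subringset_polys[OF R]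
    by (auto intro!: subringset_sum simp: subringsetD)
  have Mp: "M $ i $ j \<in> polys (loc S f)" and Np: "N $ i $ j \<in> polys (loc S f)" for i j
    by (simp_all add: M_def N_def m n)
  have "M ** N = mat 1"
    by (rule inj) (simp_all add: map_mat_mult[OF rhom_evl] M N N0 closed Mp Np)
  moreover have "N ** M = mat 1"
    by (rule inj) (simp_all add: map_mat_mult[OF rhom_evl] M N N0(2)[THEN matrix_left_right_inverse[THEN iffD1]] closed Mp Np)
  ultimately show thesis using that[of M N] Mp Np m by (simp add: M_def)
qed

text \<open>The coordinates are multiplied by the constant matrix C = M(0)^-1. The derivations
  vanish on S_f, so the matrix of the frame becomes M C, which is the identity at the origin; a
  linear change does not move the origin.\<close>

lemma chart_normalize:
  fixes D :: "'n::finite \<Rightarrow> 'a::field_char_0 \<Rightarrow> 'a" and X :: "'n \<Rightarrow> 'a"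
  assumes S: "subringset S" "subringset A" "S \<subseteq> A" and frame: "jacobian_frame S A D"
    and f: "f \<in> S" "f \<noteq> 0" "chart S A f X"
  obtains X' M N where "chart S A f X'"
    "M ** N = mat 1" "N ** M = mat 1" "\<forall>i j. M $ i $ j \<in> polys (loc S f)" "\<forall>i j. N $ i $ j \<in> polys (loc S f)"
    "\<forall>i j. D i (X' j) = evl X' (M $ i $ j)" "\<forall>i j. evl (\<lambda>_. 0) (M $ i $ j) = of_bool (i = j)"
proof -
  note R = subringset_loc[OF S(1) f(1)]
  note ad = chart_adjoin[OF S f]
  have D: "derivation (D i)" "\<And>a. a \<in> S \<Longrightarrow> D i a = 0" "\<And>a. a \<in> A \<Longrightarrow> D i a \<in> A" for i
    using frame by (auto simp: jacobian_frame_def)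
  obtain M N where MN: "M ** N = mat 1" "N ** M = mat 1" "\<forall>i j. M $ i $ j \<in> polys (loc S f)"
    "\<forall>i j. N $ i $ j \<in> polys (loc S f)" "\<forall>i j. D i (X j) = evl X (M $ i $ j)"
    using chart_jacobian[OF S frame f] by blast
  define C where "C = map_mat (evl (\<lambda>_. 0)) N"
  define C' where "C' = map_mat (evl (\<lambda>_. 0)) M"
  have CC': "C ** C' = mat 1" "C' ** C = mat 1"
    unfolding C_def C'_def map_mat_mult[OF rhom_evl, symmetric] MN by (simp_all add: map_mat_mat rhom_evl rhom_1)
  have CR: "C $ i $ j \<in> loc S f" "C' $ i $ j \<in> loc S f" for i j
    unfolding C_def C'_def map_mat_def using MN R by (auto intro!: evl_closed simp: subringsetD)
  define X' where "X' j = (\<Sum>k\<in>UNIV. X k * C $ k $ j)" for j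
  have XX': "X j = (\<Sum>k\<in>UNIV. X' k * C' $ k $ j)" for j
  proof -
    have "(\<Sum>k\<in>UNIV. X' k * C' $ k $ j) = (\<Sum>i\<in>UNIV. \<Sum>k\<in>UNIV. X i * (C $ i $ k * C' $ k $ j))"
      unfolding X'_def sum_distrib_right by (subst sum.swap) (simp add: mult.assoc)
    also have "\<dots> = (\<Sum>i\<in>UNIV. X i * (C ** C') $ i $ j)"
      by (simp add: matrix_matrix_mult_def sum_distrib_left)
    also have "\<dots> = (\<Sum>i\<in>UNIV. X i * of_bool (i = j))"
      unfolding CC' by (rule sum.cong) (auto simp: mat_def)
    finally show ?thesis by simp
  qed
  have X'X: "X' j \<in> adjoin (loc S f) X" for j
    unfolding X'_def using subringset_adjoin[OF R] CR
    by (intro subringset_sum subringsetD(6)[OF subringset_adjoin[OF R]] adjoin_gen adjoin_base R) auto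
  have XX'_adj: "X j \<in> adjoin (loc S f) X'" for j
    unfolding XX'[of j] using subringset_adjoin[OF R] CR
    by (intro subringset_sum subringsetD(6)[OF subringset_adjoin[OF R]] adjoin_gen adjoin_base R) auto
  have ind: "indep (loc S f) X" using f(3) by (intro indep_loc[OF S(1) f(1,2)]) (simp add: chart_def)
  have ind': "indep (loc S f) X'" by (rule indep_generators[OF R ind X'X XX'_adj])
  have ch: "chart S A f X'"
    unfolding chart_def
  proof (intro conjI allI)
    show "indep S X'" by (rule indep_mono[OF loc_base ind'])
    have "adjoin (loc S f) X \<subseteq> adjoin (loc S f) X'"
      by (intro adjoin_least subringset_adjoin R XX'_adj) (auto intro: adjoin_base R)
    then show "A \<subseteq> adjoin (loc S f) X'" using f(3) unfolding chart_def by blast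
    show "X' i \<in> loc A f" for i using X'X unfolding ad .
  qed
  obtain M' N' where MN': "M' ** N' = mat 1" "N' ** M' = mat 1" "\<forall>i j. M' $ i $ j \<in> polys (loc S f)"
    "\<forall>i j. N' $ i $ j \<in> polys (loc S f)" "\<forall>i j. D i (X' j) = evl X' (M' $ i $ j)"
    using chart_jacobian[OF S frame f(1,2) ch] by blast
  \<comment> \<open>\<open>w\<close> writes the new coordinates in the old ones, so that the new
    matrix can be compared with M C as a polynomial in the old coordinates.\<close>
  define w :: "'n \<Rightarrow> ('n, 'a) mpoly" where "w j = (\<Sum>k\<in>UNIV. Var k * Const (C $ k $ j))" for j
  note Rp = subringset_polys[OF R]
  have w: "w j \<in> polys (loc S f)" for j
    unfolding w_def by (intro subringset_sum subringsetD(6)[OF Rp] Rp Var_polys Const_polys R CR)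
  have evw: "evl X (w j) = X' j" "evl (\<lambda>_. 0) (w j) = 0" for j
    by (simp_all add: w_def X'_def rhom_sum[OF rhom_evl] rhom_mult[OF rhom_evl])
  have "sbst w (M' $ i $ j) = (\<Sum>k\<in>UNIV. M $ i $ k * Const (C $ k $ j))" for i j
  proof (rule indep_evl_eqI[OF R ind])
    show "sbst w (M' $ i $ j) \<in> polys (loc S f)" using MN' by (intro sbst_polys[OF R w]) blast
    show "(\<Sum>k\<in>UNIV. M $ i $ k * Const (C $ k $ j)) \<in> polys (loc S f)"
      using MN(3) by (intro subringset_sum subringsetD(6)[OF Rp] Rp Const_polys R CR) blast
    have "D i (C $ k $ j) = 0" for k using derivation_zero_loc[OF D(1,2) f(1,2) CR(1)] .
    then have "D i (X' j) = (\<Sum>k\<in>UNIV. D i (X k) * C $ k $ j)"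
      unfolding X'_def derivation_sum[OF D(1)] derivationD(2)[OF D(1)] by (simp add: mult.commute)
    then show "evl X (sbst w (M' $ i $ j)) = evl X (\<Sum>k\<in>UNIV. M $ i $ k * Const (C $ k $ j))"
      using MN(5) MN'(5) by (simp add: evl_sbst evw rhom_sum[OF rhom_evl] rhom_mult[OF rhom_evl])
  qed
  then have "evl (\<lambda>_. 0) (sbst w (M' $ i $ j)) = evl (\<lambda>_. 0) (\<Sum>k\<in>UNIV. M $ i $ k * Const (C $ k $ j))" for i j
    by simp
  then have "evl (\<lambda>_. 0) (M' $ i $ j) = (C' ** C) $ i $ j" for i j
    by (simp add: evl_sbst evw rhom_sum[OF rhom_evl] rhom_mult[OF rhom_evl] matrix_matrix_mult_def C'_def map_mat_def)
  then have "\<forall>i j. evl (\<lambda>_. 0) (M' $ i $ j) = of_bool (i = j)" by (simp add: CC' mat_def)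
  then show thesis using that[OF ch MN'] by blast
qed

text \<open>Over S_{f+g} the elements \<open>f\<close> and \<open>g\<close> generate the unit ideal,
  with 1 / (f + g) as both multipliers. There the normalized charts are patched, and comaximality
  removes the denominators \<open>f\<close> and \<open>g\<close> from the result.\<close>

lemma chart_add:
  fixes D :: "'n::finite \<Rightarrow> 'a::field_char_0 \<Rightarrow> 'a" and X Y :: "'n \<Rightarrow> 'a"
  assumes S: "subringset S" "subringset A" "S \<subseteq> A" and frame: "jacobian_frame S A D"
    and f: "f \<in> S" "f \<noteq> 0" "chart S A f X" and g: "g \<in> S" "g \<noteq> 0" "chart S A g Y" and h: "f + g \<noteq> 0"
  obtains Z :: "'n \<Rightarrow> 'a" where "chart S A (f + g) Z"
proof -
  obtain X' MF NF where X': "chart S A f X'"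
    and F: "MF ** NF = mat 1" "NF ** MF = mat 1" "\<forall>i j. MF $ i $ j \<in> polys (loc S f)"
    "\<forall>i j. NF $ i $ j \<in> polys (loc S f)" "\<forall>i j. D i (X' j) = evl X' (MF $ i $ j)"
    "\<forall>i j. evl (\<lambda>_. 0) (MF $ i $ j) = of_bool (i = j)"
    using chart_normalize[OF S frame f] by blast
  obtain Y' MG NG where Y': "chart S A g Y'"
    and G: "MG ** NG = mat 1" "NG ** MG = mat 1" "\<forall>i j. MG $ i $ j \<in> polys (loc S g)"
    "\<forall>i j. NG $ i $ j \<in> polys (loc S g)" "\<forall>i j. D i (Y' j) = evl Y' (MG $ i $ j)"
    "\<forall>i j. evl (\<lambda>_. 0) (MG $ i $ j) = of_bool (i = j)"
    using chart_normalize[OF S frame g] by blast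
  have D: "derivation (D i)" "\<And>a. a \<in> S \<Longrightarrow> D i a = 0" "\<And>a. a \<in> A \<Longrightarrow> D i a \<in> A" for i
    using frame by (auto simp: jacobian_frame_def)
  let ?h = "f + g"
  define S' where "S' = loc S ?h"
  define A' where "A' = loc A ?h"
  have hS: "?h \<in> S" using S(1) f(1) g(1) by (simp add: subringsetD)
  have S': "subringset S'" unfolding S'_def by (rule subringset_loc[OF S(1) hS])
  have A': "subringset A'" unfolding A'_def using hS S by (intro subringset_loc) auto
  have sub: "S \<subseteq> S'" "A \<subseteq> A'" "S' \<subseteq> A'"
    unfolding S'_def A'_def using loc_base loc_mono[OF S(3)] by auto
  have fS': "f \<in> S'" "g \<in> S'" "f \<in> A'" "g \<in> A'" using f g sub by auto
  have ih: "inverse ?h \<in> S'" unfolding S'_def using inverse_power_loc[OF S(1) h, of 1] by simp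
  have one: "inverse ?h * f + inverse ?h * g = 1" using h by (simp flip: distrib_left)
  have adj: "adjoin (loc S' k) W = loc A' k" and ind: "indep S' W"
    if k: "k \<in> S" "k \<noteq> 0" "chart S A k W" for k and W :: "'n \<Rightarrow> 'a"
  proof -
    have kA: "k \<in> A" "?h \<in> A" using k hS S by auto
    have "loc S' k = loc (loc S k) ?h" unfolding S'_def
      using loc_loc[OF S(1) k(1) hS] loc_loc[OF S(1) hS k(1)] by (simp add: mult.commute)
    then have "adjoin (loc S' k) W = loc (adjoin (loc S k) W) ?h"
      using adjoin_loc[OF subringset_loc[OF S(1) k(1)] _ h] hS loc_base by (metis subsetD)
    also have "\<dots> = loc A' k" unfolding chart_adjoin[OF S k] A'_def
      using loc_loc[OF S(2) kA] loc_loc[OF S(2) kA(2,1)] by (simp add: mult.commute)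
    finally show "adjoin (loc S' k) W = loc A' k" .
    show "indep S' W" unfolding S'_def using k(3) by (intro indep_loc[OF S(1) hS h]) (simp add: chart_def)
  qed
  define T where "T = loc S' (f * g)"
  have T: "subringset T" unfolding T_def using fS' S' by (intro subringset_loc) (auto simp: subringsetD)
  have Tf: "T = loc (loc S' g) f" and Tg: "T = loc (loc S' f) g"
    unfolding T_def using loc_loc[OF S' fS'(1,2)] loc_loc[OF S' fS'(2,1)] by (simp_all add: mult.commute)
  have sT: "loc S f \<subseteq> T" "loc S g \<subseteq> T"
    using Tf Tg loc_base loc_mono[OF sub(1)] by (metis subset_trans)+
  have pT: "polys (loc S f) \<subseteq> polys T" "polys (loc S g) \<subseteq> polys T" using sT by (auto intro: polys_mono[THEN subsetD])
  have indT: "indep T W" if "indep S' W" for W :: "'n \<Rightarrow> 'a"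
    unfolding T_def using S' fS' f(2) g(2) that by (intro indep_loc) (auto simp: subringsetD)
  have adjT: "adjoin T X' = loc A' (f * g)" "adjoin T Y' = loc A' (f * g)"
  proof -
    show "adjoin T X' = loc A' (f * g)" unfolding Tg
      using adjoin_loc[OF subringset_loc[OF S' fS'(1)] _ g(2)] fS' loc_base adj[OF f(1,2) X']
        loc_loc[OF A' fS'(4,3)] by (metis mult.commute subsetD)
    show "adjoin T Y' = loc A' (f * g)" unfolding Tf
      using adjoin_loc[OF subringset_loc[OF S' fS'(2)] _ f(2)] fS' loc_base adj[OF g(1,2) Y']
        loc_loc[OF A' fS'(3,4)] by (metis subsetD)
  qed
  have DT: "D i a = 0" if "a \<in> T" for i a
  proof (rule derivation_zero_loc[OF D(1)])
    show "D i a = 0" if "a \<in> S'" for a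
      using derivation_zero_loc[OF D(1,2) hS h] that unfolding S'_def by blast
    show "f * g \<in> S'" using S' fS' by (simp add: subringsetD)
    show "f * g \<noteq> 0" using f g by simp
    show "a \<in> loc S' (f * g)" using that by (simp add: T_def)
  qed
  obtain Z :: "'n \<Rightarrow> 'a" where Z: "adjoin (loc S' f) Z = adjoin (loc S' f) X'" "adjoin (loc S' g) Z = adjoin (loc S' g) Y'"
  proof (rule patch_normalized[OF S' fS'(1,2) ih ih one, folded T_def])
    show "indep T Y'" by (rule indT[OF ind[OF g(1,2) Y']])
    show "X' i \<in> adjoin T Y'" for i unfolding adjT(2) adjT(1)[symmetric] by (rule adjoin_gen[OF T])
    show "Y' i \<in> adjoin T X'" for i unfolding adjT(1) adjT(2)[symmetric] by (rule adjoin_gen[OF T])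
    show "MF ** NF = mat 1" "NF ** MF = mat 1" by fact+
    show "MF $ i $ j \<in> polys T" "NF $ i $ j \<in> polys T" "MG $ i $ j \<in> polys T" for i j
      using F G pT by blast+
    show "evl (\<lambda>_. 0) (MF $ i $ j) = of_bool (i = j)" "evl (\<lambda>_. 0) (MG $ i $ j) = of_bool (i = j)"
      "D i (X' j) = evl X' (MF $ i $ j)" "D i (Y' j) = evl Y' (MG $ i $ j)" for i j
      using F G by blast+
    show "derivation (D i)" "a \<in> T \<Longrightarrow> D i a = 0" for i a using D DT by blast+
  qed
  have Sg: "subringset (loc S' g)" and Sf: "subringset (loc S' f)" using S' fS' by (auto intro: subringset_loc)
  have indZ: "indep (loc S' g) Z"
  proof (rule indep_generators[OF Sg])
    show "indep (loc S' g) Y'" by (rule indep_loc[OF S' fS'(2) g(2) ind[OF g(1,2) Y']])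
    show "Z i \<in> adjoin (loc S' g) Y'" for i using adjoin_gen[OF Sg, of Z i] unfolding Z .
    show "Y' i \<in> adjoin (loc S' g) Z" for i using adjoin_gen[OF Sg, of Y' i] unfolding Z .
  qed
  then have indS': "indep S' Z" by (rule indep_mono[OF loc_base])
  have "chart S A ?h Z"
    unfolding chart_def
  proof (intro conjI allI subsetI)
    show "indep S Z" by (rule indep_mono[OF sub(1) indS'])
    \<comment> \<open>The coordinates lie in both localizations of \<open>A'\<close>, hence in
      \<open>A'\<close> itself.\<close>
    have "Z i \<in> loc A' f \<inter> loc A' g" for i
      using adjoin_gen[OF Sf, of Z i] adjoin_gen[OF Sg, of Z i] unfolding Z
      by (simp add: adj[OF f(1,2) X'] adj[OF g(1,2) Y'])
    also have "loc A' f \<inter> loc A' g = A'"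
      using ih sub one by (intro loc_Int_comaximal[OF A' fS'(3,4)]) auto
    finally show "Z i \<in> loc A ?h" for i by (simp add: A'_def)
    fix a assume "a \<in> A"
    then have "a \<in> loc A' f" "a \<in> loc A' g" using sub loc_base by blast+
    then have "a \<in> adjoin (loc S' f) Z" "a \<in> adjoin (loc S' g) Z"
      unfolding Z adj[OF f(1,2) X'] adj[OF g(1,2) Y'] by blast+
    then obtain p q where pq: "p \<in> polys (loc S' f)" "a = evl Z p" "q \<in> polys (loc S' g)" "a = evl Z q"
      unfolding adjoin_evl by blast
    \<comment> \<open>The two expressions of \<open>a\<close> agree over the common localization
      \<open>T\<close>. Their coefficients therefore lie in both localizations of \<open>S'\<close>,
      which intersect in \<open>S'\<close>.\<close>
    have "p = q"
    proof (rule indep_evl_eqI[OF T indT[OF indS']])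
      show "p \<in> polys T" "q \<in> polys T"
        using pq polys_mono[of "loc S' f" T] polys_mono[of "loc S' g" T] Tf Tg loc_base by blast+
    qed (use pq in simp)
    then have "p \<in> polys (loc S' f \<inter> loc S' g)" using pq by (simp add: polys_Int)
    also have "loc S' f \<inter> loc S' g = S'" by (rule loc_Int_comaximal[OF S' fS'(1,2) ih ih one])
    finally show "a \<in> adjoin (loc S ?h) Z" using pq(2) unfolding S'_def adjoin_evl by blast
  qed
  then show thesis by (rule that)
qed

section \<open>Derivations of fraction fields\<close>

text \<open>Independence of generators is proved by differentiation, and it is applied inside
  fraction fields.\<close>

instance fract :: ("{idom, ring_char_0}") field_char_0
proof
  show "inj (of_nat :: nat \<Rightarrow> 'a fract)"
    by (rule injI) (simp add: of_nat_fract eq_fract)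
qed

definition emb :: "'a::idom \<Rightarrow> 'a fract" where
  "emb a = Fract a 1"

lemma rhom_emb: "rhom emb"
  by (rule rhomI) (simp_all add: emb_def One_fract_def)

lemma emb_eq_iff [simp]: "emb a = emb b \<longleftrightarrow> a = b"
  by (simp add: emb_def eq_fract)

lemma emb_eq_0_iff [simp]: "emb a = 0 \<longleftrightarrow> a = 0"
  using emb_eq_iff[of a 0] by (simp add: rhom_0[OF rhom_emb])

lemma Fract_eq_emb: "Fract a b = emb a / emb b"
  by (simp add: emb_def)

text \<open>Quotient rule: x b = a forces D x = (\<delta> a - x \<delta> b) / b. The value is the
  same for every fraction representing x, so it is selected as the one that fits them all.\<close>

definition derivation_fract :: "('a::idom \<Rightarrow> 'a) \<Rightarrow> 'a fract \<Rightarrow> 'a fract" where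
  "derivation_fract \<delta> x = (THE y. \<forall>a b. b \<noteq> 0 \<longrightarrow> x * emb b = emb a \<longrightarrow> y = (emb (\<delta> a) - x * emb (\<delta> b)) / emb b)"

lemma fract_denominator:
  obtains a b where "b \<noteq> 0" "x * emb b = emb a"
proof (cases x)
  case (Fract a b)
  then show ?thesis using that[of b a] by (simp add: Fract_eq_emb)
qed

lemma derivation_fract_eq:
  assumes \<delta>: "derivation \<delta>" and "b \<noteq> 0" "x * emb b = emb a"
  shows "derivation_fract \<delta> x = (emb (\<delta> a) - x * emb (\<delta> b)) / emb b"
proof -
  have *: "(emb (\<delta> a) - x * emb (\<delta> b)) / emb b = (emb (\<delta> c) - x * emb (\<delta> d)) / emb d"
    if ab: "b \<noteq> 0" "x * emb b = emb a" and cd: "d \<noteq> 0" "x * emb d = emb c" for a b c d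
  proof -
    have "emb (a * d) = emb (c * b)" by (simp add: rhom_mult[OF rhom_emb] flip: ab cd)
    then have "\<delta> (a * d) = \<delta> (c * b)" by simp
    then have "emb (a * \<delta> d + d * \<delta> a) = emb (c * \<delta> b + b * \<delta> c)" by (simp add: derivationD[OF \<delta>])
    then have "emb a * emb (\<delta> d) + emb d * emb (\<delta> a) = emb c * emb (\<delta> b) + emb b * emb (\<delta> c)"
      by (simp add: rhom_simps[OF rhom_emb])
    then have "emb d * (emb (\<delta> a) - x * emb (\<delta> b)) = emb b * (emb (\<delta> c) - x * emb (\<delta> d))"
      unfolding ab(2)[symmetric] cd(2)[symmetric] by (simp add: algebra_simps)
    then show ?thesis using ab(1) cd(1) by (simp add: field_simps)
  qed
  show ?thesis
    unfolding derivation_fract_def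
  proof (rule the_equality)
    show "\<forall>c d. d \<noteq> 0 \<longrightarrow> x * emb d = emb c \<longrightarrow>
        (emb (\<delta> a) - x * emb (\<delta> b)) / emb b = (emb (\<delta> c) - x * emb (\<delta> d)) / emb d"
      using *[OF assms(2,3)] by blast
  qed (use assms in blast)
qed

lemma derivation_fract_emb:
  assumes "derivation \<delta>"
  shows "derivation_fract \<delta> (emb a) = emb (\<delta> a)"
  using derivation_fract_eq[OF assms, of 1 "emb a" a] derivationD(4)[OF assms]
  by (simp add: rhom_simps[OF rhom_emb])

lemma derivation_derivation_fract:
  assumes \<delta>: "derivation \<delta>"
  shows "derivation (derivation_fract \<delta>)"
  unfolding derivation_def
proof (intro conjI allI)
  fix x y :: "'a fract"
  obtain a b where ab: "b \<noteq> 0" "x * emb b = emb a" by (rule fract_denominator)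
  obtain c d where cd: "d \<noteq> 0" "y * emb d = emb c" by (rule fract_denominator)
  note E = rhom_simps[OF rhom_emb] derivationD[OF \<delta>]
  note X = derivation_fract_eq[OF \<delta> ab] derivation_fract_eq[OF \<delta> cd]
  have "(x + y) * emb (b * d) = emb (a * d + c * b)"
    by (simp add: E algebra_simps flip: ab(2) cd(2))
  then have 1: "derivation_fract \<delta> (x + y) = (emb (\<delta> (a * d + c * b)) - (x + y) * emb (\<delta> (b * d))) / emb (b * d)"
    using ab cd by (intro derivation_fract_eq[OF \<delta>]) auto
  show "derivation_fract \<delta> (x + y) = derivation_fract \<delta> x + derivation_fract \<delta> y"
    unfolding 1 X using ab(1) cd(1)
    by (simp add: E divide_simps flip: ab(2) cd(2)) (simp add: algebra_simps)
  have "(x * y) * emb (b * d) = emb (a * c)"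
    by (simp add: E algebra_simps flip: ab(2) cd(2))
  then have 2: "derivation_fract \<delta> (x * y) = (emb (\<delta> (a * c)) - (x * y) * emb (\<delta> (b * d))) / emb (b * d)"
    using ab cd by (intro derivation_fract_eq[OF \<delta>]) auto
  show "derivation_fract \<delta> (x * y) = x * derivation_fract \<delta> y + y * derivation_fract \<delta> x"
    unfolding 2 X using ab(1) cd(1)
    by (simp add: E divide_simps flip: ab(2) cd(2)) (simp add: algebra_simps)
qed

lemma derivation_pd: "derivation (pd j)"
  by (simp add: derivation_def pd_add pd_mult)

section \<open>Charts of the map \<open>(x, v)\<close>\<close>

type_synonym A4fract = "(4, complex) mpoly fract"

definition fract_pd :: "4 \<Rightarrow> A4fract \<Rightarrow> A4fract" where
  "fract_pd k = derivation_fract (pd k)"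

lemma derivation_fract_pd: "derivation (fract_pd k)"
  unfolding fract_pd_def by (rule derivation_derivation_fract[OF derivation_pd])

lemma fract_pd_emb: "fract_pd k (emb p) = emb (pd k p)"
  unfolding fract_pd_def by (rule derivation_fract_emb[OF derivation_pd])

lemma rhom_comorphism: "rhom (comorphism_xv v)"
  unfolding comorphism_xv_def by (intro rhom_poly_subst rhom_Const)

lemma comorphism_simps [simp]:
  "comorphism_xv v (Const c) = Const c" "comorphism_xv v (Var 0) = Var 0" "comorphism_xv v (Var 1) = v"
  by (simp_all add: comorphism_xv_def rhom_Const)

abbreviation A_ring :: "A4fract set" where
  "A_ring \<equiv> range emb"

abbreviation base_ring :: "(4, complex) mpoly \<Rightarrow> A4fract set" where
  "base_ring v \<equiv> range (\<lambda>r. emb (comorphism_xv v r))"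

lemma subringset_A: "subringset A_ring"
  by (rule subringset_range[OF rhom_emb])

lemma subringset_base: "subringset (base_ring v)"
  by (rule subringset_range[OF rhom_comp[OF rhom_emb rhom_comorphism]])

lemma base_subset_A: "base_ring v \<subseteq> A_ring"
  by auto

lemma base_ring_least:
  assumes "subringset T" "\<And>c. emb (Const c) \<in> T" "emb (Var 0) \<in> T" "emb v \<in> T"
  shows "base_ring v \<subseteq> T"
proof
  fix a assume "a \<in> base_ring v"
  then obtain p where p: "a = emb (comorphism_xv v p)" by blast
  have V: "emb (comorphism_xv v (Var i)) \<in> T" for i
    using assms by (cases "i = 0") (simp_all add: comorphism_xv_def rhom_Const)
  have "p \<in> {p. emb (comorphism_xv v p) \<in> T}"
    using polys_subset_subringset[OF subringset_vimage[OF rhom_comp[OF rhom_emb rhom_comorphism] assms(1)], of UNIV]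
      assms V by auto
  then show "a \<in> T" using p by simp
qed

text \<open>The coordinates of a chart over the complex numbers, base coordinates included. Index 1
  stands for v here, whereas among the variables it stands for y.\<close>

definition chart_vars :: "(4, complex) mpoly \<Rightarrow> (2 \<Rightarrow> A4fract) \<Rightarrow> 4 \<Rightarrow> A4fract" where
  "chart_vars v X j = (if j = 0 then emb (Var 0) else if j = 1 then emb v else if j = 2 then X 0 else X 1)"

lemma sum_4': "(\<Sum>i\<in>UNIV. f (i::4)) = f 0 + f 1 + f 2 + (f 3 :: 'a::ab_group_add)"
proof -
  have "f (4::4) = f 0" by (rule arg_cong) simp
  then show ?thesis using sum_4[of f] by (simp add: add_ac)
qed

lemma forall_2': "(\<forall>i::2. P i) \<longleftrightarrow> P 0 \<and> P 1"
proof -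
  have "(2::2) = 0" by simp
  then show ?thesis using forall_2[of P] by metis
qed

text \<open>Every element of the chart is a function of \<open>x\<close>, \<open>v\<close> and the two coordinates, so its differential
  is a combination of theirs.\<close>

lemma chart_differential:
  assumes f: "f \<in> base_ring v" "f \<noteq> 0" "chart (base_ring v) A_ring f X" and a: "a \<in> loc A_ring f"
  shows "\<exists>\<alpha>. (\<forall>j. \<alpha> j \<in> loc A_ring f) \<and>
    (\<forall>D. derivation D \<longrightarrow> (\<forall>c. D (emb (Const c)) = 0) \<longrightarrow> D a = (\<Sum>j\<in>UNIV. \<alpha> j * D (chart_vars v X j)))"
proof -
  let ?B = "loc A_ring f" and ?w = "chart_vars v X"
  \<comment> \<open>\<open>\<alpha>\<close> are the coefficients of the differential of
    \<open>a\<close>, the same for every derivation over the complex numbers.\<close>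
  define diff where "diff a \<alpha> \<longleftrightarrow> (\<forall>j. \<alpha> j \<in> ?B) \<and>
    (\<forall>D. derivation D \<longrightarrow> (\<forall>c. D (emb (Const c)) = 0) \<longrightarrow> D a = (\<Sum>j\<in>UNIV. \<alpha> j * D (?w j)))" for a \<alpha>
  have diffD: "\<alpha> j \<in> ?B"
    "derivation D \<Longrightarrow> \<forall>c. D (emb (Const c)) = 0 \<Longrightarrow> D a = (\<Sum>j\<in>UNIV. \<alpha> j * D (?w j))"
    if "diff a \<alpha>" for a \<alpha> j D
    using that unfolding diff_def by blast+
  have diffI: "diff a \<alpha>"
    if "\<And>j. \<alpha> j \<in> ?B"
      "\<And>D. derivation D \<Longrightarrow> \<forall>c. D (emb (Const c)) = 0 \<Longrightarrow> D a = (\<Sum>j\<in>UNIV. \<alpha> j * D (?w j))" for a \<alpha>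
    using that unfolding diff_def by blast
  define G where "G = {a \<in> ?B. \<exists>\<alpha>. diff a \<alpha>}"
  have fA: "f \<in> A_ring" using f base_subset_A by blast
  have B: "subringset ?B" by (rule subringset_loc[OF subringset_A fA])
  note s = subringsetD[OF B]
  have "subringset G"
    unfolding subringset_def
  proof (intro conjI ballI)
    have "diff 1 (\<lambda>_. 0)" by (rule diffI) (simp_all add: s derivationD(4))
    then show "1 \<in> G" using s by (auto simp: G_def)
    fix a b assume "a \<in> G" "b \<in> G"
    then obtain \<alpha> \<beta> where *: "diff a \<alpha>" "diff b \<beta>" "a \<in> ?B" "b \<in> ?B" by (auto simp: G_def)
    have "diff (a - b) (\<lambda>j. \<alpha> j - \<beta> j)"
    proof (rule diffI)
      show "\<alpha> j - \<beta> j \<in> ?B" for j using *(1,2) diffD(1) by (intro s(4))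
      show "D (a - b) = (\<Sum>j\<in>UNIV. (\<alpha> j - \<beta> j) * D (?w j))"
        if "derivation D" "\<forall>c. D (emb (Const c)) = 0" for D
        unfolding derivationD(6)[OF that(1)] diffD(2)[OF *(1) that] diffD(2)[OF *(2) that]
        by (simp add: left_diff_distrib sum_subtractf)
    qed
    then show "a - b \<in> G" using * s by (auto simp: G_def)
    have "diff (a * b) (\<lambda>j. a * \<beta> j + b * \<alpha> j)"
    proof (rule diffI)
      show "a * \<beta> j + b * \<alpha> j \<in> ?B" for j using * diffD(1) by (intro s(5,6))
      show "D (a * b) = (\<Sum>j\<in>UNIV. (a * \<beta> j + b * \<alpha> j) * D (?w j))"
        if "derivation D" "\<forall>c. D (emb (Const c)) = 0" for D
        unfolding derivationD(2)[OF that(1)] diffD(2)[OF *(1) that] diffD(2)[OF *(2) that]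
        by (simp add: distrib_right sum.distrib sum_distrib_left mult.assoc)
    qed
    then show "a * b \<in> G" using * s by (auto simp: G_def)
  qed
  note G = subringsetD[OF this] this
  have AB: "A_ring \<subseteq> ?B" by (rule loc_base)
  have const: "emb (Const c) \<in> G" for c
  proof -
    have "diff (emb (Const c)) (\<lambda>_. 0)" by (rule diffI) (simp_all add: s)
    then show ?thesis using AB by (auto simp: G_def)
  qed
  have w: "?w j \<in> G" for j
  proof -
    have "diff (?w j) (\<lambda>i. of_bool (i = j))"
    proof (rule diffI)
      show "of_bool (i = j) \<in> ?B" for i by (simp add: of_bool_def s)
      show "D (?w j) = (\<Sum>i\<in>UNIV. of_bool (i = j) * D (?w i))" for D :: "A4fract \<Rightarrow> A4fract"
        unfolding mult.commute[of "of_bool _"] by simp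
    qed
    moreover have "?w j \<in> ?B" using AB f(3) by (auto simp: chart_vars_def chart_def)
    ultimately show ?thesis by (auto simp: G_def)
  qed
  have SG: "base_ring v \<subseteq> G"
    using w[of 0] w[of 1] by (intro base_ring_least G const) (simp_all add: chart_vars_def)
  \<comment> \<open>Quotient rule: the differential of \<open>a\<close> follows from those of f^n a
    and f^n.\<close>
  have locG: "loc (base_ring v) f \<subseteq> G"
  proof
    fix a assume a: "a \<in> loc (base_ring v) f"
    then obtain n where n: "f ^ n * a \<in> G" using SG by (auto simp: loc_def)
    have "f ^ n \<in> G" by (rule G(7)[OF subsetD[OF SG f(1)]])
    with n obtain \<alpha> \<beta> where \<alpha>: "diff (f ^ n * a) \<alpha>" and \<beta>: "diff (f ^ n) \<beta>"
      unfolding G_def by blast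
    have i: "inverse (f ^ n) \<in> ?B" by (rule inverse_power_loc[OF subringset_A f(2)])
    have aB: "a \<in> ?B" using a loc_mono[OF base_subset_A] by blast
    have "diff a (\<lambda>j. inverse (f ^ n) * (\<alpha> j - a * \<beta> j))"
    proof (rule diffI)
      show "inverse (f ^ n) * (\<alpha> j - a * \<beta> j) \<in> ?B" for j
        using i diffD(1)[OF \<alpha>] diffD(1)[OF \<beta>] aB by (intro s(4,6))
      fix D :: "A4fract \<Rightarrow> A4fract" assume D: "derivation D" "\<forall>c. D (emb (Const c)) = 0"
      have "f ^ n * D a = D (f ^ n * a) - a * D (f ^ n)" by (simp add: derivationD(2)[OF D(1)])
      also have "\<dots> = (\<Sum>j\<in>UNIV. \<alpha> j * D (?w j)) - a * (\<Sum>j\<in>UNIV. \<beta> j * D (?w j))"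
        unfolding diffD(2)[OF \<alpha> D] diffD(2)[OF \<beta> D] ..
      also have "\<dots> = (\<Sum>j\<in>UNIV. (\<alpha> j - a * \<beta> j) * D (?w j))"
        by (simp add: left_diff_distrib sum_subtractf sum_distrib_left mult.assoc)
      finally have "D a = inverse (f ^ n) * (\<Sum>j\<in>UNIV. (\<alpha> j - a * \<beta> j) * D (?w j))"
        using f(2) by (simp add: field_simps)
      then show "D a = (\<Sum>j\<in>UNIV. inverse (f ^ n) * (\<alpha> j - a * \<beta> j) * D (?w j))"
        by (simp only: sum_distrib_left mult.assoc)
    qed
    then show "a \<in> G" using aB by (auto simp: G_def)
  qed
  have "adjoin (loc (base_ring v) f) X \<subseteq> G"
  proof (rule adjoin_least[OF G(8) locG])
    show "X i \<in> G" for i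
    proof -
      have "\<forall>i. X i \<in> G" unfolding forall_2' using w[of 2] w[of 3] by (simp add: chart_vars_def)
      then show ?thesis by blast
    qed
  qed
  then have "a \<in> G"
    using a chart_adjoin[OF subringset_base subringset_A base_subset_A f] by blast
  then show ?thesis by (auto simp: G_def diff_def)
qed

text \<open>The differentials of x, y, z, u expressed in the chart coordinates give P Q = 1, where
  \<open>Q\<close> is the Jacobian matrix of the chart coordinates, and hence Q P = 1. The first row
  of \<open>P\<close> is known because x belongs to both coordinate systems.\<close>

lemma chart_inverse_jacobian:
  assumes f: "f \<in> base_ring v" "f \<noteq> 0" "chart (base_ring v) A_ring f X"
  obtains P :: "A4fract^4^4" where "\<forall>k l. P $ k $ l \<in> loc A_ring f" "\<forall>l. P $ 0 $ l = of_bool (l = 0)"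
    "\<forall>j l. (\<Sum>k\<in>UNIV. fract_pd k (chart_vars v X j) * P $ k $ l) = of_bool (j = l)"
proof -
  have "\<exists>\<alpha>. (\<forall>j. \<alpha> j \<in> loc A_ring f) \<and>
    (\<forall>D. derivation D \<longrightarrow> (\<forall>c. D (emb (Const c)) = 0) \<longrightarrow>
      D (emb (Var i)) = (\<Sum>j\<in>UNIV. \<alpha> j * D (chart_vars v X j)))" for i
    by (rule chart_differential[OF f]) (rule subsetD[OF loc_base rangeI])
  then have "\<exists>\<alpha>. \<forall>i. (\<forall>j. \<alpha> i j \<in> loc A_ring f) \<and>
    (\<forall>D. derivation D \<longrightarrow> (\<forall>c. D (emb (Const c)) = 0) \<longrightarrow>
      D (emb (Var i)) = (\<Sum>j\<in>UNIV. \<alpha> i j * D (chart_vars v X j)))"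
    by (intro choice allI)
  then obtain \<alpha> where \<alpha>': "\<forall>i. (\<forall>j. \<alpha> i j \<in> loc A_ring f) \<and>
    (\<forall>D. derivation D \<longrightarrow> (\<forall>c. D (emb (Const c)) = 0) \<longrightarrow>
      D (emb (Var i)) = (\<Sum>j\<in>UNIV. \<alpha> i j * D (chart_vars v X j)))" ..
  have \<alpha>: "\<alpha> i j \<in> loc A_ring f"
    "derivation D \<Longrightarrow> (\<forall>c. D (emb (Const c)) = 0) \<Longrightarrow>
      D (emb (Var i)) = (\<Sum>j\<in>UNIV. \<alpha> i j * D (chart_vars v X j))" for i j D
    using \<alpha>'[rule_format] by blast+
  define P :: "A4fract^4^4" where "P = (\<chi> i j. \<alpha> i j)"
  define Q :: "A4fract^4^4" where "Q = (\<chi> j k. fract_pd k (chart_vars v X j))"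
  have "(P ** Q) $ i $ k = mat 1 $ i $ k" for i k
  proof -
    have "fract_pd k (emb (Var i)) = (\<Sum>j\<in>UNIV. \<alpha> i j * fract_pd k (chart_vars v X j))"
      by (rule \<alpha>(2)[OF derivation_fract_pd]) (simp add: fract_pd_emb rhom_simps[OF rhom_emb])
    moreover have "fract_pd k (emb (Var i)) = of_bool (i = k)"
      by (simp add: fract_pd_emb of_bool_def rhom_simps[OF rhom_emb])
    ultimately have "(\<Sum>j\<in>UNIV. \<alpha> i j * fract_pd k (chart_vars v X j)) = mat 1 $ i $ k"
      by (simp only: mat_def of_bool_def vec_lambda_beta)
    then show ?thesis by (simp add: matrix_matrix_mult_def P_def Q_def)
  qed
  then have "P ** Q = mat 1" by (simp add: vec_eq_iff)
  then have QP: "Q ** P = mat 1" by (rule matrix_left_right_inverse[THEN iffD1])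
  have 1: "(\<Sum>k\<in>UNIV. fract_pd k (chart_vars v X j) * P $ k $ l) = of_bool (j = l)" for j l
    using arg_cong[OF QP, of "\<lambda>C. C $ j $ l"] by (simp add: matrix_matrix_mult_def Q_def mat_def)
  have "P $ 0 $ l = of_bool (l = 0)" for l
    using 1[of 0 l] by (cases "l = 0") (simp_all add: chart_vars_def fract_pd_emb sum_4' rhom_simps[OF rhom_emb])
  then show thesis using that[of P] \<alpha>(1) 1 by (simp add: P_def)
qed

text \<open>The derivative in x is left out: x belongs to the base, and vector fields along the
  fibres have no component in its direction.\<close>

definition grad :: "(4, complex) mpoly \<Rightarrow> (4, complex) mpoly^3" where
  "grad v = vector [pd 1 v, pd 2 v, pd 3 v]"

text \<open>The diagonal entry of Q P = 1 at v pairs the differential of v with a column of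
  \<open>P\<close> whose x-entry is 0. Clearing denominators leaves a power of the function that
  defines the chart.\<close>

lemma chart_gradient:
  fixes X :: "2 \<Rightarrow> A4fract"
  assumes "emb (comorphism_xv v r) \<noteq> 0" "chart (base_ring v) A_ring (emb (comorphism_xv v r)) X"
  shows "\<exists>n e. comorphism_xv v r ^ n = (\<Sum>i\<in>UNIV. grad v $ i * e $ i)"
proof -
  let ?h = "comorphism_xv v r"
  let ?f = "emb ?h"
  obtain P :: "A4fract^4^4" where P: "\<forall>k l. P $ k $ l \<in> loc A_ring ?f" "\<forall>l. P $ 0 $ l = of_bool (l = 0)"
    "\<forall>j l. (\<Sum>k\<in>UNIV. fract_pd k (chart_vars v X j) * P $ k $ l) = of_bool (j = l)"
    using chart_inverse_jacobian[OF _ assms] by blast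
  have "(\<Sum>k\<in>UNIV. fract_pd k (emb v) * P $ k $ 1) = 1"
    using P(3)[rule_format, of 1 1] by (simp add: chart_vars_def)
  then have eq: "emb (pd 1 v) * P $ 1 $ 1 + emb (pd 2 v) * P $ 2 $ 1 + emb (pd 3 v) * P $ 3 $ 1 = 1"
    using P(2) by (simp add: sum_4' fract_pd_emb)
  have "\<exists>n. \<forall>k\<in>UNIV. ?f ^ n * P $ k $ 1 \<in> A_ring"
    using P(1) power_mult_mono[OF subringset_A, of ?f]
    by (intro finite_max_bound) (auto simp: loc_def)
  then obtain n where "\<And>k. ?f ^ n * P $ k $ 1 \<in> A_ring" by blast
  then have "\<exists>a. ?f ^ n * P $ k $ 1 = emb a" for k by blast
  then obtain a where a: "\<And>k. ?f ^ n * P $ k $ 1 = emb (a k)" by metis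
  have "emb (?h ^ n) = ?f ^ n * (emb (pd 1 v) * P $ 1 $ 1 + emb (pd 2 v) * P $ 2 $ 1 + emb (pd 3 v) * P $ 3 $ 1)"
    unfolding eq by (simp add: rhom_simps[OF rhom_emb])
  also have "\<dots> = emb (pd 1 v) * (?f ^ n * P $ 1 $ 1) + emb (pd 2 v) * (?f ^ n * P $ 2 $ 1) + emb (pd 3 v) * (?f ^ n * P $ 3 $ 1)"
    by (simp add: algebra_simps)
  also have "\<dots> = emb (pd 1 v * a 1 + pd 2 v * a 2 + pd 3 v * a 3)"
    unfolding a by (simp add: rhom_simps[OF rhom_emb])
  finally have "?h ^ n = pd 1 v * a 1 + pd 2 v * a 2 + pd 3 v * a 3" by simp
  then have "?h ^ n = (\<Sum>i\<in>UNIV. grad v $ i * (vector [a 1, a 2, a 3] :: (4, complex) mpoly^3) $ i)"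
    by (simp add: grad_def sum_3)
  then show ?thesis by blast
qed

text \<open>A completion of the gradient to an invertible matrix provides a basis of the derivations of
  \<open>\<complex>[x, y, z, u]\<close> that are trivial on \<open>\<complex>[x, v]\<close>.\<close>

lemma jacobian_frame_exists:
  assumes "unimodular (grad v)"
  obtains D :: "2 \<Rightarrow> A4fract \<Rightarrow> A4fract" where "jacobian_frame (base_ring v) A_ring D"
proof -
  have "row_equiv (grad v) (vector [1, 0, 0])"
    using rows_completable_mpoly4 assms unfolding rows_completable_def by blast
  then obtain M N :: "(4, complex) mpoly^3^3" where MN: "M ** N = mat 1" "N ** M = mat 1"
    "grad v v* M = vector [1, 0, 0]" unfolding row_equiv_def by blast
  have "grad v = (grad v v* M) v* N" by (simp only: vector_matrix_mul_assoc MN(1) vector_matrix_mul_rid)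
  then have "grad v = vector [1, 0, 0] v* N" by (simp only: MN(3))
  \<comment> \<open>The inverse of the completing matrix has the gradient as its first row.\<close>
  then have N1: "N $ 1 = grad v" by (simp add: vec_eq_iff vector_matrix_mult_def sum_3)
  \<comment> \<open>Columns 2 and 3 of \<open>M\<close> pair to 0 with the gradient, so as vector
    fields they kill v.\<close>
  define \<sigma> :: "2 \<Rightarrow> 3" where "\<sigma> i = (if i = 0 then 2 else 3)" for i
  define D :: "2 \<Rightarrow> A4fract \<Rightarrow> A4fract" where
    "D i a = emb (M $ 1 $ \<sigma> i) * fract_pd 1 a + emb (M $ 2 $ \<sigma> i) * fract_pd 2 a + emb (M $ 3 $ \<sigma> i) * fract_pd 3 a" for i a
  have D: "derivation (D i)" for i
    unfolding derivation_def D_def by (simp add: derivationD[OF derivation_fract_pd] algebra_simps)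
  have DA: "D i (emb p) = emb (M $ 1 $ \<sigma> i * pd 1 p + M $ 2 $ \<sigma> i * pd 2 p + M $ 3 $ \<sigma> i * pd 3 p)" for i p
    by (simp add: D_def fract_pd_emb rhom_simps[OF rhom_emb])
  have "(grad v v* M) $ \<sigma> i = 0" for i unfolding MN(3) by (simp add: \<sigma>_def)
  then have "M $ 1 $ \<sigma> i * pd 1 v + M $ 2 $ \<sigma> i * pd 2 v + M $ 3 $ \<sigma> i * pd 3 v = 0" for i
    by (simp add: vector_matrix_mult_def sum_3 grad_def mult.commute)
  then have Dv: "D i (emb v) = 0" for i
    unfolding DA by (simp only: rhom_0[OF rhom_emb])
  have D0: "base_ring v \<subseteq> {a. D i a = 0}" for i
  proof (rule base_ring_least)
    show "subringset {a. D i a = 0}" by (simp add: subringset_def derivationD[OF D])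
    show "emb v \<in> {a. D i a = 0}" by (simp add: Dv)
  qed (simp_all add: DA rhom_0[OF rhom_emb])
  have "jacobian_frame (base_ring v) A_ring D"
    unfolding jacobian_frame_def
  proof (intro conjI allI impI ballI)
    show "derivation (D i)" for i by (rule D)
    show "D i a = 0" if "a \<in> base_ring v" for i a using D0 that by blast
    show "D i a \<in> A_ring" if "a \<in> A_ring" for i a using that DA by auto
    fix f and X :: "2 \<Rightarrow> A4fract"
    assume f: "f \<in> base_ring v" "f \<noteq> 0" "chart (base_ring v) A_ring f X"
    obtain P :: "A4fract^4^4" where P: "\<forall>k l. P $ k $ l \<in> loc A_ring f" "\<forall>l. P $ 0 $ l = of_bool (l = 0)"
      "\<forall>j l. (\<Sum>k\<in>UNIV. fract_pd k (chart_vars v X j) * P $ k $ l) = of_bool (j = l)"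
      using chart_inverse_jacobian[OF f] by blast
    define col :: "2 \<Rightarrow> 4" where "col l = (if l = 0 then 2 else 3)" for l
    have col: "col l \<noteq> 0" "col l \<noteq> 1" "chart_vars v X (col l) = X l" "col q = col l \<longleftrightarrow> q = l" for l q
    proof -
      have "\<forall>l. l = 0 \<or> l = (1::2)" unfolding forall_2' by simp
      then show "col l \<noteq> 0" "col l \<noteq> 1" "chart_vars v X (col l) = X l" "col q = col l \<longleftrightarrow> q = l"
        by (auto simp: col_def chart_vars_def)
    qed
    define e :: "2 \<Rightarrow> A4fract^3" where "e l = vector [P $ 1 $ col l, P $ 2 $ col l, P $ 3 $ col l]" for l
    \<comment> \<open>\<open>e l\<close> is the vector field dual to the coordinate
      \<open>X l\<close>, and \<open>n l\<close> are its components in the columns of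
      \<open>M\<close>. The first component is its value on v, which is 0.\<close>
    define n :: "2 \<Rightarrow> A4fract^3" where "n l = map_mat emb N *v e l" for l
    have pe: "emb (pd 1 p) * e l $ 1 + emb (pd 2 p) * e l $ 2 + emb (pd 3 p) * e l $ 3 =
        (\<Sum>k\<in>UNIV. fract_pd k (emb p) * P $ k $ col l)" for p l
      using P(2) col by (simp add: sum_4' e_def fract_pd_emb)
    have n1: "n l $ 1 = 0" for l
    proof -
      have "n l $ 1 = emb (pd 1 v) * e l $ 1 + emb (pd 2 v) * e l $ 2 + emb (pd 3 v) * e l $ 3"
        unfolding n_def matrix_vector_mult_def by (simp add: map_mat_def sum_3 N1 grad_def)
      also have "\<dots> = (\<Sum>k\<in>UNIV. fract_pd k (chart_vars v X 1) * P $ k $ col l)"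
        unfolding pe by (simp add: chart_vars_def)
      finally show ?thesis using P(3) col(2)[of l] by simp
    qed
    have Mn: "map_mat emb M *v n l = e l" for l
      unfolding n_def matrix_vector_mul_assoc map_mat_mult[OF rhom_emb, symmetric] MN
      by (simp add: map_mat_mat[OF rhom_emb] rhom_1[OF rhom_emb])
    have Me: "e l $ m = emb (M $ m $ 2) * n l $ 2 + emb (M $ m $ 3) * n l $ 3" for l m
      using arg_cong[OF Mn[of l], of "\<lambda>x. x $ m"]
      by (simp add: matrix_vector_mult_def map_mat_def sum_3 n1)
    \<comment> \<open>Hence \<open>K\<close> writes the coordinate vector fields in the frame;
      applied to the coordinates they give the identity matrix.\<close>
    define K :: "A4fract^2^2" where "K = (\<chi> l i. n l $ \<sigma> i)"
    have "(K ** (\<chi> i j. D i (X j))) $ l $ q = mat 1 $ l $ q" for l q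
    proof -
      have "(K ** (\<chi> i j. D i (X j))) $ l $ q = n l $ 2 * D 0 (X q) + n l $ 3 * D 1 (X q)"
      proof -
        \<comment> \<open>In the index type the numeral 2 equals 0, while \<open>sum_2\<close> runs
          over 1 and 2.\<close>
        have "D (2::2) = D 0" by (rule arg_cong) simp
        then show ?thesis by (simp add: matrix_matrix_mult_def K_def sum_2 \<sigma>_def)
      qed
      also have "\<dots> = e l $ 1 * fract_pd 1 (X q) + e l $ 2 * fract_pd 2 (X q) + e l $ 3 * fract_pd 3 (X q)"
        unfolding Me D_def by (simp add: \<sigma>_def algebra_simps)
      also have "\<dots> = (\<Sum>k\<in>UNIV. fract_pd k (chart_vars v X (col q)) * P $ k $ col l)"
        using P(2) col by (simp add: sum_4' e_def mult.commute)
      also have "\<dots> = of_bool (col q = col l)" using P(3) by blast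
      also have "\<dots> = mat 1 $ l $ q" unfolding col(4) by (auto simp: mat_def of_bool_def)
      finally show ?thesis .
    qed
    then have "K ** (\<chi> i j. D i (X j)) = mat 1" by (simp add: vec_eq_iff)
    then have "(\<chi> i j. D i (X j)) ** K = mat 1" by (rule matrix_left_right_inverse[THEN iffD1])
    moreover have "K $ i $ j \<in> loc A_ring f" for i j
    proof -
      have "f \<in> A_ring" using f(1) base_subset_A by blast
      note s = subringsetD[OF subringset_loc[OF subringset_A this]]
      have "e i $ m \<in> loc A_ring f" for m
      proof -
        have "\<forall>m. e i $ m \<in> loc A_ring f" unfolding forall_3 using P(1) by (simp add: e_def)
        then show ?thesis by blast
      qed
      moreover have "emb p \<in> loc A_ring f" for p by (rule subsetD[OF loc_base rangeI])
      ultimately show ?thesis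
        unfolding K_def n_def matrix_vector_mult_def by (simp add: map_mat_def sum_3 s)
    qed
    ultimately show "\<exists>N. (\<forall>i j. N $ i $ j \<in> loc A_ring f) \<and> (\<chi> i j. D i (X j)) ** N = mat 1" by blast
  qed
  then show thesis by (rule that)
qed

text \<open>Two ideals that lie in no prime. Each chart puts a power of its function into the ideal
  of the gradient, so the gradient is unimodular and a frame exists. With the frame, the functions
  that admit a chart form an ideal, so there is a chart over 1.\<close>

lemma global_chart:
  assumes inj_h: "inj (comorphism_xv v)"
    and cover: "\<And>P. primeset P \<Longrightarrow> \<exists>r X. r \<notin> P \<and> chart (base_ring v) A_ring (emb (comorphism_xv v r)) (X :: 2 \<Rightarrow> A4fract)"
  shows "\<exists>X :: 2 \<Rightarrow> A4fract. chart (base_ring v) A_ring 1 X"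
proof -
  let ?h = "comorphism_xv v"
  note h = rhom_comorphism[of v]
  have inj: "r = 0" if "?h r = 0" for r using that injD[OF inj_h, of r 0] by (simp add: rhom_0[OF h])
  define G where "G = {a. \<exists>e. a = (\<Sum>i\<in>UNIV. grad v $ i * e $ i)}"
  have "idealset G"
    unfolding idealset_def
  proof (intro conjI ballI allI)
    show "0 \<in> G" by (auto simp: G_def intro!: exI[of _ 0])
    fix a assume "a \<in> G"
    then obtain e where e: "a = (\<Sum>i\<in>UNIV. grad v $ i * e $ i)" by (auto simp: G_def)
    have "s * a = (\<Sum>i\<in>UNIV. grad v $ i * (\<chi> i. s * e $ i) $ i)" for s
      by (simp add: e sum_distrib_left mult.left_commute)
    then show "s * a \<in> G" for s unfolding G_def by blast
    fix b assume "b \<in> G"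
    then obtain e' where e': "b = (\<Sum>i\<in>UNIV. grad v $ i * e' $ i)" by (auto simp: G_def)
    have "a + b = (\<Sum>i\<in>UNIV. grad v $ i * (e + e') $ i)"
      by (simp add: e e' distrib_left sum.distrib)
    then show "a + b \<in> G" unfolding G_def by blast
  qed
  moreover have "\<not> G \<subseteq> P" if P: "primeset P" for P
  proof
    assume GP: "G \<subseteq> P"
    obtain r X where r: "r \<notin> {r. ?h r \<in> P}" "chart (base_ring v) A_ring (emb (?h r)) (X :: 2 \<Rightarrow> A4fract)"
      using cover[OF primeset_vimage[OF h P]] by blast
    have "?h r \<noteq> 0" using r(1) idealsetD(1)[OF primesetD(1)[OF P]] by auto
    then obtain n e where "?h r ^ n = (\<Sum>i\<in>UNIV. grad v $ i * e $ i)"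
      using chart_gradient[OF _ r(2)] by auto
    then have "?h r ^ n \<in> P" using GP by (auto simp: G_def)
    then show False using primesetD(5)[OF P] r(1) by blast
  qed
  ultimately have "1 \<in> G" by (rule idealset_unit)
  then have "unimodular (grad v)" unfolding G_def unimodular_def by (auto intro: sym)
  then obtain D :: "2 \<Rightarrow> A4fract \<Rightarrow> A4fract" where D: "jacobian_frame (base_ring v) A_ring D"
    by (rule jacobian_frame_exists)
  \<comment> \<open>Zero is added by hand: localizing at 0 gives the whole field, and a sum of two
    functions with charts may vanish.\<close>
  define J where "J = {r. r = 0 \<or> (\<exists>X :: 2 \<Rightarrow> A4fract. chart (base_ring v) A_ring (emb (?h r)) X)}"
  note SA = subringset_base[of v] subringset_A base_subset_A
  have e: "emb (?h (a + b)) = emb (?h a) + emb (?h b)" "emb (?h (a * b)) = emb (?h a) * emb (?h b)" for a b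
    by (simp_all add: rhom_simps[OF h] rhom_simps[OF rhom_emb])
  have "idealset J"
    unfolding idealset_def
  proof (intro conjI ballI allI)
    show "0 \<in> J" by (simp add: J_def)
    fix a assume a: "a \<in> J"
    show "r * a \<in> J" for r
    proof (cases "a = 0")
      case False
      then obtain X :: "2 \<Rightarrow> A4fract" where "chart (base_ring v) A_ring (emb (?h a)) X"
        using a by (auto simp: J_def)
      then have "chart (base_ring v) A_ring (emb (?h r) * emb (?h a)) X"
        by (intro chart_mult[OF SA]) auto
      then show ?thesis by (auto simp: J_def e)
    qed (simp add: J_def)
    fix b assume b: "b \<in> J"
    show "a + b \<in> J"
    proof (cases "a = 0 \<or> b = 0 \<or> a + b = 0")
      case False
      then obtain X Y :: "2 \<Rightarrow> A4fract" where X: "chart (base_ring v) A_ring (emb (?h a)) X"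
        and Y: "chart (base_ring v) A_ring (emb (?h b)) Y"
        using a b by (auto simp: J_def)
      have nz: "emb (?h a) \<noteq> 0" "emb (?h b) \<noteq> 0" "emb (?h a) + emb (?h b) \<noteq> 0"
        using False inj by (auto simp flip: e)
      obtain Z :: "2 \<Rightarrow> A4fract" where "chart (base_ring v) A_ring (emb (?h a) + emb (?h b)) Z"
        by (rule chart_add[OF SA D rangeI nz(1) X rangeI nz(2) Y nz(3)])
      then show ?thesis by (auto simp: J_def e)
    qed (use a b in \<open>auto simp: J_def\<close>)
  qed
  moreover have "\<not> J \<subseteq> P" if "primeset P" for P
    using cover[OF that] by (auto simp: J_def)
  ultimately have "1 \<in> J" by (rule idealset_unit)
  then show ?thesis by (simp add: J_def rhom_1[OF h] rhom_1[OF rhom_emb])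
qed

section \<open>Spectra of integral domains\<close>

lemma type_ring_simps [simp]:
  "carrier type_ring = UNIV" "x \<otimes>\<^bsub>type_ring\<^esub> y = x * y" "\<one>\<^bsub>type_ring\<^esub> = 1"
  "x \<oplus>\<^bsub>type_ring\<^esub> y = x + y" "\<zero>\<^bsub>type_ring\<^esub> = 0"
  by (simp_all add: ring_of_type_algebra_def)

lemma primeideal_type_ring: "primeideal P (type_ring :: 'a::comm_ring_1 ring) \<longleftrightarrow> primeset P"
proof
  assume "primeideal P (type_ring :: 'a ring)"
  then interpret P: primeideal P "type_ring :: 'a ring" .
  show "primeset P"
    unfolding primeset_def idealset_def
  proof (intro conjI ballI allI impI)
    show "0 \<in> P" using additive_subgroup.zero_closed[OF P.is_additive_subgroup] by simp
    show "a + b \<in> P" if "a \<in> P" "b \<in> P" for a b using additive_subgroup.a_closed[OF P.is_additive_subgroup that] by simp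
    show "r * a \<in> P" if "a \<in> P" for a r using P.I_l_closed[OF that, of r] by simp
    show "1 \<notin> P" using P.I_notcarr P.one_imp_carrier by auto
    show "a \<in> P \<or> b \<in> P" if "a * b \<in> P" for a b using P.I_prime[of a b] that by simp
  qed
next
  assume P: "primeset P"
  note i = idealsetD[OF primesetD(1)[OF P]]
  have cr: "cring (type_ring :: 'a ring)" by (rule cring_from_type_algebra)
  interpret cring "type_ring :: 'a ring" by (rule cr)
  have neg: "\<ominus>\<^bsub>type_ring\<^esub> a = - a" for a :: 'a
    by (rule minus_equality) simp_all
  have "ideal P (type_ring :: 'a ring)"
  proof (rule idealI)
    show "ring (type_ring :: 'a ring)" by (rule ring_from_type_algebra)
    show "subgroup P (add_monoid (type_ring :: 'a ring))"
      by (rule add.subgroupI) (use i in \<open>auto simp: neg a_inv_def[symmetric]\<close>)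
  qed (use i in auto)
  then show "primeideal P (type_ring :: 'a ring)"
  proof (rule primeidealI)
    show "carrier type_ring \<noteq> P" using primesetD(2)[OF P] by auto
  qed (use cr primesetD(3)[OF P] in auto)
qed

section \<open>Fractions and stalks at the primes of a domain\<close>

abbreviation fr :: "'a::comm_ring_1 set \<Rightarrow> 'a \<Rightarrow> 'a \<Rightarrow> ('a \<times> 'a) set" where
  "fr \<equiv> fraction type_ring"

abbreviation stalkT :: "'a::comm_ring_1 set \<Rightarrow> ('a \<times> 'a) set ring" where
  "stalkT \<equiv> local_ring_at type_ring"

text \<open>In a domain the extra multiplier in the definition of a fraction cancels.\<close>

lemma fr_def':
  fixes P :: "'a::idom set"
  assumes "primeset P"
  shows "fr P a s = {(b, t). t \<notin> P \<and> a * t = b * s}"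
proof -
  have "(\<exists>u. u \<notin> P \<and> u * (a * t) = u * (b * s)) \<longleftrightarrow> a * t = b * s" for b t
    using primesetD(2)[OF assms] idealsetD(1)[OF primesetD(1)[OF assms]] by auto
  then show ?thesis unfolding fraction_def by (auto simp: Bex_def)
qed

lemma fr_eqI:
  fixes P :: "'a::idom set"
  assumes P: "primeset P" and "s \<notin> P" "t \<notin> P" "a * t = b * s"
  shows "fr P a s = fr P b t"
proof -
  have "s \<noteq> 0" "t \<noteq> 0" using assms idealsetD(1)[OF primesetD(1)[OF P]] by auto
  then have "a * d = c * s \<longleftrightarrow> b * d = c * t" for c d
  proof -
    have "a * d = c * s \<longleftrightarrow> (a * d) * t = (c * s) * t" using \<open>t \<noteq> 0\<close> by simp
    also have "(a * d) * t = (a * t) * d" by (simp add: mult_ac)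
    also have "\<dots> = (b * d) * s" unfolding assms(4) by (simp add: mult_ac)
    also have "(c * s) * t = (c * t) * s" by (simp add: mult_ac)
    finally show ?thesis using \<open>s \<noteq> 0\<close> by simp
  qed
  then show ?thesis by (simp add: fr_def'[OF P])
qed

text \<open>Operations on fractions are unions over representatives; such a union collapses when its
  term does not depend on the representative.\<close>

lemma fr_UN:
  fixes P :: "'a::idom set"
  assumes P: "primeset P" and s: "s \<notin> P"
    and eq: "\<And>b t. t \<notin> P \<Longrightarrow> a * t = b * s \<Longrightarrow> F b t = F a s"
  shows "(\<Union>(b, t)\<in>fr P a s. F b t) = F a s"
proof (rule SUP_eq_const)
  show "fr P a s \<noteq> {}" using s by (auto simp: fr_def'[OF P])
  fix p assume "p \<in> fr P a s"
  then obtain b t where "p = (b, t)" "t \<notin> P" "a * t = b * s" by (auto simp: fr_def'[OF P])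
  then show "(case p of (b, t) \<Rightarrow> F b t) = F a s" using eq by simp
qed

lemma stalk_carrier: "carrier (stalkT P) = {fr P a s | a s. s \<notin> P}"
  by (simp add: local_ring_at_def)

lemma stalk_one: "\<one>\<^bsub>stalkT P\<^esub> = fr P 1 1"
  by (simp add: local_ring_at_def)

lemma stalk_mult:
  fixes P :: "'a::idom set"
  assumes P: "primeset P" and "s \<notin> P" "t \<notin> P"
  shows "fr P a s \<otimes>\<^bsub>stalkT P\<^esub> fr P b t = fr P (a * b) (s * t)"
proof -
  have *: "fr P (a' * b') (s' * t') = fr P (a * b) (s * t)"
    if "s' \<notin> P" "a * s' = a' * s" "t' \<notin> P" "b * t' = b' * t" for a' s' b' t'
  proof (rule fr_eqI[OF P])
    show "s' * t' \<notin> P" "s * t \<notin> P" using that assms primesetD(4)[OF P] by blast+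
    have "a' * b' * (s * t) = (a' * s) * (b' * t)" by (simp add: mult_ac)
    also have "\<dots> = a * b * (s' * t')" by (simp add: that(2,4)[symmetric] mult_ac)
    finally show "a' * b' * (s * t) = a * b * (s' * t')" .
  qed
  have "fr P a s \<otimes>\<^bsub>stalkT P\<^esub> fr P b t =
      (\<Union>(a', s')\<in>fr P a s. \<Union>(b', t')\<in>fr P b t. fr P (a' * b') (s' * t'))"
    by (simp add: local_ring_at_def)
  also have "\<dots> = fr P (a * b) (s * t)"
  proof (rule fr_UN[OF P assms(2), of a "\<lambda>a' s'. \<Union>(b', t')\<in>fr P b t. fr P (a' * b') (s' * t')", THEN trans])
    have inner: "(\<Union>(b', t')\<in>fr P b t. fr P (a' * b') (s' * t')) = fr P (a * b) (s * t)"
      if "s' \<notin> P" "a * s' = a' * s" for a' s'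
    proof -
      have "(\<Union>(b', t')\<in>fr P b t. fr P (a' * b') (s' * t')) = fr P (a' * b) (s' * t)"
        by (rule fr_UN[OF P assms(3)]) (use *[OF that] assms(3) in simp)
      then show ?thesis using *[OF that assms(3) refl] by simp
    qed
    show "(\<Union>(b', t')\<in>fr P b t. fr P (a * b') (s * t')) = fr P (a * b) (s * t)"
      by (rule inner[OF assms(2) refl])
    show "(\<Union>(b', t')\<in>fr P b t. fr P (a' * b') (s' * t')) = (\<Union>(b', t')\<in>fr P b t. fr P (a * b') (s * t'))"
      if "s' \<notin> P" "a * s' = a' * s" for a' s'
      unfolding inner[OF that] inner[OF assms(2) refl] ..
  qed
  finally show ?thesis .
qed

lemma stalk_add:
  fixes P :: "'a::idom set"
  assumes P: "primeset P" and "s \<notin> P" "t \<notin> P"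
  shows "fr P a s \<oplus>\<^bsub>stalkT P\<^esub> fr P b t = fr P (a * t + b * s) (s * t)"
proof -
  have *: "fr P (a' * t' + b' * s') (s' * t') = fr P (a * t + b * s) (s * t)"
    if "s' \<notin> P" "a * s' = a' * s" "t' \<notin> P" "b * t' = b' * t" for a' s' b' t'
  proof (rule fr_eqI[OF P])
    show "s' * t' \<notin> P" "s * t \<notin> P" using that assms primesetD(4)[OF P] by blast+
    have "(a' * t' + b' * s') * (s * t) = (a' * s) * (t' * t) + (b' * t) * (s' * s)"
      by (simp add: algebra_simps)
    also have "\<dots> = (a * t + b * s) * (s' * t')"
      by (simp add: that(2,4)[symmetric] algebra_simps)
    finally show "(a' * t' + b' * s') * (s * t) = (a * t + b * s) * (s' * t')" .
  qed
  have "fr P a s \<oplus>\<^bsub>stalkT P\<^esub> fr P b t =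
      (\<Union>(a', s')\<in>fr P a s. \<Union>(b', t')\<in>fr P b t. fr P (a' * t' + b' * s') (s' * t'))"
    by (simp add: local_ring_at_def)
  also have "\<dots> = fr P (a * t + b * s) (s * t)"
  proof (rule fr_UN[OF P assms(2), of a "\<lambda>a' s'. \<Union>(b', t')\<in>fr P b t. fr P (a' * t' + b' * s') (s' * t')", THEN trans])
    have inner: "(\<Union>(b', t')\<in>fr P b t. fr P (a' * t' + b' * s') (s' * t')) = fr P (a * t + b * s) (s * t)"
      if "s' \<notin> P" "a * s' = a' * s" for a' s'
    proof -
      have "(\<Union>(b', t')\<in>fr P b t. fr P (a' * t' + b' * s') (s' * t')) = fr P (a' * t + b * s') (s' * t)"
        by (rule fr_UN[OF P assms(3)]) (use *[OF that] assms(3) in simp)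
      then show ?thesis using *[OF that assms(3) refl] by simp
    qed
    show "(\<Union>(b', t')\<in>fr P b t. fr P (a * t' + b' * s) (s * t')) = fr P (a * t + b * s) (s * t)"
      by (rule inner[OF assms(2) refl])
    show "(\<Union>(b', t')\<in>fr P b t. fr P (a' * t' + b' * s') (s' * t')) =
        (\<Union>(b', t')\<in>fr P b t. fr P (a * t' + b' * s) (s * t'))"
      if "s' \<notin> P" "a * s' = a' * s" for a' s'
      unfolding inner[OF that] inner[OF assms(2) refl] ..
  qed
  finally show ?thesis .
qed

lemma stalk_Units:
  fixes P :: "'a::idom set"
  assumes P: "primeset P" and s: "s \<notin> P"
  shows "fr P a s \<in> Units (stalkT P) \<longleftrightarrow> a \<notin> P"
proof
  note i = idealsetD[OF primesetD(1)[OF P]]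
  assume "fr P a s \<in> Units (stalkT P)"
  then obtain b t where "t \<notin> P" "fr P b t \<otimes>\<^bsub>stalkT P\<^esub> fr P a s = fr P 1 1"
    unfolding Units_def stalk_carrier stalk_one by blast
  then have "fr P (b * a) (t * s) = fr P 1 1" by (simp add: stalk_mult[OF P _ s])
  moreover have "(1, 1) \<in> fr P 1 1" using primesetD(2)[OF P] by (simp add: fr_def'[OF P])
  ultimately have "(1, 1) \<in> fr P (b * a) (t * s)" by simp
  then have "b * a = t * s" by (simp add: fr_def'[OF P])
  then show "a \<notin> P" using primesetD(4)[OF P \<open>t \<notin> P\<close> s] i(3) by metis
next
  assume a: "a \<notin> P"
  have "fr P (s * a) (a * s) = fr P 1 1" "fr P (a * s) (s * a) = fr P 1 1"
    by (rule fr_eqI[OF P], use primesetD(2)[OF P] primesetD(4)[OF P] a s in \<open>simp_all add: mult.commute\<close>)+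
  then have "fr P s a \<otimes>\<^bsub>stalkT P\<^esub> fr P a s = fr P 1 1" "fr P a s \<otimes>\<^bsub>stalkT P\<^esub> fr P s a = fr P 1 1"
    by (simp_all add: stalk_mult[OF P a s] stalk_mult[OF P s a])
  then show "fr P a s \<in> Units (stalkT P)"
    unfolding Units_def stalk_carrier stalk_one using a s by blast
qed

text \<open>The same fraction is a different set of pairs at each prime. Its value in the fraction
  field makes germs at different points comparable.\<close>

definition germ_value :: "('a::idom \<times> 'a) set \<Rightarrow> 'a fract" where
  "germ_value X = (let (a, s) = (SOME p. p \<in> X) in Fract a s)"

lemma germ_value_fr:
  assumes P: "primeset P" and s: "s \<notin> P"
  shows "germ_value (fr P a s) = Fract a s"
proof -
  have 0: "0 \<in> P" by (rule idealsetD(1)[OF primesetD(1)[OF P]])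
  have "(a, s) \<in> fr P a s" using s by (simp add: fr_def'[OF P])
  then have "(SOME p. p \<in> fr P a s) \<in> fr P a s" by (rule someI)
  then obtain b t where bt: "(SOME p. p \<in> fr P a s) = (b, t)" "t \<notin> P" "a * t = b * s"
    by (auto simp: fr_def'[OF P])
  then have "Fract b t = Fract a s" using 0 s by (subst eq_fract) auto
  then show ?thesis using bt by (simp add: germ_value_def)
qed

section \<open>The Zariski topology\<close>

definition basic_open :: "'a::comm_ring_1 \<Rightarrow> 'a set set" where
  "basic_open f = {P. primeset P \<and> f \<notin> P}"

lemma zariski_def': "zariski type_ring = topology_generated_by (range (basic_open :: 'a::comm_ring_1 \<Rightarrow> _))"
  unfolding zariski_def basic_open_def primeideal_type_ring by (rule arg_cong[of _ _ topology_generated_by]) auto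

lemma openin_basic_open: "openin (zariski type_ring) (basic_open f)"
  unfolding zariski_def' by (rule topology_generated_by_Basis) simp

lemma topspace_zariski: "topspace (zariski type_ring) = {P. primeset P}"
  unfolding zariski_def' topology_generated_by_topspace
  by (auto simp: basic_open_def intro!: exI[of _ 1] dest: primesetD(2))

text \<open>Intersections of two basic open sets are basic, so the generating sets form a
  basis.\<close>

lemma zariski_basis:
  fixes U :: "'a::comm_ring_1 set set"
  assumes "openin (zariski type_ring) U" "P \<in> U"
  obtains f where "f \<notin> P" "P \<in> basic_open f" "basic_open f \<subseteq> U"
proof -
  have "generate_topology_on (range basic_open) U"
    using assms(1) unfolding zariski_def' openin_topology_generated_by_iff .
  then have "\<forall>P\<in>U. \<exists>f. P \<in> basic_open f \<and> basic_open f \<subseteq> U"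
  proof (induction rule: generate_topology_on.induct)
    case (Int U V)
    show ?case
    proof
      fix P assume "P \<in> U \<inter> V"
      then obtain f g where *: "P \<in> basic_open f" "basic_open f \<subseteq> U" "P \<in> basic_open g" "basic_open g \<subseteq> V"
        using Int.IH by blast
      have "basic_open (f * g) \<subseteq> basic_open f \<inter> basic_open g"
        by (auto simp: basic_open_def dest: primesetD(1) intro: idealsetD(3,4))
      moreover have "P \<in> basic_open (f * g)" using * by (auto simp: basic_open_def dest: primesetD(3))
      ultimately show "\<exists>f. P \<in> basic_open f \<and> basic_open f \<subseteq> U \<inter> V" using * by blast
    qed
  next
    case (UN K)
    then show ?case by (meson Union_iff Sup_upper subset_trans)
  qed auto
  then obtain f where "P \<in> basic_open f" "basic_open f \<subseteq> U" using assms(2) by blast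
  then show thesis using that[of f] by (simp add: basic_open_def)
qed

lemma Spec_simps [simp]:
  "space_top (Spec R) = zariski R" "stalk (Spec R) = local_ring_at R"
  by (simp_all add: Spec_def)

lemma open_subspace_simps [simp]:
  "space_top (open_subspace X U) = subtopology (space_top X) U" "stalk (open_subspace X U) = stalk X"
  "sections (open_subspace X U) = sections X"
  by (simp_all add: open_subspace_def)

lemma points_SpecT: "points SpecT = {P. primeset P}"
  by (simp add: topspace_zariski)

lemma sections_SpecT:
  "s \<in> sections SpecT U \<longleftrightarrow> s \<in> extensional U \<and>
    (\<forall>P\<in>U. \<exists>V a b. openin (zariski type_ring) V \<and> P \<in> V \<and> V \<subseteq> U \<and> (\<forall>Q\<in>V. b \<notin> Q \<and> s Q = fr Q a b))"
  by (simp add: Spec_def)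

section \<open>Morphisms induced by ring homomorphisms\<close>

lemma point_SpecT_map [simp]: "point (SpecT_map h) Q = {a. h a \<in> Q}"
  by (simp add: Spec_map_def)

lemma costalk_SpecT_map:
  fixes h :: "'a::idom \<Rightarrow> 'b::idom"
  assumes h: "rhom h" and Q: "primeset Q" and s: "h s \<notin> Q"
  shows "costalk (SpecT_map h) Q (fr {a. h a \<in> Q} a s) = fr Q (h a) (h s)"
proof -
  have P: "primeset {a. h a \<in> Q}" by (rule primeset_vimage[OF h Q])
  have "(\<Union>(b, t)\<in>fr {a. h a \<in> Q} a s. fr Q (h b) (h t)) = fr Q (h a) (h s)"
  proof (rule fr_UN[OF P])
    show "fr Q (h b) (h t) = fr Q (h a) (h s)" if "t \<notin> {a. h a \<in> Q}" "a * t = b * s" for b t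
    proof (rule fr_eqI[OF Q])
      have "h (b * s) = h (a * t)" using that(2) by simp
      then show "h b * h s = h a * h t" by (simp add: rhom_mult[OF h])
    qed (use that s in auto)
  qed (use s in simp)
  then show ?thesis by (simp add: Spec_map_def)
qed

lemma openin_vimage_SpecT_map:
  assumes h: "rhom h" and V: "openin (zariski type_ring) V"
  shows "openin (zariski type_ring) {P. primeset P \<and> {a. h a \<in> P} \<in> V}"
proof (subst openin_subopen, intro ballI)
  fix P assume "P \<in> {P. primeset P \<and> {a. h a \<in> P} \<in> V}"
  then have P: "primeset P" "{a. h a \<in> P} \<in> V" by auto
  obtain f where f: "f \<notin> {a. h a \<in> P}" "basic_open f \<subseteq> V" by (rule zariski_basis[OF V P(2)])
  have "basic_open (h f) \<subseteq> {P. primeset P \<and> {a. h a \<in> P} \<in> V}"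
    using f(2) primeset_vimage[OF h] by (auto simp: basic_open_def)
  moreover have "P \<in> basic_open (h f)" using f(1) P(1) by (simp add: basic_open_def)
  ultimately show "\<exists>T. openin (zariski type_ring) T \<and> P \<in> T \<and> T \<subseteq> {P. primeset P \<and> {a. h a \<in> P} \<in> V}"
    using openin_basic_open by blast
qed

lemma vimage_in_SpecT: "vimage_in SpecT (SpecT_map h) U = {P. primeset P \<and> {a. h a \<in> P} \<in> U}"
  by (simp add: vimage_in_def topspace_zariski)

lemma morphism_SpecT_map:
  fixes h :: "'a::idom \<Rightarrow> 'b::idom"
  assumes h: "rhom h" and U: "openin (zariski type_ring) U" and W: "openin (zariski type_ring) W"
    and WU: "\<And>P. P \<in> W \<Longrightarrow> {a. h a \<in> P} \<in> U"
  shows "morphism (open_subspace SpecT W) (open_subspace SpecT U) (SpecT_map h)"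
proof -
  let ?X = "open_subspace SpecT W" and ?f = "SpecT_map h"
  have Wp: "primeset P" if "P \<in> W" for P using openin_subset[OF W] that by (auto simp: topspace_zariski)
  have vim: "vimage_in ?X ?f V = {P. primeset P \<and> {a. h a \<in> P} \<in> V} \<inter> W" for V
    by (auto simp: vimage_in_def topspace_zariski)
  have openV: "openin (zariski type_ring) V" if "openin (subtopology (zariski type_ring) U) V" for V :: "'a set set"
    using that U openin_trans_full by blast
  show ?thesis
    unfolding morphism_def
  proof (intro conjI ballI allI impI)
    show "continuous_map (space_top ?X) (space_top (open_subspace SpecT U)) (point ?f)"
      unfolding open_subspace_simps Spec_simps
    proof (rule continuous_map_into_subtopology)
      show "continuous_map (subtopology (zariski type_ring) W) (zariski type_ring) (point ?f)"
        unfolding continuous_map_def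
      proof (intro conjI allI impI)
        show "point ?f \<in> topspace (subtopology (zariski type_ring) W) \<rightarrow> topspace (zariski type_ring)"
          using primeset_vimage[OF h] by (auto simp: topspace_zariski)
        fix V :: "'a set set" assume V: "openin (zariski type_ring) V"
        have "{x \<in> topspace (subtopology (zariski type_ring) W). point ?f x \<in> V} =
            {P. primeset P \<and> {a. h a \<in> P} \<in> V} \<inter> W"
          by (auto simp: topspace_zariski)
        then show "openin (subtopology (zariski type_ring) W) {x \<in> topspace (subtopology (zariski type_ring) W). point ?f x \<in> V}"
          using openin_vimage_SpecT_map[OF h V] by (auto simp: openin_subtopology)
      qed
      show "point ?f \<in> topspace (subtopology (zariski type_ring) W) \<rightarrow> U" using WU by (auto simp: topspace_zariski)
    qed
  next
    fix Q assume "Q \<in> points ?X"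
    then have Q: "primeset Q" by (simp add: topspace_zariski)
    let ?P = "{a. h a \<in> Q}"
    have P: "primeset ?P" by (rule primeset_vimage[OF h Q])
    note c = costalk_SpecT_map[OF h Q]
    show "costalk ?f Q \<in> ring_hom (stalk (open_subspace SpecT U) (point ?f Q)) (stalk ?X Q)"
    proof (rule ring_hom_memI)
      show "costalk ?f Q x \<in> carrier (stalk ?X Q)" if "x \<in> carrier (stalk (open_subspace SpecT U) (point ?f Q))" for x
        using that by (auto simp: stalk_carrier c) blast
      show "costalk ?f Q \<one>\<^bsub>stalk (open_subspace SpecT U) (point ?f Q)\<^esub> = \<one>\<^bsub>stalk ?X Q\<^esub>"
        using c[of 1 1] primesetD(2)[OF Q] by (simp add: stalk_one rhom_1[OF h])
      fix x y
      assume "x \<in> carrier (stalk (open_subspace SpecT U) (point ?f Q))"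
        "y \<in> carrier (stalk (open_subspace SpecT U) (point ?f Q))"
      then obtain a s b t where *: "x = fr ?P a s" "y = fr ?P b t" "s \<notin> ?P" "t \<notin> ?P"
        by (auto simp: stalk_carrier)
      have st: "s * t \<notin> ?P" by (rule primesetD(4)[OF P *(3,4)])
      show "costalk ?f Q (x \<otimes>\<^bsub>stalk (open_subspace SpecT U) (point ?f Q)\<^esub> y) =
          costalk ?f Q x \<otimes>\<^bsub>stalk ?X Q\<^esub> costalk ?f Q y"
        using * st by (simp add: stalk_mult[OF P] stalk_mult[OF Q] c rhom_mult[OF h])
      show "costalk ?f Q (x \<oplus>\<^bsub>stalk (open_subspace SpecT U) (point ?f Q)\<^esub> y) =
          costalk ?f Q x \<oplus>\<^bsub>stalk ?X Q\<^esub> costalk ?f Q y"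
        using * st by (simp add: stalk_add[OF P] stalk_add[OF Q] c rhom_mult[OF h] rhom_add[OF h])
    qed
    show "x \<in> Units (stalk (open_subspace SpecT U) (point ?f Q))"
      if x: "x \<in> carrier (stalk (open_subspace SpecT U) (point ?f Q))" "costalk ?f Q x \<in> Units (stalk ?X Q)" for x
    proof -
      obtain a s where "x = fr ?P a s" "s \<notin> ?P" using x(1) by (auto simp: stalk_carrier)
      then show ?thesis using x(2) by (simp add: c stalk_Units[OF P] stalk_Units[OF Q])
    qed
  next
    fix V t
    assume V: "openin (space_top (open_subspace SpecT U)) V" and t: "t \<in> sections (open_subspace SpecT U) V"
    have V': "openin (zariski type_ring) V" using V openV by simp
    show "(\<lambda>p\<in>vimage_in ?X ?f V. costalk ?f p (t (point ?f p))) \<in> sections ?X (vimage_in ?X ?f V)"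
      unfolding open_subspace_simps sections_SpecT
    proof (intro conjI ballI)
      fix Q assume "Q \<in> vimage_in ?X ?f V"
      then have Q: "primeset Q" "{a. h a \<in> Q} \<in> V" "Q \<in> W" by (auto simp: vim)
      then obtain V1 a b where V1: "openin (zariski type_ring) V1" "{a. h a \<in> Q} \<in> V1" "V1 \<subseteq> V"
        "\<And>P. P \<in> V1 \<Longrightarrow> b \<notin> P \<and> t P = fr P a b"
        using t unfolding open_subspace_simps sections_SpecT by meson
      let ?V = "{P. primeset P \<and> {a. h a \<in> P} \<in> V1} \<inter> W"
      have "openin (zariski type_ring) ?V" by (intro openin_Int openin_vimage_SpecT_map h V1 W)
      moreover have "Q \<in> ?V" "?V \<subseteq> vimage_in ?X ?f V" using Q V1 by (auto simp: vim)
      moreover have "h b \<notin> P \<and> (\<lambda>p\<in>vimage_in ?X ?f V. costalk ?f p (t (point ?f p))) P = fr P (h a) (h b)"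
        if "P \<in> ?V" for P
      proof -
        have "b \<notin> {a. h a \<in> P}" "t {a. h a \<in> P} = fr {a. h a \<in> P} a b" using V1(4) that by auto
        moreover have "P \<in> vimage_in ?X ?f V" using that V1(3) by (auto simp: vim)
        ultimately show ?thesis using that by (simp add: costalk_SpecT_map[OF h])
      qed
      ultimately show "\<exists>V' a b. openin (zariski type_ring) V' \<and> Q \<in> V' \<and> V' \<subseteq> vimage_in ?X ?f V \<and>
          (\<forall>P\<in>V'. b \<notin> P \<and> (\<lambda>p\<in>vimage_in ?X ?f V. costalk ?f p (t (point ?f p))) P = fr P a b)"
        by blast
    qed simp
  qed
qed

lemma eq_map_SpecT_comp:
  fixes k :: "'a::idom \<Rightarrow> 'b::idom" and l :: "'b \<Rightarrow> 'c::idom" and m :: "'a \<Rightarrow> 'c"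
  assumes "rhom k" "rhom l" "\<And>a. l (k a) = m a"
  shows "eq_map (open_subspace SpecT W) (open_subspace SpecT U) (comp_map (SpecT_map k) (SpecT_map l)) (SpecT_map m)"
proof -
  have m: "rhom m" using rhom_comp[OF assms(2,1)] by (simp add: assms(3))
  show ?thesis
    unfolding eq_map_def
  proof (intro ballI conjI)
    fix Q assume "Q \<in> points (open_subspace SpecT W)"
    then have Q: "primeset Q" by (simp add: topspace_zariski)
    have P: "primeset {b. l b \<in> Q}" by (rule primeset_vimage[OF assms(2) Q])
    show "point (comp_map (SpecT_map k) (SpecT_map l)) Q = point (SpecT_map m) Q"
      by (simp add: comp_map_def assms(3))
    fix x assume "x \<in> carrier (stalk (open_subspace SpecT U) (point (comp_map (SpecT_map k) (SpecT_map l)) Q))"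
    then obtain a s where x: "x = fr {a. m a \<in> Q} a s" "m s \<notin> Q"
      by (auto simp: stalk_carrier comp_map_def assms(3))
    have "costalk (SpecT_map k) {b. l b \<in> Q} (fr {a. k a \<in> {b. l b \<in> Q}} a s) = fr {b. l b \<in> Q} (k a) (k s)"
      using x(2) by (intro costalk_SpecT_map[OF assms(1) P]) (simp add: assms(3))
    moreover have "{a. k a \<in> {b. l b \<in> Q}} = {a. m a \<in> Q}" by (simp add: assms(3))
    ultimately have "costalk (comp_map (SpecT_map k) (SpecT_map l)) Q x =
        costalk (SpecT_map l) Q (fr {b. l b \<in> Q} (k a) (k s))"
      by (simp add: comp_map_def x(1))
    also have "\<dots> = fr Q (m a) (m s)"
      using x(2) by (subst costalk_SpecT_map[OF assms(2) Q]) (simp_all add: assms(3))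
    also have "\<dots> = costalk (SpecT_map m) Q x"
      unfolding x(1) by (rule costalk_SpecT_map[OF m Q x(2), symmetric])
    finally show "costalk (comp_map (SpecT_map k) (SpecT_map l)) Q x = costalk (SpecT_map m) Q x" .
  qed
qed

lemma eq_map_SpecT_id:
  "eq_map (open_subspace SpecT W) (open_subspace SpecT U) (SpecT_map (\<lambda>a::'a::idom. a)) id_map"
  unfolding eq_map_def
proof (intro ballI conjI)
  fix Q :: "'a set" assume "Q \<in> points (open_subspace SpecT W)"
  then have Q: "primeset Q" by (simp add: topspace_zariski)
  show "point (SpecT_map (\<lambda>a. a)) Q = point id_map Q" by (simp add: id_map_def)
  fix x assume "x \<in> carrier (stalk (open_subspace SpecT U) (point (SpecT_map (\<lambda>a. a)) Q))"
  then obtain a s where "x = fr Q a s" "s \<notin> Q" by (auto simp: stalk_carrier)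
  then show "costalk (SpecT_map (\<lambda>a. a)) Q x = costalk id_map Q x"
    using costalk_SpecT_map[OF rhom_id Q, of s a] by (simp add: id_map_def)
qed

lemma eq_map_trans: "eq_map X Y f g \<Longrightarrow> eq_map X Y g k \<Longrightarrow> eq_map X Y f k"
  unfolding eq_map_def by metis

text \<open>An isomorphism of algebras over the base induces mutually inverse morphisms over every
  open set of the base.\<close>

lemma trivial_plane_bundle_of_iso:
  fixes h :: "'r::idom \<Rightarrow> 'a::idom" and \<theta> :: "(2, 'r) mpoly \<Rightarrow> 'a"
  assumes h: "rhom h" and \<theta>: "rhom \<theta>" "rhom \<theta>'" "\<And>a. \<theta> (\<theta>' a) = a" "\<And>q. \<theta>' (\<theta> q) = q"
    and \<theta>h: "\<And>r. \<theta> (Const r) = h r" and U: "openin (zariski type_ring) U"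
  shows "trivial_plane_bundle U (open_subspace SpecT (vimage_in SpecT (SpecT_map h) U)) (SpecT_map h)"
proof -
  let ?W = "{P. primeset P \<and> {a. h a \<in> P} \<in> U}"
  let ?V = "{P. primeset P \<and> {a. Const a \<in> P} \<in> U} :: (2, 'r) mpoly set set"
  have W: "openin (zariski type_ring) ?W" by (rule openin_vimage_SpecT_map[OF h U])
  have V: "openin (zariski type_ring) ?V" by (rule openin_vimage_SpecT_map[OF rhom_Const U])
  have \<theta>'h: "\<theta>' (h r) = Const r" for r using \<theta>(4)[of "Const r"] by (simp add: \<theta>h)
  let ?X = "open_subspace SpecT ?W" and ?Y = "open_subspace SpecT ?V" and ?S = "open_subspace SpecT U"
  have "isomorphic_over ?S ?X (SpecT_map h) ?Y plane_proj"
    unfolding isomorphic_over_def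
  proof (intro conjI exI)
    show "morphism ?X ?S (SpecT_map h)" by (rule morphism_SpecT_map[OF h U W]) simp
    show "morphism ?Y ?S plane_proj" by (rule morphism_SpecT_map[OF rhom_Const U V]) simp
    show "morphism ?X ?Y (SpecT_map \<theta>)"
      by (rule morphism_SpecT_map[OF \<theta>(1) V W]) (auto simp: primeset_vimage \<theta>(1) \<theta>h)
    show "morphism ?Y ?X (SpecT_map \<theta>')"
      by (rule morphism_SpecT_map[OF \<theta>(2) W V]) (auto simp: primeset_vimage \<theta>(2) \<theta>'h)
    show "eq_map ?X ?X (comp_map (SpecT_map \<theta>') (SpecT_map \<theta>)) id_map"
      by (rule eq_map_trans[OF eq_map_SpecT_comp[OF \<theta>(2,1,3)] eq_map_SpecT_id])
    show "eq_map ?Y ?Y (comp_map (SpecT_map \<theta>) (SpecT_map \<theta>')) id_map"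
      by (rule eq_map_trans[OF eq_map_SpecT_comp[OF \<theta>(1,2,4)] eq_map_SpecT_id])
    show "eq_map ?X ?S (comp_map plane_proj (SpecT_map \<theta>)) (SpecT_map h)"
      by (rule eq_map_SpecT_comp[OF rhom_Const \<theta>(1) \<theta>h])
  qed
  then show ?thesis
    unfolding trivial_plane_bundle_def times_plane_def vimage_in_SpecT .
qed

section \<open>Trivial plane bundles and charts\<close>

text \<open>Polynomials on the product with the plane have coefficients in the base type, whereas
  \<open>indep\<close> and \<open>adjoin\<close> use coefficients in the fraction field. This map
  connects the two.\<close>

definition map_coeffs ::
    "('a::comm_ring_1 \<Rightarrow> 'b::comm_ring_1) \<Rightarrow> ('n::finite, 'a) mpoly \<Rightarrow> ('n, 'b) mpoly" where
  "map_coeffs c = poly_subst (\<lambda>a. Const (c a)) Var"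

lemma rhom_map_coeffs: "rhom c \<Longrightarrow> rhom (map_coeffs c)"
  unfolding map_coeffs_def by (intro rhom_poly_subst rhom_comp[OF rhom_Const])

lemma map_coeffs_simps [simp]:
  assumes "rhom c"
  shows "map_coeffs c (Const a) = Const (c a)" "map_coeffs c (Var i) = Var i"
  unfolding map_coeffs_def by (simp_all add: rhom_comp[OF rhom_Const assms])

lemma lookup_map_coeffs:
  assumes c: "rhom c"
  shows "Poly_Mapping.lookup (map_coeffs c p) m = c (Poly_Mapping.lookup p m)"
proof (induction p arbitrary: m rule: mpoly_induct)
  case (Const a)
  show ?case unfolding map_coeffs_simps(1)[OF c] by (simp add: Const_def lookup_single when_def rhom_0[OF c])
next
  case (Var i p)
  then show ?case
    by (simp add: rhom_mult[OF rhom_map_coeffs[OF c]] c lookup_Var_mult rhom_0[OF c])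
next
  case (add p q)
  then show ?case by (simp add: rhom_add[OF rhom_map_coeffs[OF c]] lookup_add rhom_add[OF c])
qed

lemma map_coeffs_eq_0:
  assumes "rhom c" "\<And>a. c a = 0 \<Longrightarrow> a = 0" "map_coeffs c p = 0"
  shows "p = 0"
  by (rule poly_mapping_eqI) (metis assms lookup_map_coeffs lookup_zero)

lemma map_coeffs_polys: "rhom c \<Longrightarrow> map_coeffs c p \<in> polys (range c)"
  by (simp add: polys_def lookup_map_coeffs)

lemma polys_range:
  assumes c: "rhom c"
  shows "polys (range c) \<subseteq> range (map_coeffs c :: ('n::finite, 'a::comm_ring_1) mpoly \<Rightarrow> ('n, 'b::comm_ring_1) mpoly)"
proof (rule polys_subset_subringset[OF subringset_range[OF rhom_map_coeffs[OF c]]])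
  show "Const b \<in> range (map_coeffs c :: ('n, 'a) mpoly \<Rightarrow> ('n, 'b) mpoly)" if "b \<in> range c" for b
    using that c by (metis imageE map_coeffs_simps(1) rangeI)
  show "Var i \<in> range (map_coeffs c :: ('n, 'a) mpoly \<Rightarrow> ('n, 'b) mpoly)" for i
    using c by (metis map_coeffs_simps(2) rangeI)
qed

lemma evl_map_coeffs: "rhom c \<Longrightarrow> evl z (map_coeffs c p) = poly_subst c z p"
  unfolding map_coeffs_def by (subst rhom_poly_subst_comp[OF rhom_evl]) (simp_all add: rhom_comp[OF rhom_Const])

section \<open>Germs and sections as elements of the fraction field\<close>

lemma carrier_stalkE:
  assumes "X \<in> carrier (stalkT P)"
  obtains a s where "X = fr P a s" "s \<notin> P"
  using assms by (auto simp: stalk_carrier)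

lemma fr_carrier: "s \<notin> P \<Longrightarrow> fr P a s \<in> carrier (stalkT P)"
  by (auto simp: stalk_carrier)

lemma Fract_prime_simps:
  fixes P :: "'a::idom set"
  assumes "primeset P" "s \<notin> P" "t \<notin> P"
  shows "Fract (a * b) (s * t) = Fract a s * Fract b t"
    "Fract (a * t + b * s) (s * t) = Fract a s + Fract b t"
proof -
  have "s \<noteq> 0" "t \<noteq> 0" using assms idealsetD(1)[OF primesetD(1)[OF assms(1)]] by auto
  then show "Fract (a * b) (s * t) = Fract a s * Fract b t"
    "Fract (a * t + b * s) (s * t) = Fract a s + Fract b t" by simp_all
qed

text \<open>A stalk map followed by taking values is a ring homomorphism on the ring and determines
  the values of all fractions. Elements outside \<open>P\<close> are units of the stalk, so they are
  not sent to 0.\<close>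

lemma germ_hom:
  fixes P :: "'b::idom set" and Q :: "'c::idom set"
  assumes P: "primeset P" and Q: "primeset Q" and k: "k \<in> ring_hom (stalkT P) (stalkT Q)"
  defines "\<kappa> \<equiv> \<lambda>q. germ_value (k (fr P q 1))"
  shows "rhom \<kappa>" "s \<notin> P \<Longrightarrow> \<kappa> s \<noteq> 0" "s \<notin> P \<Longrightarrow> germ_value (k (fr P b s)) * \<kappa> s = \<kappa> b"
proof -
  have 1: "1 \<notin> P" "1 \<notin> Q" using primesetD(2) P Q by blast+
  have c: "k x \<in> carrier (stalkT Q)" if "x \<in> carrier (stalkT P)" for x
    using ring_hom_closed[OF k that] .
  have gm: "germ_value (k (fr P (a * b) (s * t))) = germ_value (k (fr P a s)) * germ_value (k (fr P b t))"
    if st: "s \<notin> P" "t \<notin> P" for a b s t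
  proof -
    obtain a' s' where x: "k (fr P a s) = fr Q a' s'" "s' \<notin> Q" using c[OF fr_carrier[OF st(1)]] by (rule carrier_stalkE)
    obtain b' t' where y: "k (fr P b t) = fr Q b' t'" "t' \<notin> Q" using c[OF fr_carrier[OF st(2)]] by (rule carrier_stalkE)
    have "k (fr P (a * b) (s * t)) = fr Q (a' * b') (s' * t')"
      using ring_hom_mult[OF k fr_carrier[OF st(1)] fr_carrier[OF st(2)], of a b]
      by (simp add: stalk_mult[OF P st] stalk_mult[OF Q x(2) y(2)] x y)
    then show ?thesis
      using x y primesetD(4)[OF Q x(2) y(2)] by (simp add: germ_value_fr[OF Q])
  qed
  have ga: "germ_value (k (fr P (a + b) 1)) = germ_value (k (fr P a 1)) + germ_value (k (fr P b 1))" for a b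
  proof -
    obtain a' s' where x: "k (fr P a 1) = fr Q a' s'" "s' \<notin> Q" using c[OF fr_carrier[OF 1(1)]] by (rule carrier_stalkE)
    obtain b' t' where y: "k (fr P b 1) = fr Q b' t'" "t' \<notin> Q" using c[OF fr_carrier[OF 1(1)]] by (rule carrier_stalkE)
    have "k (fr P (a + b) 1) = fr Q (a' * t' + b' * s') (s' * t')"
      using ring_hom_add[OF k fr_carrier[OF 1(1)] fr_carrier[OF 1(1)], of a b]
      by (simp add: stalk_add[OF P 1(1) 1(1)] stalk_add[OF Q x(2) y(2)] x y)
    then show ?thesis
      using x y primesetD(4)[OF Q x(2) y(2)] Fract_prime_simps(2)[OF Q x(2) y(2)]
      by (simp add: germ_value_fr[OF Q])
  qed
  have g1: "germ_value (k (fr P 1 1)) = 1"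
    using ring_hom_one[OF k] 1 by (simp add: stalk_one germ_value_fr[OF Q] One_fract_def)
  show "rhom \<kappa>"
  proof (rule rhomI)
    show "\<kappa> 1 = 1" by (simp add: \<kappa>_def g1)
    show "\<kappa> (a + b) = \<kappa> a + \<kappa> b" for a b by (simp add: \<kappa>_def ga)
    show "\<kappa> (a * b) = \<kappa> a * \<kappa> b" for a b using gm[OF 1(1) 1(1), of a b] by (simp add: \<kappa>_def)
  qed
  show *: "germ_value (k (fr P b s)) * \<kappa> s = \<kappa> b" if "s \<notin> P" for b s
  proof -
    have "germ_value (k (fr P b s)) * \<kappa> s = germ_value (k (fr P (b * s) (s * 1)))"
      unfolding \<kappa>_def by (rule gm[OF that 1(1), symmetric])
    also have "fr P (b * s) (s * 1) = fr P b 1" by (rule fr_eqI[OF P]) (use that 1 in auto)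
    finally show ?thesis by (simp add: \<kappa>_def)
  qed
  show "\<kappa> s \<noteq> 0" if "s \<notin> P"
    using *[OF that, of 1] g1 by (auto simp: \<kappa>_def)
qed

text \<open>Every nonempty open set contains the generic point, so all local fractions of a section
  have one value. The denominators of this value form an ideal. If it contained no power of
  \<open>f\<close>, some prime would contain it and avoid \<open>f\<close>, contradicting the local
  fraction at that prime.\<close>

lemma section_value:
  fixes f :: "'a::idom"
  assumes s: "s \<in> sections SpecT (basic_open f)" and f: "f \<noteq> 0"
  shows "\<exists>n c. germ_value (s {0}) * emb f ^ n = emb c"
    and "P \<in> basic_open f \<Longrightarrow> \<exists>a t. t \<notin> P \<and> s P = fr P a t \<and> Fract a t = germ_value (s {0})"
proof -
  let ?\<xi> = "germ_value (s {0})"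
  have loc: "\<exists>a t. t \<notin> P \<and> s P = fr P a t \<and> Fract a t = ?\<xi>" if P: "P \<in> basic_open f" for P
  proof -
    obtain V a b where V: "openin (zariski type_ring) V" "P \<in> V" "\<And>Q. Q \<in> V \<Longrightarrow> b \<notin> Q \<and> s Q = fr Q a b"
      using s P unfolding sections_SpecT by meson
    obtain g where g: "g \<notin> P" "P \<in> basic_open g" "basic_open g \<subseteq> V" by (rule zariski_basis[OF V(1,2)])
    have "g \<noteq> 0" using g(2) by (auto simp: basic_open_def dest: primesetD(1) idealsetD(1))
    then have "{0} \<in> V" using g(3) primeset_0 by (auto simp: basic_open_def)
    then have "b \<notin> {0}" "s {0} = fr {0} a b" using V(3) by blast+
    then have "?\<xi> = Fract a b" by (simp add: germ_value_fr[OF primeset_0])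
    then show ?thesis using V(2,3) by auto
  qed
  then show "P \<in> basic_open f \<Longrightarrow> \<exists>a t. t \<notin> P \<and> s P = fr P a t \<and> Fract a t = ?\<xi>" .
  let ?I = "{d. \<exists>c. ?\<xi> * emb d = emb c}"
  have I: "idealset ?I"
    unfolding idealset_def
  proof (intro conjI ballI allI)
    show "0 \<in> ?I" by (auto simp: rhom_0[OF rhom_emb] intro!: exI[of _ 0])
    fix a assume "a \<in> ?I"
    then obtain c where c: "?\<xi> * emb a = emb c" by blast
    have "?\<xi> * emb (r * a) = emb (r * c)" for r
      by (simp add: rhom_mult[OF rhom_emb] c[symmetric] mult_ac)
    then show "r * a \<in> ?I" for r by blast
    fix b assume "b \<in> ?I"
    then obtain d where d: "?\<xi> * emb b = emb d" by blast
    have "?\<xi> * emb (a + b) = emb (c + d)" by (simp add: rhom_add[OF rhom_emb] distrib_left c d)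
    then show "a + b \<in> ?I" by blast
  qed
  show "\<exists>n c. ?\<xi> * emb f ^ n = emb c"
  proof (rule ccontr)
    assume "\<not> ?thesis"
    then have "f ^ n \<notin> ?I" for n by (simp add: rhom_power[OF rhom_emb])
    then obtain P where P: "primeset P" "?I \<subseteq> P" "f \<notin> P" using prime_avoiding_powers[OF I, of f] by metis
    then obtain a t where at: "t \<notin> P" "Fract a t = ?\<xi>" using loc[of P] by (auto simp: basic_open_def)
    have "t \<noteq> 0" using at(1) idealsetD(1)[OF primesetD(1)[OF P(1)]] by auto
    then have "?\<xi> * emb t = emb a" unfolding at(2)[symmetric] by (simp add: Fract_eq_emb)
    then have "t \<in> ?I" by blast
    then show False using P(2) at(1) by blast
  qed
qed

text \<open>A morphism comes with stalk maps and not with a homomorphism of rings. Pulling back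
  \<open>q / 1\<close> as a section over a basic open set and taking its value recovers the
  comorphism into the localization.\<close>

lemma pullback_value:
  fixes \<alpha> :: "('a::idom set, ('a \<times> 'a) set, 'b::idom set, ('b \<times> 'b) set) lrmap"
  assumes \<alpha>: "morphism (open_subspace SpecT W) (open_subspace SpecT V) \<alpha>" and fV: "basic_open f \<subseteq> V"
    and vim: "vimage_in (open_subspace SpecT W) \<alpha> (basic_open f) = basic_open f'" and f': "f' \<noteq> 0"
  defines "\<kappa> \<equiv> \<lambda>q. germ_value (costalk \<alpha> {0} (fr (point \<alpha> {0}) q 1))"
  shows "\<exists>n c. \<kappa> q * emb f' ^ n = emb c"
    and "Q \<in> basic_open f' \<Longrightarrow>
      \<exists>a s. s \<notin> Q \<and> costalk \<alpha> Q (fr (point \<alpha> Q) q 1) = fr Q a s \<and> Fract a s = \<kappa> q"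
proof -
  let ?t = "\<lambda>Q\<in>basic_open f. fr Q q 1"
  have "openin (subtopology (zariski type_ring) V) (basic_open f)"
    using openin_basic_open[of f] fV by (simp add: openin_subset_topspace_eq openin_open_subtopology openin_subtopology) blast
  moreover have "?t \<in> sections SpecT (basic_open f)"
    unfolding sections_SpecT
  proof (intro conjI ballI)
    fix P assume "P \<in> basic_open f"
    then show "\<exists>V a b. openin (zariski type_ring) V \<and> P \<in> V \<and> V \<subseteq> basic_open f \<and> (\<forall>Q\<in>V. b \<notin> Q \<and> ?t Q = fr Q a b)"
      by (intro exI[of _ "basic_open f"] exI[of _ q] exI[of _ 1])
        (auto simp: openin_basic_open, auto simp: basic_open_def dest: primesetD(2))
  qed simp
  ultimately have s: "(\<lambda>p\<in>basic_open f'. costalk \<alpha> p (?t (point \<alpha> p))) \<in> sections SpecT (basic_open f')"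
  proof -
    have pull: "\<forall>V' t. openin (subtopology (zariski type_ring) V) V' \<longrightarrow> t \<in> sections SpecT V' \<longrightarrow>
        (\<lambda>p\<in>vimage_in (open_subspace SpecT W) \<alpha> V'. costalk \<alpha> p (t (point \<alpha> p)))
          \<in> sections SpecT (vimage_in (open_subspace SpecT W) \<alpha> V')"
      using \<alpha> by (simp add: morphism_def)
    assume "openin (subtopology (zariski type_ring) V) (basic_open f)" "?t \<in> sections SpecT (basic_open f)"
    then show ?thesis unfolding vim[symmetric] using pull by blast
  qed
  have pt: "point \<alpha> p \<in> basic_open f" if "p \<in> basic_open f'" for p
    using that unfolding vim[symmetric] by (simp add: vimage_in_def)
  have 0: "{0} \<in> basic_open f'" using primeset_0 f' by (simp add: basic_open_def)
  show "\<exists>n c. \<kappa> q * emb f' ^ n = emb c"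
    using section_value(1)[OF s f'] 0 pt[OF 0] by (simp add: \<kappa>_def)
  show "\<exists>a s. s \<notin> Q \<and> costalk \<alpha> Q (fr (point \<alpha> Q) q 1) = fr Q a s \<and> Fract a s = \<kappa> q"
    if Q: "Q \<in> basic_open f'"
    using section_value(2)[OF s f' Q] 0 pt[OF 0] pt[OF Q] Q by (simp add: \<kappa>_def)
qed

text \<open>The inverse trivialization carries a prime of the product over \<open>P\<close> to a
  prime of the total space over \<open>P\<close>, and the zero section provides such a
  prime.\<close>

lemma bundle_generic_point:
  fixes h :: "'r::idom \<Rightarrow> 'a::idom"
  assumes h: "rhom h" and U: "openin (zariski type_ring) U" "P \<in> U"
    and triv: "trivial_plane_bundle U (open_subspace SpecT W) (SpecT_map h)"
  obtains Q where "primeset Q" "Q \<in> W" "{r. h r \<in> Q} = P"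
    "\<And>R :: (2, 'r) mpoly set. primeset R \<Longrightarrow> {r. Const r \<in> R} \<in> U \<Longrightarrow>
      \<exists>Q. primeset Q \<and> Q \<in> W \<and> {r. h r \<in> Q} = {r. Const r \<in> R}"
proof -
  let ?X = "open_subspace SpecT W" and ?Y = "times_plane U" and ?S = "open_subspace SpecT U"
  obtain \<alpha> \<beta> where \<beta>: "morphism ?Y ?X \<beta>"
    and \<alpha>\<beta>: "eq_map ?Y ?Y (comp_map \<alpha> \<beta>) id_map" and over: "eq_map ?X ?S (comp_map plane_proj \<alpha>) (SpecT_map h)"
    using triv unfolding trivial_plane_bundle_def isomorphic_over_def by blast
  have *: "\<exists>Q. primeset Q \<and> Q \<in> W \<and> {r. h r \<in> Q} = {r. Const r \<in> R}"
    if R: "primeset R" "{r. Const r \<in> R} \<in> U" for R :: "(2, 'r) mpoly set"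
  proof -
    have RY: "R \<in> points ?Y"
      using R unfolding times_plane_def vimage_in_SpecT by (simp add: topspace_zariski)
    have QX: "point \<beta> R \<in> points ?X"
      using \<beta> RY unfolding morphism_def continuous_map_def by blast
    have "point \<alpha> (point \<beta> R) = R"
      using \<alpha>\<beta> RY unfolding eq_map_def by (simp add: comp_map_def id_map_def)
    moreover have "point plane_proj (point \<alpha> (point \<beta> R)) = {r. h r \<in> point \<beta> R}"
      using over QX unfolding eq_map_def by (simp add: comp_map_def)
    ultimately show ?thesis using QX by (intro exI[of _ "point \<beta> R"]) (simp add: topspace_zariski)
  qed
  \<comment> \<open>Restriction to the zero section: both plane coordinates become 0.\<close>
  define \<pi> :: "(2, 'r) mpoly \<Rightarrow> 'r" where "\<pi> = poly_subst (\<lambda>a. a) (\<lambda>_. 0)"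
  have \<pi>: "rhom \<pi>" unfolding \<pi>_def by (rule rhom_eval)
  have P: "primeset P" using openin_subset[OF U(1)] U(2) by (auto simp: topspace_zariski)
  have "{r. Const r \<in> {q. \<pi> q \<in> P}} = P" by (simp add: \<pi>_def)
  then obtain Q where "primeset Q" "Q \<in> W" "{r. h r \<in> Q} = P"
    using *[OF primeset_vimage[OF \<pi> P]] U(2) by metis
  then show thesis using * by (rule that)
qed

text \<open>The chart consists of the pulled back plane coordinates. They are independent and
  generate because the two morphisms undo each other on germs. One pair \<open>\<xi>\<close> serves
  every basic open set inside \<open>U\<close>; over the punctured plane two such sets are used with
  the same pair.\<close>

lemma bundle_charts:
  fixes h :: "'r::idom \<Rightarrow> 'a::idom"
  assumes h: "rhom h" and U: "openin (zariski type_ring) U"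
    and triv: "trivial_plane_bundle U (open_subspace SpecT (vimage_in SpecT (SpecT_map h) U)) (SpecT_map h)"
    and inj_h: "inj h" and ne: "{0} \<in> U"
  obtains \<xi> :: "2 \<Rightarrow> 'a fract"
  where "\<And>f. f \<noteq> 0 \<Longrightarrow> basic_open f \<subseteq> U \<Longrightarrow> chart (range (\<lambda>r. emb (h r))) (range emb) (emb (h f)) \<xi>"
proof -
  have inj: "r = 0" if "h r = 0" for r using that injD[OF inj_h, of r 0] by (simp add: rhom_0[OF h])
  let ?W = "vimage_in SpecT (SpecT_map h) U"
  let ?V = "vimage_in SpecT plane_proj U :: (2, 'r) mpoly set set"
  let ?X = "open_subspace SpecT ?W" and ?Y = "open_subspace SpecT ?V" and ?S = "open_subspace SpecT U"
  obtain \<alpha> \<beta> where \<alpha>: "morphism ?X ?Y \<alpha>" and \<beta>: "morphism ?Y ?X \<beta>"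
    and \<beta>\<alpha>: "eq_map ?X ?X (comp_map \<beta> \<alpha>) id_map" and \<alpha>\<beta>: "eq_map ?Y ?Y (comp_map \<alpha> \<beta>) id_map"
    and over: "eq_map ?X ?S (comp_map plane_proj \<alpha>) (SpecT_map h)"
    using triv unfolding trivial_plane_bundle_def isomorphic_over_def times_plane_def by blast
  have X: "points ?X = {P. primeset P \<and> {r. h r \<in> P} \<in> U}"
    and Y: "points ?Y = {P. primeset P \<and> {r. Const r \<in> P} \<in> U}"
    by (auto simp: topspace_zariski vimage_in_SpecT)
  let ?a = "{0} :: 'a set" and ?y = "{0} :: (2, 'r) mpoly set"
  have Const0: "(Const r :: (2, 'r) mpoly) = 0 \<longleftrightarrow> r = 0" for r
  proof
    assume "(Const r :: (2, 'r) mpoly) = 0"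
    then have "poly_subst (\<lambda>a. a) (\<lambda>_. 0) (Const r :: (2, 'r) mpoly) = 0" by (simp add: poly_subst_0)
    then show "r = 0" by simp
  qed simp
  have aX: "?a \<in> points ?X" and yY: "?y \<in> points ?Y"
  proof -
    have "{r. h r \<in> ?a} = {0}" using inj rhom_0[OF h] by auto
    then show "?a \<in> points ?X" unfolding X using primeset_0 ne by simp
    have "{r. Const r \<in> ?y} = {0}" using Const0 by auto
    then show "?y \<in> points ?Y" unfolding Y using primeset_0 ne by simp
  qed
  have \<alpha>Y: "point \<alpha> p \<in> points ?Y" if "p \<in> points ?X" for p
    using \<alpha> that unfolding morphism_def continuous_map_def by blast
  have \<beta>X: "point \<beta> p \<in> points ?X" if "p \<in> points ?Y" for p
    using \<beta> that unfolding morphism_def continuous_map_def by blast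
  have \<beta>\<alpha>p: "point \<beta> (point \<alpha> p) = p" if "p \<in> points ?X" for p
    using \<beta>\<alpha> that unfolding eq_map_def by (simp add: comp_map_def id_map_def)
  have \<alpha>\<beta>p: "point \<alpha> (point \<beta> p) = p" if "p \<in> points ?Y" for p
    using \<alpha>\<beta> that unfolding eq_map_def by (simp add: comp_map_def id_map_def)
  have over_p: "{r. Const r \<in> point \<alpha> p} = {r. h r \<in> p}" if "p \<in> points ?X" for p
    using over that unfolding eq_map_def by (simp add: comp_map_def)
  have over_q: "{r. h r \<in> point \<beta> q} = {r. Const r \<in> q}" if "q \<in> points ?Y" for q
    using over_p[OF \<beta>X[OF that]] \<alpha>\<beta>p[OF that] by simp
  have prX: "primeset p" if "p \<in> points ?X" for p using that unfolding X by simp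
  have prY: "primeset p" if "p \<in> points ?Y" for p using that unfolding Y by simp
  have khom: "costalk \<alpha> p \<in> ring_hom (stalkT (point \<alpha> p)) (stalkT p)" if "p \<in> points ?X" for p
    using \<alpha> that unfolding morphism_def by simp
  have khom': "costalk \<beta> p \<in> ring_hom (stalkT (point \<beta> p)) (stalkT p)" if "p \<in> points ?Y" for p
    using \<beta> that unfolding morphism_def by simp
  define \<kappa> where "\<kappa> q = germ_value (costalk \<alpha> ?a (fr (point \<alpha> ?a) q 1))" for q
  define \<kappa>' where "\<kappa>' q = germ_value (costalk \<beta> ?y (fr (point \<beta> ?y) q 1))" for q
  note G = germ_hom[OF prY[OF \<alpha>Y[OF aX]] prX[OF aX] khom[OF aX], folded \<kappa>_def]
  note G' = germ_hom[OF prX[OF \<beta>X[OF yY]] prY[OF yY] khom'[OF yY], folded \<kappa>'_def]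
  have \<kappa>_Const: "\<kappa> (Const r) = emb (h r)" for r
  proof -
    let ?P = "point \<alpha> ?a"
    have P: "primeset ?P" by (rule prY[OF \<alpha>Y[OF aX]])
    have e: "{r. Const r \<in> ?P} = {r. h r \<in> ?a}" by (rule over_p[OF aX])
    have 1: "h 1 \<notin> ?a" "Const 1 \<notin> ?P" using primesetD(2)[OF P] by (auto simp: rhom_1[OF h])
    have "fr {r. h r \<in> ?a} r 1 \<in> carrier (stalkT {r. h r \<in> ?a})"
      by (rule fr_carrier) (use 1 in simp)
    then have "costalk \<alpha> ?a (costalk plane_proj ?P (fr {r. h r \<in> ?a} r 1)) = costalk (SpecT_map h) ?a (fr {r. h r \<in> ?a} r 1)"
      using over aX e unfolding eq_map_def by (simp add: comp_map_def)
    also have "\<dots> = fr ?a (h r) (h 1)" by (rule costalk_SpecT_map[OF h primeset_0 1(1)])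
    also have "costalk plane_proj ?P (fr {r. h r \<in> ?a} r 1) = fr ?P (Const r) (Const 1)"
      unfolding e[symmetric] by (rule costalk_SpecT_map[OF rhom_Const P 1(2)])
    finally show ?thesis unfolding \<kappa>_def by (simp add: rhom_1[OF h] germ_value_fr[OF primeset_0] emb_def)
  qed
  define \<xi> where "\<xi> i = \<kappa> (Var i)" for i
  have \<kappa>_eq: "\<kappa> q = poly_subst (\<lambda>r. emb (h r)) \<xi> q" for q
    by (rule rhom_mpoly_eqI[OF G(1)])
      (simp_all add: rhom_poly_subst rhom_comp[OF rhom_emb h] \<kappa>_Const \<xi>_def)
  note rS = rhom_comp[OF rhom_emb h]
  let ?Sr = "range (\<lambda>r. emb (h r))"
  have Sr: "subringset ?Sr" by (rule subringset_range[OF rS])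
  have fin: "chart ?Sr (range emb) (emb (h f)) \<xi>" if f: "f \<noteq> 0" "basic_open f \<subseteq> U" for f
  proof -
    have hf: "h f \<noteq> 0" using inj f(1) by blast
    have cf: "Const f \<noteq> (0 :: (2, 'r) mpoly)" using Const0 f(1) by simp
    have inU: "{r. h r \<in> p} \<in> U" if "primeset p" "h f \<notin> p" for p
      using f(2) primeset_vimage[OF h that(1)] that(2) by (auto simp: basic_open_def)
    have inU': "{r. Const r \<in> p} \<in> U" if "primeset p" "Const f \<notin> p" for p :: "(2, 'r) mpoly set"
      using f(2) primeset_vimage[OF rhom_Const that(1)] that(2) by (auto simp: basic_open_def)
    \<comment> \<open>The morphism lies over the base, so nonvanishing of \<open>f\<close> means the
      same on both sides.\<close>
    have vim: "vimage_in ?X \<alpha> (basic_open (Const f)) = basic_open (h f)"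
    proof (intro equalityI subsetI)
      fix p assume "p \<in> vimage_in ?X \<alpha> (basic_open (Const f))"
      then have p: "p \<in> points ?X" "Const f \<notin> point \<alpha> p" by (auto simp: vimage_in_def basic_open_def)
      then show "p \<in> basic_open (h f)" using over_p[OF p(1)] prX by (auto simp: basic_open_def)
    next
      fix p assume "p \<in> basic_open (h f)"
      then have p: "primeset p" "h f \<notin> p" by (auto simp: basic_open_def)
      then have pX: "p \<in> points ?X" unfolding X using inU by simp
      then show "p \<in> vimage_in ?X \<alpha> (basic_open (Const f))"
        using over_p[OF pX] p(2) prY[OF \<alpha>Y[OF pX]] unfolding vimage_in_def basic_open_def by blast
    qed
    have vim': "vimage_in ?Y \<beta> (basic_open (h f)) = basic_open (Const f)"
    proof (intro equalityI subsetI)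
      fix p assume "p \<in> vimage_in ?Y \<beta> (basic_open (h f))"
      then have p: "p \<in> points ?Y" "h f \<notin> point \<beta> p" by (auto simp: vimage_in_def basic_open_def)
      then show "p \<in> basic_open (Const f)" using over_q[OF p(1)] prY by (auto simp: basic_open_def)
    next
      fix p :: "(2, 'r) mpoly set" assume "p \<in> basic_open (Const f)"
      then have p: "primeset p" "Const f \<notin> p" by (auto simp: basic_open_def)
      then have pY: "p \<in> points ?Y" unfolding Y using inU' by simp
      then show "p \<in> vimage_in ?Y \<beta> (basic_open (h f))"
        using over_q[OF pY] p(2) prX[OF \<beta>X[OF pY]] unfolding vimage_in_def basic_open_def by blast
    qed
    have subV: "basic_open (Const f) \<subseteq> ?V" "basic_open (h f) \<subseteq> ?W"
      using inU inU' by (auto simp: vimage_in_SpecT basic_open_def)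
    note A = pullback_value[OF \<alpha> subV(1) vim hf, folded \<kappa>_def]
    note B = pullback_value[OF \<beta> subV(2) vim' cf, folded \<kappa>'_def]
    show ?thesis
      unfolding chart_def
    proof (intro conjI allI subsetI)
      show "\<xi> i \<in> loc (range emb) (emb (h f))" for i
        using A(1)[of "Var i"] by (auto simp: loc_def \<xi>_def mult.commute)
      show "indep ?Sr \<xi>"
        unfolding indep_def
      proof (intro ballI impI)
        fix p assume p: "p \<in> polys ?Sr" "poly_subst (\<lambda>a. a) \<xi> p = 0"
        then obtain q :: "(2, 'r) mpoly" where q: "p = map_coeffs (\<lambda>r. emb (h r)) q"
          using polys_range[OF rS] by blast
        have "poly_subst (\<lambda>a. a) \<xi> p = \<kappa> q"
          unfolding q \<kappa>_eq evl_def[symmetric] by (rule evl_map_coeffs[OF rS])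
        then have \<kappa>q: "\<kappa> q = 0" using p(2) by simp
        \<comment> \<open>If \<open>q\<close> has value 0, its pullback has zero germ at the image
          under \<open>\<beta>\<close> of the generic point of the product. Applying
          \<open>\<beta>\<close> to this germ returns \<open>q\<close>, so \<open>q\<close> is
          0.\<close>
        let ?p = "point \<beta> ?y"
        have pX: "?p \<in> points ?X" by (rule \<beta>X[OF yY])
        have "h f \<notin> ?p" using over_q[OF yY] cf by auto
        then have "?p \<in> basic_open (h f)" using prX[OF pX] by (simp add: basic_open_def)
        then obtain a s where as: "s \<notin> ?p" "costalk \<alpha> ?p (fr (point \<alpha> ?p) q 1) = fr ?p a s" "Fract a s = \<kappa> q"
          using A(2) by blast
        have "s \<noteq> 0" using as(1) idealsetD(1)[OF primesetD(1)[OF prX[OF pX]]] by auto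
        then have "a = 0" using as(3) \<kappa>q by (simp add: Fract_eq_emb)
        have "costalk \<beta> ?y (costalk \<alpha> ?p (fr ?y q 1)) = fr ?y q 1"
          using \<alpha>\<beta> yY fr_carrier[of 1 ?y q] \<alpha>\<beta>p[OF yY] unfolding eq_map_def by (simp add: comp_map_def id_map_def)
        then have "germ_value (costalk \<beta> ?y (fr ?p a s)) = emb q"
          using as(2) \<alpha>\<beta>p[OF yY] by (simp add: germ_value_fr[OF primeset_0] emb_def)
        then have "emb q * \<kappa>' s = \<kappa>' a" using G'(3)[OF as(1), of a] by simp
        then have "emb q = 0" using G'(2)[OF as(1)] \<open>a = 0\<close> by (simp add: rhom_0[OF G'(1)])
        then have "q = 0" by simp
        then show "p = 0" using q by (simp add: map_coeffs_def poly_subst_0)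
      qed
      fix x assume "x \<in> range (emb :: 'a \<Rightarrow> _)"
      then obtain a where a: "x = emb a" by blast
      \<comment> \<open>The pullback of \<open>a\<close> along \<open>\<beta>\<close> is q / f^n for
        some \<open>q\<close>. Applying \<open>\<alpha>\<close> writes \<open>a\<close> as a
        polynomial in \<open>\<xi>\<close> divided by the n-th power of \<open>h f\<close>.\<close>
      let ?p = "point \<alpha> ?a"
      have pY: "?p \<in> points ?Y" by (rule \<alpha>Y[OF aX])
      have "Const f \<notin> ?p" using over_p[OF aX] hf by auto
      then have "?p \<in> basic_open (Const f)" using prY[OF pY] by (simp add: basic_open_def)
      then obtain b s where bs: "s \<notin> ?p" "costalk \<beta> ?p (fr (point \<beta> ?p) a 1) = fr ?p b s" "Fract b s = \<kappa>' a"
        using B(2) by blast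
      have s0: "s \<noteq> 0" using bs(1) idealsetD(1)[OF primesetD(1)[OF prY[OF pY]]] by auto
      obtain n q where nq: "\<kappa>' a * emb (Const f) ^ n = emb q" using B(1) by blast
      have "emb (b * Const f ^ n) = emb (q * s)"
        using nq s0 unfolding bs(3)[symmetric] Fract_eq_emb by (simp add: rhom_simps[OF rhom_emb] field_simps)
      then have eq: "b * Const f ^ n = q * s" by simp
      have "costalk \<alpha> ?a (costalk \<beta> ?p (fr ?a a 1)) = fr ?a a 1"
        using \<beta>\<alpha> aX fr_carrier[of 1 ?a a] \<beta>\<alpha>p[OF aX] unfolding eq_map_def by (simp add: comp_map_def id_map_def)
      then have "germ_value (costalk \<alpha> ?a (fr ?p b s)) = emb a"
        using bs(2) \<beta>\<alpha>p[OF aX] by (simp add: germ_value_fr[OF primeset_0] emb_def)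
      then have "emb a * \<kappa> s = \<kappa> b" using G(3)[OF bs(1), of b] by simp
      then have "emb a * emb (h f) ^ n * \<kappa> s = \<kappa> (b * Const f ^ n)"
        by (simp add: rhom_simps[OF G(1)] \<kappa>_Const mult_ac)
      also have "\<dots> = \<kappa> q * \<kappa> s" unfolding eq by (simp add: rhom_simps[OF G(1)])
      finally have "emb (h f) ^ n * emb a = \<kappa> q" using G(2)[OF bs(1)] by (simp add: mult.commute)
      moreover have "\<kappa> q \<in> adjoin ?Sr \<xi>"
        unfolding \<kappa>_eq
        by (rule poly_subst_closed[OF subringset_adjoin[OF Sr], where S = UNIV])
          (auto intro!: adjoin_base[OF Sr] adjoin_gen[OF Sr])
      ultimately have "emb a \<in> loc (adjoin ?Sr \<xi>) (emb (h f))" by (intro locI[where n = n]) simp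
      then show "x \<in> adjoin (loc ?Sr (emb (h f))) \<xi>"
        unfolding a using hf by (subst adjoin_loc[OF Sr]) auto
    qed
  qed
  then show thesis by (rule that)
qed

section \<open>Variables and global charts\<close>

lemma rhom_left_inverse:
  assumes \<theta>: "rhom \<theta>" and "\<And>a. \<exists>q. \<theta> q = a" "\<And>q. \<theta> q = 0 \<Longrightarrow> q = 0"
  obtains \<theta>' where "rhom \<theta>'" "\<And>a. \<theta> (\<theta>' a) = a" "\<And>q. \<theta>' (\<theta> q) = q"
proof -
  obtain \<theta>' where 1: "\<And>a. \<theta> (\<theta>' a) = a" using assms(2) by metis
  have inj: "p = q" if "\<theta> p = \<theta> q" for p q
    using assms(3)[of "p - q"] that by (simp add: rhom_diff[OF \<theta>])
  have "rhom \<theta>'"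
    by (rule rhomI) (rule inj, simp add: rhom_simps[OF \<theta>] 1)+
  moreover have "\<theta>' (\<theta> q) = q" for q by (rule inj) (simp add: 1)
  ultimately show thesis using that 1 by blast
qed

text \<open>The purely algebraic condition with which all four conditions are compared;
  \<open>\<theta>\<close> is the comorphism of a trivialization over the whole plane.\<close>

definition trivializable :: "(4, complex) mpoly \<Rightarrow> bool" where
  "trivializable v \<longleftrightarrow> (\<exists>(\<theta> :: (2, (2, complex) mpoly) mpoly \<Rightarrow> (4, complex) mpoly) \<theta>'.
    rhom \<theta> \<and> rhom \<theta>' \<and> (\<forall>a. \<theta> (\<theta>' a) = a) \<and> (\<forall>q. \<theta>' (\<theta> q) = q) \<and>
    (\<forall>r. \<theta> (Const r) = comorphism_xv v r))"

lemma forall_2_cases: "P 0 \<Longrightarrow> P 1 \<Longrightarrow> P (i :: 2)"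
  using forall_2'[of P] by blast

lemma subringset_generate_ring: "subringset (generate_ring type_ring (H :: 'a::comm_ring_1 set))"
proof -
  interpret cring "type_ring :: 'a ring" by (rule cring_from_type_algebra)
  have neg: "\<ominus>\<^bsub>type_ring\<^esub> a = - a" for a :: 'a
    by (rule minus_equality) simp_all
  let ?G = "generate_ring type_ring H"
  have u: "- a \<in> ?G" if "a \<in> ?G" for a using generate_ring.a_inv[OF that] by (simp add: neg)
  have "a - b \<in> ?G" if "a \<in> ?G" "b \<in> ?G" for a b
    using generate_ring.eng_add[OF that(1) u[OF that(2)]] by simp
  moreover have "a * b \<in> ?G" if "a \<in> ?G" "b \<in> ?G" for a b
    using generate_ring.eng_mult[OF that] by simp
  moreover have "1 \<in> ?G" using generate_ring.one[of type_ring H] by simp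
  ultimately show ?thesis by (auto simp: subringset_def)
qed

lemma generate_ring_least:
  fixes T :: "'a::comm_ring_1 set"
  assumes T: "subringset T" "H \<subseteq> T"
  shows "generate_ring type_ring H \<subseteq> T"
proof
  interpret cring "type_ring :: 'a ring" by (rule cring_from_type_algebra)
  have neg: "\<ominus>\<^bsub>type_ring\<^esub> a = - a" for a :: 'a
    by (rule minus_equality) simp_all
  fix a assume "a \<in> generate_ring type_ring H"
  then show "a \<in> T"
    by induction (use T in \<open>auto simp: subringsetD neg\<close>)
qed

lemma x_variable_if_trivializable:
  assumes "trivializable v"
  shows "x_variable v"
proof -
  obtain \<theta> :: "(2, (2, complex) mpoly) mpoly \<Rightarrow> (4, complex) mpoly" and \<theta>'
    where \<theta>: "rhom \<theta>" "\<forall>a. \<theta> (\<theta>' a) = a" "\<forall>r. \<theta> (Const r) = comorphism_xv v r"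
    using assms unfolding trivializable_def by blast
  let ?B = "generate_ring type_ring (range Const \<union> {Var 0}) :: (4, complex) mpoly set"
  let ?T = "generate_ring type_ring (?B \<union> {v, \<theta> (Var 0), \<theta> (Var 1)})"
  have T: "subringset ?T" by (rule subringset_generate_ring)
  have B: "b \<in> ?T" if "b \<in> ?B" for b using that by (intro generate_ring.incl) simp
  have "Const c \<in> ?B" "Var 0 \<in> ?B" for c by (auto intro: generate_ring.incl)
  then have gens: "Const c \<in> ?T" "Var 0 \<in> ?T" "v \<in> ?T" "\<theta> (Var 0) \<in> ?T" "\<theta> (Var 1) \<in> ?T" for c
    using B by (auto intro: generate_ring.incl)
  have base: "comorphism_xv v r \<in> ?T" for r
    unfolding comorphism_xv_def
    by (rule poly_subst_closed[OF T, where S = UNIV]) (use gens in auto)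
  have "polys UNIV \<subseteq> {q. \<theta> q \<in> ?T}"
  proof (rule polys_subset_subringset[OF subringset_vimage[OF \<theta>(1) T]])
    show "Const r \<in> {q. \<theta> q \<in> ?T}" for r using \<theta>(3) base by simp
    show "Var i \<in> {q. \<theta> q \<in> ?T}" for i by (rule forall_2_cases) (use gens in auto)
  qed
  then have "\<theta> q \<in> ?T" for q by auto
  then have "?T = UNIV" using \<theta>(2) by (metis UNIV_eq_I)
  then show ?thesis unfolding x_variable_def by blast
qed

text \<open>The elements x, v, g, h generate a polynomial ring in four variables over the complex
  numbers, so they are algebraically independent. Generation makes \<open>\<theta>\<close>
  surjective and independence makes it injective.\<close>

lemma trivializable_if_x_variable:
  assumes "x_variable v"
  shows "trivializable v"
proof -
  obtain g h where gh: "generate_ring type_ring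
      (generate_ring type_ring (range Const \<union> {Var 0}) \<union> {v, g, h}) = UNIV"
    using assms unfolding x_variable_def by blast
  have gen: "T = UNIV" if T: "subringset T" "\<And>c. Const c \<in> T" "Var 0 \<in> T" "v \<in> T" "g \<in> T" "h \<in> T" for T
  proof -
    have "generate_ring type_ring (range Const \<union> {Var 0}) \<subseteq> T"
      by (rule generate_ring_least[OF T(1)]) (use T in auto)
    then have "generate_ring type_ring (generate_ring type_ring (range Const \<union> {Var 0}) \<union> {v, g, h}) \<subseteq> T"
      by (intro generate_ring_least T(1)) (use T in auto)
    then show ?thesis using gh by auto
  qed
  let ?c = "\<lambda>a. emb (Const a :: (4, complex) mpoly)"
  have c: "rhom ?c" by (rule rhom_comp[OF rhom_emb rhom_Const])
  have C0: "subringset (range ?c)" by (rule subringset_range[OF c])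
  have Const_inj: "a = 0" if "(Const a :: (4, complex) mpoly) = 0" for a
  proof -
    have "evl (\<lambda>_. 0) (Const a :: (4, complex) mpoly) = 0" unfolding that by (rule rhom_0[OF rhom_evl])
    then show ?thesis by simp
  qed
  let ?y = "\<lambda>i. emb (Var i :: (4, complex) mpoly)"
  let ?w = "chart_vars v (\<lambda>i. if i = 0 then emb g else emb h)"
  have ev_emb: "evl ?y (map_coeffs ?c p) = emb p" for p
    unfolding evl_map_coeffs[OF c]
    by (rule rhom_mpoly_eqI[OF rhom_poly_subst[OF c] rhom_emb]) (simp_all add: c)
  have y: "indep (range ?c) ?y"
    unfolding indep_def
  proof (intro ballI impI)
    fix p assume p: "p \<in> polys (range ?c)" "poly_subst (\<lambda>a. a) ?y p = 0"
    then obtain q :: "(4, complex) mpoly" where q: "p = map_coeffs ?c q" using polys_range[OF c] by blast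
    then have "emb q = 0" using p(2) ev_emb by (simp add: evl_def)
    then show "p = 0" using q by (simp add: rhom_0[OF rhom_map_coeffs[OF c]])
  qed
  have wy: "?w i \<in> adjoin (range ?c) ?y" for i
  proof -
    have "emb p \<in> adjoin (range ?c) ?y" for p
      using evl_adjoin[OF map_coeffs_polys[OF c], of ?y p] unfolding ev_emb .
    then show ?thesis by (simp add: chart_vars_def)
  qed
  have w_in: "?w i \<in> adjoin (range ?c) ?w" for i by (rule adjoin_gen[OF C0])
  have yw: "?y i \<in> adjoin (range ?c) ?w" for i
  proof -
    have "{p. emb p \<in> adjoin (range ?c) ?w} = UNIV"
      by (rule gen[OF subringset_vimage[OF rhom_emb subringset_adjoin[OF C0]]])
        (use w_in[of 0] w_in[of 1] w_in[of 2] w_in[of 3] adjoin_base[OF C0 rangeI] in \<open>simp_all add: chart_vars_def\<close>)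
    then show ?thesis by blast
  qed
  have w: "indep (range ?c) ?w" by (rule indep_generators[OF C0 y wy yw])
  define \<theta> where "\<theta> = poly_subst (comorphism_xv v) (\<lambda>i :: 2. if i = 0 then g else h)"
  have \<theta>: "rhom \<theta>" unfolding \<theta>_def by (intro rhom_poly_subst rhom_comorphism)
  have \<theta>_simps: "\<theta> (Const r) = comorphism_xv v r" "\<theta> (Var 0) = g" "\<theta> (Var 1) = h" for r
    unfolding \<theta>_def by (simp_all add: rhom_comorphism)
  \<comment> \<open>Regroups four variables as two over two, so that \<open>\<theta>\<close> after
    \<open>F\<close> is evaluation at x, v, g, h.\<close>
  define F :: "(4, complex) mpoly \<Rightarrow> (2, (2, complex) mpoly) mpoly" where
    "F = poly_subst (\<lambda>c. Const (Const c)) (\<lambda>j. if j = 0 then Const (Var 0) else if j = 1 then Const (Var 1)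
      else if j = 2 then Var 0 else Var 1)"
  have cc: "rhom (\<lambda>c. Const (Const c) :: (2, (2, complex) mpoly) mpoly)"
    by (rule rhom_comp[OF rhom_Const rhom_Const])
  have F: "rhom F" unfolding F_def by (rule rhom_poly_subst[OF cc])
  have F_simps: "F (Const a) = Const (Const a)" "F (Var 0) = Const (Var 0)" "F (Var 1) = Const (Var 1)"
    "F (Var 2) = Var 0" "F (Var 3) = Var 1" for a
    unfolding F_def by (simp_all add: cc)
  have F_surj: "range F = UNIV"
  proof -
    have R: "subringset (range F)" by (rule subringset_range[OF F])
    have "polys UNIV \<subseteq> {r. Const r \<in> range F}"
    proof (rule polys_subset_subringset[OF subringset_vimage[OF rhom_Const R]])
      show "Const a \<in> {r. Const r \<in> range F}" for a using rangeI[of F "Const a"] by (simp add: F_simps)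
      show "Var i \<in> {r. Const r \<in> range F}" for i
        by (rule forall_2_cases) (use F_simps(2,3) in \<open>auto intro: range_eqI[OF sym]\<close>)
    qed
    then have C: "Const r \<in> range F" for r by auto
    have "polys UNIV \<subseteq> range F"
      by (rule polys_subset_subringset[OF R C], rule forall_2_cases)
        (use F_simps(4,5) in \<open>auto intro: range_eqI[OF sym]\<close>)
    then show ?thesis by auto
  qed
  have \<theta>F: "emb (\<theta> (F p)) = evl ?w (map_coeffs ?c p)" for p
    unfolding evl_map_coeffs[OF c]
  proof (rule rhom_mpoly_eqI[where F = "\<lambda>p. emb (\<theta> (F p))"])
    show "emb (\<theta> (F (Var i))) = poly_subst ?c ?w (Var i)" for i
    proof -
      have "\<forall>i. emb (\<theta> (F (Var i))) = poly_subst ?c ?w (Var i)"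
        unfolding forall_4' by (simp add: F_simps \<theta>_simps c chart_vars_def)
      then show ?thesis by blast
    qed
  qed (simp_all add: rhom_comp[OF rhom_emb rhom_comp[OF \<theta> F]] rhom_poly_subst c F_simps \<theta>_simps)
  have inj: "q = 0" if "\<theta> q = 0" for q
  proof -
    obtain p where p: "q = F p" using F_surj by blast
    have "poly_subst (\<lambda>a. a) ?w (map_coeffs ?c p) = 0"
      using \<theta>F[of p] that by (simp add: p rhom_0[OF rhom_emb] evl_def)
    then have "map_coeffs ?c p = 0" using w map_coeffs_polys[OF c] by (auto simp: indep_def)
    then have "p = 0" by (rule map_coeffs_eq_0[OF c, rotated]) (use Const_inj in auto)
    then show ?thesis by (simp add: p rhom_0[OF F])
  qed
  have surj: "\<exists>q. \<theta> q = a" for a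
  proof -
    have "range \<theta> = UNIV"
    proof (rule gen[OF subringset_range[OF \<theta>]])
      show "Const c \<in> range \<theta>" for c using \<theta>_simps(1)[of "Const c"] by (auto intro: range_eqI[OF sym])
      show "Var 0 \<in> range \<theta>" using \<theta>_simps(1)[of "Var 0"] by (auto intro: range_eqI[OF sym])
      show "v \<in> range \<theta>" using \<theta>_simps(1)[of "Var 1"] by (auto intro: range_eqI[OF sym])
      show "g \<in> range \<theta>" "h \<in> range \<theta>" using \<theta>_simps(2,3) by (auto intro: range_eqI[OF sym])
    qed
    then show ?thesis by (metis UNIV_I imageE)
  qed
  obtain \<theta>' where "rhom \<theta>'" "\<And>a. \<theta> (\<theta>' a) = a" "\<And>q. \<theta>' (\<theta> q) = q"
    using rhom_left_inverse[OF \<theta> surj inj] by blast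
  then show ?thesis unfolding trivializable_def using \<theta> \<theta>_simps(1) by blast
qed

text \<open>Localizing at 1 introduces no denominators, so the coordinates of the chart are
  polynomials and give \<open>\<theta>\<close> directly.\<close>

lemma trivializable_if_chart:
  fixes X :: "2 \<Rightarrow> A4fract"
  assumes inj_h: "inj (comorphism_xv v)" and chart: "chart (base_ring v) A_ring 1 X"
  shows "trivializable v"
proof -
  have inj: "r = 0" if "comorphism_xv v r = 0" for r
    using that injD[OF inj_h, of r 0] by (simp add: rhom_0[OF rhom_comorphism])
  have loc1: "loc S 1 = S" for S :: "A4fract set" by (simp add: loc_def)
  let ?e = "\<lambda>r. emb (comorphism_xv v r)"
  have e: "rhom ?e" by (rule rhom_comp[OF rhom_emb rhom_comorphism])
  have ind: "indep (base_ring v) X" and gen: "A_ring \<subseteq> adjoin (base_ring v) X" and "\<And>i. X i \<in> A_ring"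
    using chart by (auto simp: chart_def loc1)
  then obtain \<xi> where \<xi>: "\<And>i. X i = emb (\<xi> i)" unfolding image_iff by metis
  define \<theta> where "\<theta> = poly_subst (comorphism_xv v) \<xi>"
  have \<theta>: "rhom \<theta>" unfolding \<theta>_def by (intro rhom_poly_subst rhom_comorphism)
  have ev: "evl X (map_coeffs ?e q) = emb (\<theta> q)" for q
    unfolding evl_map_coeffs[OF e] \<theta>_def rhom_poly_subst_comp[OF rhom_emb rhom_comorphism]
    by (simp add: \<xi>[symmetric])
  have surj: "\<exists>q. \<theta> q = a" for a
  proof -
    have "emb a \<in> adjoin (base_ring v) X" using gen by blast
    then obtain p where p: "p \<in> polys (base_ring v)" "emb a = evl X p" unfolding adjoin_evl by blast
    then obtain q where "p = map_coeffs ?e q" using polys_range[OF e] by blast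
    then have "emb a = emb (\<theta> q)" using p(2) by (simp add: ev)
    then show ?thesis by auto
  qed
  have inj\<theta>: "q = 0" if "\<theta> q = 0" for q
  proof -
    have "poly_subst (\<lambda>a. a) X (map_coeffs ?e q) = 0"
      using ev[of q] that by (simp add: rhom_0[OF rhom_emb] evl_def)
    then have "map_coeffs ?e q = 0" using ind map_coeffs_polys[OF e] by (auto simp: indep_def)
    then show ?thesis by (rule map_coeffs_eq_0[OF e, rotated]) (use inj in auto)
  qed
  obtain \<theta>' where "rhom \<theta>'" "\<And>a. \<theta> (\<theta>' a) = a" "\<And>q. \<theta>' (\<theta> q) = q"
    using rhom_left_inverse[OF \<theta> surj inj\<theta>] by blast
  moreover have "\<theta> (Const r) = comorphism_xv v r" for r by (simp add: \<theta>_def rhom_comorphism)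
  ultimately show ?thesis unfolding trivializable_def using \<theta> by blast
qed

section \<open>Bundles over open sets of the plane and trivializations\<close>

lemma open_subspace_points: "points SpecT \<subseteq> W \<Longrightarrow> open_subspace SpecT W = SpecT"
  by (simp add: open_subspace_def Spec_def subtopology_superset)

lemma vimage_points:
  "rhom h \<Longrightarrow> vimage_in SpecT (SpecT_map h) (points SpecT) = points SpecT"
  unfolding vimage_in_SpecT points_SpecT using primeset_vimage by blast

lemma trivial_bundle_if_trivializable:
  assumes "trivializable v" "openin (zariski type_ring) U"
  shows "trivial_plane_bundle U
    (open_subspace A4 (vimage_in A4 (SpecT_map (comorphism_xv v)) U)) (SpecT_map (comorphism_xv v))"
proof -
  obtain \<theta> :: "(2, (2, complex) mpoly) mpoly \<Rightarrow> (4, complex) mpoly" and \<theta>' where \<theta>: "rhom \<theta>" "rhom \<theta>'"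
    "\<forall>a. \<theta> (\<theta>' a) = a" "\<forall>q. \<theta>' (\<theta> q) = q" "\<forall>r. \<theta> (Const r) = comorphism_xv v r"
    using assms(1) unfolding trivializable_def by blast
  show ?thesis
    by (rule trivial_plane_bundle_of_iso[OF rhom_comorphism \<theta>(1,2) \<theta>(3)[rule_format] \<theta>(4)[rule_format]
          \<theta>(5)[rule_format] assms(2)])
qed

lemma zero_in_open:
  fixes U :: "'a::idom set set"
  assumes "openin (zariski type_ring) U" "P \<in> U"
  shows "{0} \<in> U"
proof -
  obtain g where g: "g \<notin> P" "P \<in> basic_open g" "basic_open g \<subseteq> U" by (rule zariski_basis[OF assms])
  then have "g \<noteq> 0" by (auto simp: basic_open_def dest: primesetD(1) idealsetD(1))
  then show ?thesis using g(3) primeset_0 by (auto simp: basic_open_def)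
qed

text \<open>Some prime of the total space lies over the generic point of the base. It contracts to
  0, but its contraction contains everything that the comorphism sends to 0.\<close>

lemma bundle_comorphism_inj:
  assumes "openin (zariski type_ring) U" "P \<in> U"
    "trivial_plane_bundle U (open_subspace A4 W) (SpecT_map (comorphism_xv v))"
  shows "inj (comorphism_xv v)"
proof (rule injI)
  fix r s assume "comorphism_xv v r = comorphism_xv v s"
  then have 0: "comorphism_xv v (r - s) = 0" by (simp add: rhom_diff[OF rhom_comorphism])
  obtain Q where Q: "primeset Q" "{r. comorphism_xv v r \<in> Q} = {0}"
    using bundle_generic_point[OF rhom_comorphism assms(1) zero_in_open[OF assms(1,2)] assms(3)] by metis
  have "comorphism_xv v (r - s) \<in> Q" unfolding 0 by (rule idealsetD(1)[OF primesetD(1)[OF Q(1)]])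
  then have "r - s \<in> {0}" using Q(2) by blast
  then show "r = s" by simp
qed

text \<open>Each trivializing open set is shrunk to a basic one, which yields the local charts to be
  glued.\<close>

lemma trivializable_if_bundle:
  assumes "plane_bundle (points A2) A4 (SpecT_map (comorphism_xv v))"
  shows "trivializable v"
proof -
  let ?h = "comorphism_xv v"
  have loc: "\<exists>U. openin (zariski type_ring) U \<and> P \<in> U \<and>
      trivial_plane_bundle U (open_subspace A4 (vimage_in A4 (SpecT_map ?h) U)) (SpecT_map ?h)"
    if "primeset P" for P :: "(2, complex) mpoly set"
    using assms that unfolding plane_bundle_def points_SpecT by blast
  obtain U0 where U0: "openin (zariski type_ring) U0" "{0} \<in> U0"
    "trivial_plane_bundle U0 (open_subspace A4 (vimage_in A4 (SpecT_map ?h) U0)) (SpecT_map ?h)"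
    using loc[OF primeset_0] by blast
  have inj: "inj ?h" by (rule bundle_comorphism_inj[OF U0])
  have "\<exists>r X. r \<notin> P \<and> chart (base_ring v) A_ring (emb (?h r)) (X :: 2 \<Rightarrow> A4fract)" if P: "primeset P" for P
  proof -
    obtain U where U: "openin (zariski type_ring) U" "P \<in> U"
      "trivial_plane_bundle U (open_subspace A4 (vimage_in A4 (SpecT_map ?h) U)) (SpecT_map ?h)"
      using loc[OF P] by blast
    obtain f where f: "f \<notin> P" "basic_open f \<subseteq> U" by (rule zariski_basis[OF U(1,2)])
    have "f \<noteq> 0" using f(1) idealsetD(1)[OF primesetD(1)[OF P]] by auto
    show ?thesis
    proof (rule bundle_charts[OF rhom_comorphism U(1,3) inj zero_in_open[OF U(1,2)]])
      fix \<xi> :: "2 \<Rightarrow> A4fract"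
      assume "\<And>f. f \<noteq> 0 \<Longrightarrow> basic_open f \<subseteq> U \<Longrightarrow> chart (base_ring v) A_ring (emb (?h f)) \<xi>"
      then show ?thesis using f \<open>f \<noteq> 0\<close> by blast
    qed
  qed
  from global_chart[OF inj this] obtain X :: "2 \<Rightarrow> A4fract" where "chart (base_ring v) A_ring 1 X" by blast
  then show ?thesis by (rule trivializable_if_chart[OF inj])
qed

section \<open>The punctured plane\<close>

text \<open>Divisibility by a variable is vanishing under this homomorphism, so over a domain the
  variables are prime elements.\<close>

definition zero_var :: "'n::finite \<Rightarrow> ('n, 'a::comm_ring_1) mpoly \<Rightarrow> ('n, 'a) mpoly" where
  "zero_var i = sbst (\<lambda>j. if j = i then 0 else Var j)"

lemma rhom_zero_var: "rhom (zero_var i)"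
  by (simp add: zero_var_def rhom_sbst)

text \<open>A polynomial differs from its restriction to the hyperplane by a multiple of the
  variable: this holds for constants and variables and is preserved by differences and
  products.\<close>

lemma Var_dvd_iff:
  fixes p :: "('n::finite, 'a::comm_ring_1) mpoly"
  shows "Var i dvd p \<longleftrightarrow> zero_var i p = 0"
proof
  assume "Var i dvd p"
  then show "zero_var i p = 0" by (auto simp: rhom_mult[OF rhom_zero_var] elim!: dvdE) (simp add: zero_var_def)
next
  let ?T = "{p :: ('n, 'a) mpoly. Var i dvd p - zero_var i p}"
  have "subringset ?T"
    unfolding subringset_def
  proof (intro conjI ballI; clarsimp simp: rhom_simps[OF rhom_zero_var])
    fix a b :: "('n, 'a) mpoly" assume *: "Var i dvd a - zero_var i a" "Var i dvd b - zero_var i b"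
    have "a - b - (zero_var i a - zero_var i b) = (a - zero_var i a) - (b - zero_var i b)" by simp
    then show "Var i dvd a - b - (zero_var i a - zero_var i b)" using * by (metis dvd_diff)
    have "a * b - zero_var i a * zero_var i b = a * (b - zero_var i b) + zero_var i b * (a - zero_var i a)"
      by (simp add: algebra_simps)
    then show "Var i dvd a * b - zero_var i a * zero_var i b" using * by (metis dvd_add dvd_mult)
  qed
  moreover have "Const a \<in> ?T" "Var j \<in> ?T" for a j by (simp_all add: zero_var_def)
  ultimately have "polys UNIV \<subseteq> ?T" by (intro polys_subset_subringset) auto
  then have "Var i dvd p - zero_var i p" by auto
  then show "zero_var i p = 0 \<Longrightarrow> Var i dvd p" by simp
qed

lemma Var_nonzero: "(Var i :: ('n, 'a::comm_ring_1) mpoly) \<noteq> 0"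
  by (metis Var_def lookup_single_eq lookup_zero zero_neq_one)

lemma power_dvd_mult_cancel:
  fixes p :: "'a::idom"
  assumes "p \<noteq> 0" and prime: "\<And>a b. p dvd a * b \<Longrightarrow> p dvd a \<or> p dvd b" and "\<not> p dvd w"
  shows "p ^ n dvd w * a \<Longrightarrow> p ^ n dvd a"
proof (induction n)
  case (Suc n)
  then have "p ^ n dvd w * a" by (metis dvd_mult_right power_Suc dvd_trans dvd_refl)
  then obtain b where b: "a = p ^ n * b" using Suc.IH by (elim dvdE) auto
  have "p ^ n * p dvd p ^ n * (w * b)" using Suc.prems by (simp add: b mult_ac)
  then have "p dvd w * b" using assms(1) by (simp only: dvd_mult_cancel_left) auto
  then have "p dvd b" using prime assms(3) by blast
  then show ?case by (auto simp: b mult.commute)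
qed simp

text \<open>Comparing a / p^n with b / w^m shows that p^n divides w^m a. As \<open>p\<close> is
  prime and does not divide \<open>w\<close>, already \<open>a\<close> is divisible by p^n.\<close>

lemma loc_Int_coprime:
  fixes e :: "'d::idom \<Rightarrow> 'k::field"
  assumes e: "rhom e" and inj: "inj e" and "p \<noteq> 0"
    and prime: "\<And>a b. p dvd a * b \<Longrightarrow> p dvd a \<or> p dvd b" and w: "\<not> p dvd w"
  shows "loc (range e) (e p) \<inter> loc (range e) (e w) = range e"
proof (intro equalityI subsetI)
  fix c assume "c \<in> loc (range e) (e p) \<inter> loc (range e) (e w)"
  then obtain n m a b where nm: "e p ^ n * c = e a" "e w ^ m * c = e b" by (auto simp: loc_def)
  have "e (w ^ m * a) = e (p ^ n * b)"
    by (simp add: rhom_simps[OF e] nm[symmetric] mult_ac)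
  then have "w ^ m * a = p ^ n * b" by (rule injD[OF inj])
  then have "p ^ n dvd w ^ m * a" by simp
  moreover have "\<not> p dvd w ^ m"
  proof (induction m)
    case 0
    then show ?case using w by (metis dvd_trans one_dvd power_0)
  qed (use prime w in auto)
  ultimately have "p ^ n dvd a" using power_dvd_mult_cancel[of p "w ^ m" n a] assms(3) prime by blast
  then obtain d where "a = p ^ n * d" by (elim dvdE)
  then have "e p ^ n * c = e p ^ n * e d" using nm(1) by (simp add: rhom_simps[OF e])
  moreover have "e p \<noteq> 0" using injD[OF inj, of p 0] assms(3) by (auto simp: rhom_0[OF e])
  ultimately have "c = e d" by simp
  then show "c \<in> range e" by simp
qed (use loc_base[of "range e"] in auto)

lemma Var_prime:
  fixes a b :: "('n::{finite, linorder}, 'a::idom) mpoly"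
  assumes "Var i dvd a * b"
  shows "Var i dvd a \<or> Var i dvd b"
  using assms by (simp add: Var_dvd_iff rhom_mult[OF rhom_zero_var])

text \<open>Modulo the two variables every polynomial is congruent to its constant term.\<close>

lemma origin_eq: "origin = {p. evl (\<lambda>_. 0) p = 0}"
proof -
  interpret cring "type_ring :: (2, complex) mpoly ring" by (rule cring_from_type_algebra)
  have prime_id: "idealset origin"
  proof -
    have "ideal origin (type_ring :: (2, complex) mpoly ring)" unfolding origin_def by (rule genideal_ideal) simp
    then interpret I: ideal origin "type_ring :: (2, complex) mpoly ring" .
    show ?thesis
      unfolding idealset_def
      using additive_subgroup.zero_closed[OF I.is_additive_subgroup]
        additive_subgroup.a_closed[OF I.is_additive_subgroup] I.I_l_closed by auto
  qed
  have V: "Var 0 \<in> origin" "Var 1 \<in> origin" unfolding origin_def using genideal_self[of "{Var 0, Var 1}"] by auto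
  note i = idealsetD[OF prime_id]
  have ker: "primeset {p. evl (\<lambda>_. 0) p \<in> {0 :: complex}}"
    by (rule primeset_vimage[OF rhom_evl primeset_0])
  have sub: "origin \<subseteq> {p. evl (\<lambda>_. 0) p = 0}"
    unfolding origin_def
  proof (rule genideal_minimal)
    show "ideal {p. evl (\<lambda>_. 0) p = 0} (type_ring :: (2, complex) mpoly ring)"
      using ker primeideal.axioms(1) unfolding primeideal_type_ring[symmetric] singleton_iff by blast
  qed simp
  let ?T = "{p. p - Const (evl (\<lambda>_. 0) p) \<in> origin}"
  have "subringset ?T"
    unfolding subringset_def
  proof (intro conjI ballI; clarsimp simp: rhom_simps[OF rhom_evl] rhom_simps[OF rhom_Const] i(1))
    fix a b :: "(2, complex) mpoly" let ?e = "\<lambda>p. Const (evl (\<lambda>_. 0) p) :: (2, complex) mpoly"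
    assume *: "a - ?e a \<in> origin" "b - ?e b \<in> origin"
    have "a - b - (?e a - ?e b) = (a - ?e a) - (b - ?e b)" by simp
    then show "a - b - (?e a - ?e b) \<in> origin" using i(6)[OF *] by (simp only:)
    have "a * b - ?e a * ?e b = a * (b - ?e b) + ?e b * (a - ?e a)" by (simp add: algebra_simps)
    then show "a * b - ?e a * ?e b \<in> origin" using i(2)[OF i(3)[OF *(2), of a] i(3)[OF *(1), of "?e b"]] by (simp only:)
  qed
  moreover have "Const a \<in> ?T" for a using i(1) by simp
  moreover have "Var j \<in> ?T" for j by (rule forall_2_cases) (use V in simp_all)
  ultimately have "polys UNIV \<subseteq> ?T" by (intro polys_subset_subringset) auto
  then have "p - Const (evl (\<lambda>_. 0) p) \<in> origin" for p by auto
  then have "p \<in> origin" if "evl (\<lambda>_. 0) p = 0" for p using that by (metis Const_0 diff_zero)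
  then show ?thesis using sub by blast
qed

text \<open>The ideal of the origin is maximal: a polynomial that does not vanish there differs from
  a nonzero constant by an element of this ideal.\<close>

lemma prime_containing_vars:
  assumes P: "primeset P" and "Var 0 \<in> P" "Var 1 \<in> (P :: (2, complex) mpoly set)"
  shows "P = origin"
proof -
  note i = idealsetD[OF primesetD(1)[OF P]]
  interpret cring "type_ring :: (2, complex) mpoly ring" by (rule cring_from_type_algebra)
  have "origin \<subseteq> P"
    unfolding origin_def
  proof (rule genideal_minimal)
    show "ideal P (type_ring :: (2, complex) mpoly ring)"
      using P primeideal.axioms(1) unfolding primeideal_type_ring[symmetric] by blast
  qed (use assms in simp)
  moreover have "p \<in> origin" if p: "p \<in> P" for p
  proof (rule ccontr)
    assume "p \<notin> origin"
    then have c: "evl (\<lambda>_. 0) p \<noteq> 0" by (simp add: origin_eq)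
    have "p - Const (evl (\<lambda>_. 0) p) \<in> origin"
      by (simp add: origin_eq rhom_diff[OF rhom_evl])
    then have "p - (p - Const (evl (\<lambda>_. 0) p)) \<in> P" using \<open>origin \<subseteq> P\<close> i(6)[OF p] by blast
    then have "Const (inverse (evl (\<lambda>_. 0) p)) * Const (evl (\<lambda>_. 0) p) \<in> P" by (intro i(3)) simp
    then show False using c primesetD(2)[OF P] by (simp flip: rhom_mult[OF rhom_Const])
  qed
  ultimately show ?thesis by blast
qed

lemma punctured_plane_eq: "points A2 - {origin} = basic_open (Var 0) \<union> basic_open (Var 1)"
proof -
  have "Var 0 \<in> origin" "Var 1 \<in> origin" by (simp_all add: origin_eq)
  then show ?thesis unfolding points_SpecT basic_open_def using prime_containing_vars by blast
qed

lemma openin_punctured_plane: "openin (zariski type_ring) (points A2 - {origin})"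
  unfolding punctured_plane_eq by (intro openin_Un openin_basic_open)

text \<open>Functions on the complement of a set of codimension two extend: \<open>x\<close> and \<open>v\<close> have no common
  factor, since otherwise \<open>\<Phi>\<close> would miss the generic point of the line \<open>x = 0\<close>.\<close>

lemma trivializable_if_punctured_bundle:
  defines "U \<equiv> points A2 - {origin}"
  assumes triv: "trivial_plane_bundle U
    (open_subspace A4 (vimage_in A4 (SpecT_map (comorphism_xv v)) U)) (SpecT_map (comorphism_xv v))"
  shows "trivializable v"
proof -
  let ?h = "comorphism_xv v"
  have U: "openin (zariski type_ring) U" unfolding U_def by (rule openin_punctured_plane)
  have bU: "basic_open (Var 0) \<subseteq> U" "basic_open (Var 1) \<subseteq> U"
    unfolding U_def punctured_plane_eq by auto
  have "{0} \<in> basic_open (Var 0 :: (2, complex) mpoly)"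
    by (simp add: basic_open_def primeset_0 Var_nonzero)
  then have 0: "{0} \<in> U" using bU(1) by blast
  have inj: "inj ?h" by (rule bundle_comorphism_inj[OF U 0 triv])
  \<comment> \<open>The generic point of the line where the first coordinate vanishes. It belongs to
    the punctured plane because it does not contain the second coordinate.\<close>
  let ?L = "{r. zero_var 0 r \<in> {0}} :: (2, complex) mpoly set"
  have L1: "(Var 1 :: (2, complex) mpoly) \<notin> ?L" using Var_nonzero by (simp add: zero_var_def)
  have "primeset ?L" by (rule primeset_vimage[OF rhom_zero_var primeset_0])
  then have "?L \<in> U" using bU(2) L1 by (auto simp: basic_open_def)
  then obtain Q where Q: "primeset Q" "{r. ?h r \<in> Q} = ?L"
    using bundle_generic_point[OF rhom_comorphism U _ triv] by metis
  \<comment> \<open>If x divided v, every prime containing x would contain v; but \<open>Q\<close>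
    lies over the generic point of the line, so it contains x and not v.\<close>
  have xv: "\<not> Var 0 dvd v"
  proof
    assume "Var 0 dvd v"
    then obtain k where k: "v = k * Var 0" by (metis dvdE mult.commute)
    have "(Var 0 :: (2, complex) mpoly) \<in> ?L" by (simp add: zero_var_def)
    then have "?h (Var 0) \<in> Q" using Q(2) by blast
    then have "?h (Var 1) \<in> Q" using idealsetD(3)[OF primesetD(1)[OF Q(1)]] by (simp add: k)
    then show False using L1 Q(2) by blast
  qed
  have ab: "\<not> (Var 0 :: (2, complex) mpoly) dvd Var 1"
    using Var_nonzero by (simp add: Var_dvd_iff zero_var_def)
  show ?thesis
  proof (rule bundle_charts[OF rhom_comorphism U triv inj 0])
    fix \<xi> :: "2 \<Rightarrow> A4fract"
    assume \<xi>: "\<And>f. f \<noteq> 0 \<Longrightarrow> basic_open f \<subseteq> U \<Longrightarrow> chart (base_ring v) A_ring (emb (?h f)) \<xi>"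
    have x: "chart (base_ring v) A_ring (emb (Var 0)) \<xi>" and w: "chart (base_ring v) A_ring (emb v) \<xi>"
      using \<xi>[OF Var_nonzero bU(1)] \<xi>[OF Var_nonzero bU(2)] by simp_all
    have AA: "loc A_ring (emb (Var 0)) \<inter> loc A_ring (emb v) = A_ring"
      by (rule loc_Int_coprime[OF rhom_emb _ Var_nonzero Var_prime xv]) (simp add: inj_def)
    have SS: "loc (base_ring v) (emb (Var 0)) \<inter> loc (base_ring v) (emb v) = base_ring v"
      using loc_Int_coprime[OF rhom_comp[OF rhom_emb rhom_comorphism[of v]] _ Var_nonzero Var_prime ab] inj
      by (simp add: inj_def)
    note S = subringset_base[of v]
    have xS: "emb (Var 0) \<in> base_ring v" "emb v \<in> base_ring v"
      using comorphism_simps(2,3)[of v] by (metis rangeI)+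
    have nz: "emb (Var 0 :: (4, complex) mpoly) \<noteq> 0" "emb v \<noteq> 0" using xv by (auto simp: Var_nonzero)
    let ?T = "loc (base_ring v) (emb (Var 0) * emb v)"
    have xvS: "emb (Var 0) * emb v \<in> base_ring v" using xS S by (simp add: subringsetD)
    have T: "subringset ?T" by (rule subringset_loc[OF S xvS])
    have sT: "loc (base_ring v) (emb (Var 0)) \<subseteq> ?T" "loc (base_ring v) (emb v) \<subseteq> ?T"
      using loc_mult_subset[OF S xS(1) xS(2)] loc_mult_subset[OF S xS(2) xS(1)] by (simp_all add: mult.commute)
    have indT: "indep ?T \<xi>" using nz x by (intro indep_loc[OF S xvS]) (auto simp: chart_def)
    have loc1: "loc K 1 = K" for K :: "A4fract set" by (simp add: loc_def)
    \<comment> \<open>The same pair is a chart where x is nonzero and where v is nonzero.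
      Intersecting the two localizations, of \<open>A_ring\<close> for the coordinates and of
      \<open>base_ring v\<close> for the coefficients, removes all denominators.\<close>
    have "chart (base_ring v) A_ring 1 \<xi>"
      unfolding chart_def loc1
    proof (intro conjI allI subsetI)
      show "indep (base_ring v) \<xi>" using x by (simp add: chart_def)
      show "\<xi> i \<in> A_ring" for i using x w AA unfolding chart_def by blast
      fix a assume "a \<in> A_ring"
      then have "a \<in> adjoin (loc (base_ring v) (emb (Var 0))) \<xi>" "a \<in> adjoin (loc (base_ring v) (emb v)) \<xi>"
        using x w unfolding chart_def by blast+
      then obtain p q where pq: "p \<in> polys (loc (base_ring v) (emb (Var 0)))" "a = evl \<xi> p"
        "q \<in> polys (loc (base_ring v) (emb v))" "a = evl \<xi> q"
        unfolding adjoin_evl by blast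
      have "p = q"
        by (rule indep_evl_eqI[OF T indT]) (use pq polys_mono[OF sT(1)] polys_mono[OF sT(2)] in auto)
      then have "p \<in> polys (loc (base_ring v) (emb (Var 0)) \<inter> loc (base_ring v) (emb v))"
        using pq by (simp add: polys_Int)
      then show "a \<in> adjoin (base_ring v) \<xi>" using pq(2) unfolding SS adjoin_evl by blast
    qed
    then show "trivializable v" by (rule trivializable_if_chart[OF inj])
  qed
qed

theorem proposition1:
  fixes v :: "(4, complex) mpoly"
  defines "\<Phi> \<equiv> SpecT_map (comorphism_xv v)"
  defines "F0 \<equiv> vimage_in A4 \<Phi> {origin}"
  assumes "flat_family_of_affine_planes (comorphism_xv v)"
  shows "(x_variable v \<longleftrightarrow> plane_bundle (points A2) A4 \<Phi>) \<and>
         (plane_bundle (points A2) A4 \<Phi> \<longleftrightarrow> trivial_plane_bundle (points A2) A4 \<Phi>) \<and>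
         (trivial_plane_bundle (points A2) A4 \<Phi> \<longleftrightarrow>
            trivial_plane_bundle (points A2 - {origin}) (open_subspace A4 (points A4 - F0)) \<Phi>)"
proof -
  have openA2: "openin (zariski type_ring) (points A2)" by simp
  have whole: "open_subspace A4 (vimage_in A4 \<Phi> (points A2)) = A4"
    unfolding \<Phi>_def vimage_points[OF rhom_comorphism] by (rule open_subspace_points) simp
  \<comment> \<open>Every prime contracts to a prime, so the complement of the fibre over the origin
    is the preimage of the punctured plane.\<close>
  have punctured: "points A4 - F0 = vimage_in A4 \<Phi> (points A2 - {origin})"
    using primeset_vimage[OF rhom_comorphism[of v]]
    unfolding F0_def \<Phi>_def vimage_in_SpecT points_SpecT by blast
  have locally_trivial: "plane_bundle (points A2) A4 \<Phi>" if "trivial_plane_bundle (points A2) A4 \<Phi>"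
    unfolding plane_bundle_def
  proof (intro conjI ballI exI)
    show "morphism A4 (open_subspace A2 (points A2)) \<Phi>"
      using that unfolding trivial_plane_bundle_def isomorphic_over_def by blast
    show "trivial_plane_bundle (points A2) (open_subspace A4 (vimage_in A4 \<Phi> (points A2))) \<Phi>"
      unfolding whole by (rule that)
  qed (use openA2 in simp_all)
  have "trivial_plane_bundle (points A2) A4 \<Phi>" if "trivializable v"
    using trivial_bundle_if_trivializable[OF that openA2] unfolding \<Phi>_def[symmetric] whole .
  moreover have "trivial_plane_bundle (points A2 - {origin}) (open_subspace A4 (points A4 - F0)) \<Phi>"
    if "trivializable v"
    using trivial_bundle_if_trivializable[OF that openin_punctured_plane]
    unfolding \<Phi>_def[symmetric] punctured .
  moreover have "trivializable v" if "plane_bundle (points A2) A4 \<Phi>"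
    using that unfolding \<Phi>_def by (rule trivializable_if_bundle)
  moreover have "trivializable v"
    if "trivial_plane_bundle (points A2 - {origin}) (open_subspace A4 (points A4 - F0)) \<Phi>"
    using that unfolding punctured unfolding \<Phi>_def by (rule trivializable_if_punctured_bundle)
  moreover have "x_variable v \<longleftrightarrow> trivializable v"
    using x_variable_if_trivializable trivializable_if_x_variable by blast
  ultimately show ?thesis using locally_trivial by blast
qed

end
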